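(* Let $s$ be a string of length $n$ over an alphabet $\Sigma=[0,\sigma-1]$ with $\sigma\le n$ and $\sigma$ a power of $2$, given in packed form. Then all bitmasks $B_u$ of the wavelet tree of $s$ can be constructed in $\mathcal{O}(n\log\sigma/\sqrt{\log n})$ time.
   Context: Model: word RAM with machine words of $\log n$ bits. The input $s$ is packed: each character is a $\log\sigma$-bit integer and $\log n/\log\sigma$ characters are stored per machine word. The (binary) wavelet tree of $s$ is defined recursively: create a root $r$ with bitmask $B_r$ of length $|s|$, where $B_r[i]$ is the most significant bit of the $\log\sigma$-bit binary representation of $s[i]$; let $s_0$ (resp. $s_1$) be the subsequence of characters of $s$ whose most significant bit is $0$ (resp. $1$), with this bit removed; recursively build the wavelet trees of $s_0$ and $s_1$ (strings over $[0,\sigma/2-1]$) and attach them as the left and right children of $r$; stop when the alphabet is unary. Each bitmask is stored packed, starting at a new machine word. *)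

theory Defs
  imports Complex_Main
begin

section \<open>Word RAM\<close>

text \<open>
  Machine words are natural numbers below \<open>2 ^ w\<close>, where \<open>w\<close> is the word size. A program is a fixed
  finite text, so it mentions finitely many registers and finitely many arrays, each array being
  indexed by one machine word. This is the usual convention that O(1) arrays of O(n) words
  are addressable, without reserving address bits for the array name. Programs may depend neither
  on the word size nor on the input; constants are truncated to \<open>w\<close> bits.
\<close>

datatype binop = Add | Sub | Mul | Div | Mod | And | Or | Xor | Shl | Shr | Eq | Lt

datatype exp = Const nat | Reg nat | Op binop exp exp | Load nat exp

datatype com =
    Skip
  | Assign nat exp
  | Store nat exp exp
  | Seq com com
  | If exp com com
  | While exp com

record state =
  reg :: "nat \<Rightarrow> nat"
  mem :: "nat \<Rightarrow> nat \<Rightarrow> nat"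

fun eval_op :: "nat \<Rightarrow> binop \<Rightarrow> nat \<Rightarrow> nat \<Rightarrow> nat" where
  "eval_op w Add a b = (a + b) mod 2 ^ w"
| "eval_op w Sub a b = (a + 2 ^ w - b) mod 2 ^ w"
| "eval_op w Mul a b = (a * b) mod 2 ^ w"
| "eval_op w Div a b = a div b"
| "eval_op w Mod a b = a mod b"
| "eval_op w And a b = semiring_bit_operations_class.and a b"
| "eval_op w Or a b = semiring_bit_operations_class.or a b"
| "eval_op w Xor a b = semiring_bit_operations_class.xor a b"
| "eval_op w Shl a b = push_bit b a mod 2 ^ w"
| "eval_op w Shr a b = drop_bit b a"
| "eval_op w Eq a b = of_bool (a = b)"
| "eval_op w Lt a b = of_bool (a < b)"

fun eval :: "nat \<Rightarrow> exp \<Rightarrow> state \<Rightarrow> nat" where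
  "eval w (Const c) st = c mod 2 ^ w"
| "eval w (Reg r) st = reg st r"
| "eval w (Op f e1 e2) st = eval_op w f (eval w e1 st) (eval w e2 st)"
| "eval w (Load a e) st = mem st a (eval w e st)"

text \<open>Every constant, register access, operation and memory access takes unit time.\<close>

fun cost :: "exp \<Rightarrow> nat" where
  "cost (Const c) = 1"
| "cost (Reg r) = 1"
| "cost (Op f e1 e2) = cost e1 + cost e2 + 1"
| "cost (Load a e) = cost e + 1"

text \<open>
  \<open>run w P st t st'\<close>: with word size \<open>w\<close>, program \<open>P\<close> started in \<open>st\<close> halts in \<open>st'\<close> after \<open>t\<close> units
  of time.
\<close>

inductive run :: "nat \<Rightarrow> com \<Rightarrow> state \<Rightarrow> nat \<Rightarrow> state \<Rightarrow> bool" for w where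
  Skip: "run w Skip st 1 st"
| Assign: "run w (Assign r e) st (cost e + 1) (st\<lparr>reg := (reg st)(r := eval w e st)\<rparr>)"
| Store: "run w (Store a i e) st (cost i + cost e + 1)
    (st\<lparr>mem := (mem st)(a := (mem st a)(eval w i st := eval w e st))\<rparr>)"
| Seq: "run w P st t st' \<Longrightarrow> run w Q st' t' st'' \<Longrightarrow> run w (Seq P Q) st (t + t') st''"
| IfTrue: "eval w b st \<noteq> 0 \<Longrightarrow> run w P st t st' \<Longrightarrow> run w (If b P Q) st (cost b + 1 + t) st'"
| IfFalse: "eval w b st = 0 \<Longrightarrow> run w Q st t st' \<Longrightarrow> run w (If b P Q) st (cost b + 1 + t) st'"
| WhileFalse: "eval w b st = 0 \<Longrightarrow> run w (While b P) st (cost b + 1) st"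
| WhileTrue: "eval w b st \<noteq> 0 \<Longrightarrow> run w P st t st' \<Longrightarrow> run w (While b P) st' t' st'' \<Longrightarrow>
    run w (While b P) st (cost b + 1 + t + t') st''"

inductive_cases run_elims:
  "run w Skip st t st'"
  "run w (Assign r e) st t st'"
  "run w (Store a i e) st t st'"
  "run w (Seq P Q) st t st'"
  "run w (If b P Q) st t st'"
  "run w (While b P) st t st'"

lemma run_deterministic:
  "run w P st t st' \<Longrightarrow> run w P st u st'' \<Longrightarrow> u = t \<and> st'' = st'"
proof (induction arbitrary: u st'' rule: run.induct)
  case (Skip st)
  then show ?case by (auto elim: run_elims(1))
next
  case (Assign r e st)
  then show ?case by (auto elim: run_elims(2))
next
  case (Store a i e st)
  then show ?case by (auto elim: run_elims(3))
next
  case (Seq P st t st' Q t' st1)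
  from Seq.prems show ?case by (rule run_elims(4)) (metis Seq.IH)
next
  case (IfTrue b st P t st' Q)
  from IfTrue.prems show ?case
    by (rule run_elims(5)) (use IfTrue.hyps(1) in \<open>auto dest!: IfTrue.IH\<close>)
next
  case (IfFalse b st Q t st' P)
  from IfFalse.prems show ?case
    by (rule run_elims(5)) (use IfFalse.hyps(1) in \<open>auto dest!: IfFalse.IH\<close>)
next
  case (WhileFalse b st P)
  from WhileFalse.prems show ?case by (rule run_elims(6)) (use WhileFalse.hyps in simp_all)
next
  case (WhileTrue b st P t st' t' st1)
  from WhileTrue.prems show ?case
  proof (rule run_elims(6), goal_cases)
    case 1
    with WhileTrue.hyps(1) show ?case by simp
  next
    case (2 v st2 v')
    have "v = t \<and> st2 = st'" using 2 by (intro WhileTrue.IH(1)) auto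
    moreover from this have "v' = t' \<and> st'' = st1" using 2 by (intro WhileTrue.IH(2)) auto
    ultimately show ?case using 2 by simp
  qed
qed

text \<open>
  Words of \<open>log n\<close> bits, rounded so that every number up to \<open>2 * n\<close> is a machine word. Since every
  bitmask starts at a new word, the bitmasks of a wavelet tree may need more than \<open>n\<close>, but always
  fewer than \<open>2 * n\<close>, words, and each of these must be addressable.
\<close>

definition word_size :: "nat \<Rightarrow> nat" where
  "word_size n = nat \<lfloor>log 2 (real n)\<rfloor> + 2"


section \<open>Packed sequences\<close>

text \<open>
  \<open>packed w b xs j\<close> is the \<open>j\<close>-th word of the packed form of the sequence \<open>xs\<close> of \<open>b\<close>-bit integers:
  it holds \<open>w div b\<close> consecutive entries, the first of them in the lowest bits. Unused
  positions are zero.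
\<close>

definition packed :: "nat \<Rightarrow> nat \<Rightarrow> nat list \<Rightarrow> nat \<Rightarrow> nat" where
  "packed w b xs j = (let p = w div b in horner_sum id (2 ^ b) (take p (drop (p * j) xs)))"

definition packed_bits :: "nat \<Rightarrow> bool list \<Rightarrow> nat \<Rightarrow> nat" where
  "packed_bits w B = packed w 1 (map of_bool B)"

definition num_words :: "nat \<Rightarrow> bool list \<Rightarrow> nat" where
  "num_words w B = nat \<lceil>real (length B) / real w\<rceil>"


section \<open>Wavelet trees\<close>

datatype wtree = Leaf | Node "bool list" wtree wtree

text \<open>The first argument is the number of bits per character, that is \<open>log \<sigma>\<close>.\<close>

fun wavelet_tree :: "nat \<Rightarrow> nat list \<Rightarrow> wtree" where
  "wavelet_tree 0 s = Leaf"
| "wavelet_tree (Suc k) s =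
    Node (map (\<lambda>c. bit c k) s)
      (wavelet_tree k (map (take_bit k) (filter (\<lambda>c. \<not> bit c k) s)))
      (wavelet_tree k (map (take_bit k) (filter (\<lambda>c. bit c k) s)))"

text \<open>
  The bitmasks of a tree, tagged with the position of their node when the root has position \<open>v\<close> and
  the children of the node at position \<open>u\<close> are at \<open>2 * u\<close> and \<open>2 * u + 1\<close>.
\<close>

fun bitmasks :: "nat \<Rightarrow> wtree \<Rightarrow> (nat \<times> bool list) set" where
  "bitmasks v Leaf = {}"
| "bitmasks v (Node B l r) = insert (v, B) (bitmasks (2 * v) l \<union> bitmasks (2 * v + 1) r)"


section \<open>Input and output conventions\<close>

text \<open>
  Registers 0 and 1 hold \<open>n\<close> and \<open>\<sigma> = 2 ^ k\<close>, array 0 holds the packed string, everything else is 0.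
\<close>

definition input_state :: "nat \<Rightarrow> nat list \<Rightarrow> state" where
  "input_state k s =
    \<lparr>reg = (\<lambda>_. 0)(0 := length s, 1 := 2 ^ k),
     mem = (\<lambda>_ _. 0)(0 := packed (word_size (length s)) k s)\<rparr>"

text \<open>
  The bitmasks are stored in array 2, in pairwise disjoint blocks of words; entry \<open>v\<close> of array 1 is
  the address of the block for the node at position \<open>v\<close>, the root having position 1.
\<close>

definition stores_bitmasks :: "nat \<Rightarrow> wtree \<Rightarrow> state \<Rightarrow> bool" where
  "stores_bitmasks w T st \<longleftrightarrow>
    (\<forall>(v, B) \<in> bitmasks 1 T.
       mem st 1 v + num_words w B \<le> 2 ^ w \<and>
       (\<forall>j < num_words w B. mem st 2 (mem st 1 v + j) = packed_bits w B j)) \<and>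
    (\<forall>(v, B) \<in> bitmasks 1 T. \<forall>(v', B') \<in> bitmasks 1 T. v \<noteq> v' \<longrightarrow>
       {mem st 1 v ..< mem st 1 v + num_words w B} \<inter>
       {mem st 1 v' ..< mem st 1 v' + num_words w B'} = {})"

text \<open>
  For \<open>\<sigma> \<ge> 2\<close> the quotient is at least 1. The maximum only matters for \<open>\<sigma> = 1\<close>, where the quotient is
  0 although starting and halting already takes constant time.
\<close>

definition time_bound :: "nat \<Rightarrow> nat \<Rightarrow> real" where
  "time_bound n \<sigma> = max 1 (real n * log 2 (real \<sigma>) / sqrt (log 2 (real n)))"

lemma time_bound_eq:
  assumes "2 \<le> \<sigma>" "\<sigma> \<le> n"
  shows "time_bound n \<sigma> = real n * log 2 (real \<sigma>) / sqrt (log 2 (real n))"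
proof -
  have n: "2 \<le> real n" using assms by linarith
  have "log 2 2 \<le> log 2 (real n)" using n by (subst log_le_cancel_iff) auto
  then have pos: "1 \<le> log 2 (real n)" by simp
  have "log 2 2 \<le> log 2 (real \<sigma>)" using assms by (subst log_le_cancel_iff) auto
  then have s: "1 \<le> log 2 (real \<sigma>)" by simp
  have "real n < 2 ^ n" by (rule of_nat_less_two_power)
  then have "log 2 (real n) \<le> real n" using n by (intro less_imp_le log2_of_power_less) auto
  also have "real n \<le> (real n)\<^sup>2" using n by (simp add: power2_eq_square)
  finally have "sqrt (log 2 (real n)) \<le> real n" using n by (intro real_le_lsqrt) auto
  also have "\<dots> \<le> real n * log 2 (real \<sigma>)" using n s by simp
  finally show ?thesis using pos by (simp add: time_bound_def max_def)
qed

end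

theory Submission
  imports Defs "HOL-Library.Discrete_Functions"
begin

text \<open>
  Let \<open>\<tau>\<close> be about the square root of half the word size. The nodes are processed in heap order. While
  level \<open>d\<close> is processed, each character is represented only by a digit of at most \<open>\<tau>\<close> of its bits,
  among them the one that decides level \<open>d\<close>. The digits of all characters, sorted stably by their top
  \<open>d\<close> bits, form a single packed bit stream. Processing a node reads its part of the stream in chunks
  of \<open>\<tau>\<close> digits, that is of at most half a word, and looks up in tables of size at most \<open>2 ^ (w / 2)\<close>
  the bits of a chunk and its digits with bit 0 and with bit 1. Appending the results to the bitmask
  and to the stream of the next level costs constant time per chunk, hence \<open>n / \<tau>\<close> per level plus a
  constant per node. When the bits of the digits are used up, which happens about \<open>k / \<tau>\<close> times, the
  stream is rebuilt by a counting sort in linear time. If \<open>k \<le> \<tau>\<close>, the characters themselves serve as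
  digits and the packed input is copied word by word, because linear time would be too much.
\<close>

section \<open>Total correctness with running time\<close>

text \<open>The square root comes from a balance. With digits of d bits and chunks of m digits, a
  level costs about n / m, and a rebuild costs n once per d levels; over k levels this is about k *
  n * (1 / m + 1 / d). A chunk has to serve as a table index, so m * d is limited to w / 2, and m =
  d = sqrt (w / 2) is the best choice. The limit w / 2 rather than w keeps a table at about sqrt n
  entries. This matters because the bit that decides a level moves inside the digit from level to
  level, so the tables are recomputed for each level. The constant per node adds up to about 2 ^ k.
  Comparing it with n is not enough when k is small, since the bound is then below n; the growth of
  2 ^ j / j settles this. The other obstacle is arithmetic: every address, offset and product formed
  by the program must fit in one word of floor (log n) + 2 bits, although a stream can have far more
  than n bits.\<close>

abbreviation Seq_infix :: "com \<Rightarrow> com \<Rightarrow> com" (infixr ";;" 60) where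
  "P ;; Q \<equiv> Seq P Q"

text \<open>Time is an argument of the postcondition, so correctness and cost are proved together.
  Runs are deterministic, so the existence of one halting run is total correctness.\<close>

definition wp :: "nat \<Rightarrow> com \<Rightarrow> state \<Rightarrow> (nat \<Rightarrow> state \<Rightarrow> bool) \<Rightarrow> bool" where
  "wp w P st Q \<longleftrightarrow> (\<exists>t st'. run w P st t st' \<and> Q t st')"

lemma wp_Skip: "wp w Skip st Q \<longleftrightarrow> Q 1 st"
  unfolding wp_def by (metis run.Skip run_elims(1))

lemma wp_Assign:
  "wp w (Assign r e) st Q \<longleftrightarrow> Q (cost e + 1) (st\<lparr>reg := (reg st)(r := eval w e st)\<rparr>)"
  unfolding wp_def by (metis run.Assign run_elims(2))

lemma wp_Store:
  "wp w (Store a i e) st Q \<longleftrightarrow> Q (cost i + cost e + 1)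
     (st\<lparr>mem := (mem st)(a := (mem st a)(eval w i st := eval w e st))\<rparr>)"
  unfolding wp_def by (metis run.Store run_elims(3))

lemma wp_Seq: "wp w (P ;; R) st Q \<longleftrightarrow> wp w P st (\<lambda>t st'. wp w R st' (\<lambda>t'. Q (t + t')))"
  unfolding wp_def by (metis run.Seq run_elims(4))

lemma wp_If:
  "wp w (If b P R) st Q \<longleftrightarrow>
     (if eval w b st \<noteq> 0 then wp w P st (\<lambda>t. Q (cost b + 1 + t)) else wp w R st (\<lambda>t. Q (cost b + 1 + t)))"
  unfolding wp_def
  by (auto intro: run.IfTrue[simplified] run.IfFalse[simplified] elim!: run_elims(5))

lemma wp_While:
  "wp w (While b P) st Q \<longleftrightarrow>
     (if eval w b st \<noteq> 0 then wp w P st (\<lambda>t st'. wp w (While b P) st' (\<lambda>t'. Q (cost b + 1 + t + t')))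
      else Q (cost b + 1) st)"
proof (cases "eval w b st = 0")
  case True
  then show ?thesis unfolding wp_def
    by (auto intro: run.WhileFalse[simplified] elim!: run_elims(6)[of w b P st])
next
  case False
  show ?thesis
  proof
    assume "wp w (While b P) st Q"
    then show "if eval w b st \<noteq> 0 then wp w P st (\<lambda>t st'. wp w (While b P) st' (\<lambda>t'. Q (cost b + 1 + t + t')))
      else Q (cost b + 1) st"
      using False unfolding wp_def by (auto elim!: run_elims(6)[of w b P st])
  next
    assume "if eval w b st \<noteq> 0 then wp w P st (\<lambda>t st'. wp w (While b P) st' (\<lambda>t'. Q (cost b + 1 + t + t')))
      else Q (cost b + 1) st"
    then obtain t st' t' st'' where "run w P st t st'" "run w (While b P) st' t' st''"
      "Q (cost b + 1 + t + t') st''"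
      using False unfolding wp_def by auto
    then show "wp w (While b P) st Q" using run.WhileTrue[OF False] unfolding wp_def by blast
  qed
qed

lemmas wp_simps = wp_Skip wp_Assign wp_Store wp_Seq wp_If

lemma wp_mono: "wp w P st Q \<Longrightarrow> (\<And>t s. Q t s \<Longrightarrow> Q' t s) \<Longrightarrow> wp w P st Q'"
  unfolding wp_def by blast

section \<open>Frame conditions: what a program cannot change\<close>

fun written_regs :: "com \<Rightarrow> nat set" where
  "written_regs Skip = {}"
| "written_regs (Assign r e) = {r}"
| "written_regs (Store a i e) = {}"
| "written_regs (Seq P Q) = written_regs P \<union> written_regs Q"
| "written_regs (If b P Q) = written_regs P \<union> written_regs Q"
| "written_regs (While b P) = written_regs P"

fun written_arrays :: "com \<Rightarrow> nat set" where
  "written_arrays Skip = {}"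
| "written_arrays (Assign r e) = {}"
| "written_arrays (Store a i e) = {a}"
| "written_arrays (Seq P Q) = written_arrays P \<union> written_arrays Q"
| "written_arrays (If b P Q) = written_arrays P \<union> written_arrays Q"
| "written_arrays (While b P) = written_arrays P"

text \<open>Arrays are framed as a whole. Facts about untouched cells of an array that is written
  have to be stated in the postconditions.\<close>

definition agree :: "com \<Rightarrow> state \<Rightarrow> state \<Rightarrow> bool" where
  "agree P s s' \<longleftrightarrow> (\<forall>r. r \<notin> written_regs P \<longrightarrow> reg s' r = reg s r) \<and>
     (\<forall>a. a \<notin> written_arrays P \<longrightarrow> mem s' a = mem s a)"

lemma agree_refl [simp]: "agree P s s"
  by (simp add: agree_def)

lemma agree_trans: "agree P s s' \<Longrightarrow> agree P s' s'' \<Longrightarrow> agree P s s''"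
  by (simp add: agree_def)

lemma run_agree: "run w P st t st' \<Longrightarrow> agree P st st'"
  by (induction rule: run.induct) (auto simp: agree_def)

lemma wp_agree: "wp w P st Q \<Longrightarrow> wp w P st (\<lambda>t s. Q t s \<and> agree P st s)"
  unfolding wp_def using run_agree by blast

lemma wp_mono_agree:
  "wp w P st Q \<Longrightarrow> (\<And>t s. Q t s \<Longrightarrow> agree P st s \<Longrightarrow> Q' t s) \<Longrightarrow> wp w P st Q'"
  by (drule wp_agree) (erule wp_mono, blast)

lemma agree_While [simp]: "agree (While b P) = agree P"
  by (simp add: agree_def fun_eq_iff)

text \<open>Induction on the number of rounds left; the test is evaluated \<open>N + 1\<close>
  times. The body and the exit condition may use agreement with the initial state, so an invariant
  needs to mention only what the loop changes.\<close>

lemma wp_While_rule: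
  assumes "I 0 st"
    and body: "\<And>i s. i < N \<Longrightarrow> I i s \<Longrightarrow> agree (While b P) st s \<Longrightarrow>
      eval w b s \<noteq> 0 \<and> wp w P s (\<lambda>t s'. t \<le> T i \<and> I (Suc i) s')"
    and exit: "\<And>s. I N s \<Longrightarrow> agree (While b P) st s \<Longrightarrow> eval w b s = 0"
  shows "wp w (While b P) st (\<lambda>t s. t \<le> (\<Sum>i<N. T i) + (N + 1) * (cost b + 1) \<and> I N s)"
proof -
  have "wp w (While b P) s
      (\<lambda>t s. t \<le> (\<Sum>i\<in>{i..<N}. T i) + (N - i + 1) * (cost b + 1) \<and> I N s)"
    if "i \<le> N" "I i s" "agree P st s" for i s
    using that
  proof (induction "N - i" arbitrary: i s)
    case 0
    then have "i = N" by simp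
    with 0 exit show ?case by (subst wp_While) auto
  next
    case (Suc x)
    then have i: "i < N" by simp
    from body[OF i Suc.prems(2)] Suc.prems(3) have b: "eval w b s \<noteq> 0"
      and P: "wp w P s (\<lambda>t s'. t \<le> T i \<and> I (Suc i) s')" by auto
    show ?case
      apply (subst wp_While)
      using b apply simp
      apply (rule wp_mono_agree[OF P])
      apply (rule wp_mono)
       apply (rule Suc.hyps(1)[of "Suc i"])
      using Suc i apply (auto intro: agree_trans)
      apply (subst sum.atLeast_Suc_lessThan[OF i])
      apply (subgoal_tac "N - i = Suc (N - Suc i)")
       apply (auto simp: algebra_simps)
      done
  qed
  from this[of 0 st] assms(1) show ?thesis by (simp add: lessThan_atLeast0)
qed

section \<open>Bit streams\<close>

abbreviation val :: "bool list \<Rightarrow> nat" where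
  "val \<equiv> horner_sum of_bool 2"

lemma bit_val: "bit (val bs) i \<longleftrightarrow> i < length bs \<and> bs ! i"
  by (simp add: bit_horner_sum_bit_iff)

lemma val_less: "val bs < 2 ^ length bs"
  by (rule horner_sum_of_bool_2_less)

lemma val_append: "val (bs @ cs) = val bs + 2 ^ length bs * val cs"
  by (simp add: horner_sum_append)

text \<open>The bound on \<open>q\<close> is not strict: the word in which the next bit will land is
  included even if it holds no bit of \<open>L\<close> yet. It is zero above the end of
  \<open>L\<close>, so an append may merge into it by a bitwise or.\<close>

definition stream :: "nat \<Rightarrow> (nat \<Rightarrow> nat) \<Rightarrow> nat \<Rightarrow> bool list \<Rightarrow> bool" where
  "stream w A b L \<longleftrightarrow> (\<forall>q \<le> length L div w. A (b + q) = val (take w (drop (w * q) L)))"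

lemma stream_Nil: "stream w A b [] \<longleftrightarrow> A b = 0"
  by (simp add: stream_def)

lemma stream_bit:
  assumes "stream w A b L" "i < length L" "0 < w"
  shows "bit (A (b + i div w)) (i mod w) = L ! i"
proof -
  have "i div w \<le> length L div w" using assms by (simp add: div_le_mono)
  with assms(1) have "A (b + i div w) = val (take w (drop (w * (i div w)) L))" by (simp add: stream_def)
  moreover have "i mod w < w" using assms by simp
  moreover have "i mod w < length L - w * (i div w)"
    using assms(2) mult_div_mod_eq[of w i] by linarith
  ultimately show ?thesis using assms(2) by (simp add: bit_val)
qed

text \<open>
  The second word is overwritten, not merged: it has no bits of \<open>L\<close>, and afterwards the word that the
  stream ends in has no garbage above the end.
\<close>

lemma stream_append:
  assumes "stream w A b L" "length x \<le> w" "0 < w"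
  defines "q \<equiv> length L div w" and "r \<equiv> length L mod w"
  shows "stream w (A(b + q := or (A (b + q)) (push_bit r (val x) mod 2 ^ w),
                     Suc (b + q) := drop_bit (w - r) (val x))) b (L @ x)"
  unfolding stream_def
proof (intro allI impI)
  fix q' assume q': "q' \<le> length (L @ x) div w"
  have L: "length L = w * q + r" "r < w" using assms by (simp_all add: q_def r_def)
  \<comment> \<open>Since \<open>r < w\<close> and \<open>length x <= w\<close>, an append crosses
    at most one word boundary, so only the words \<open>q\<close> and \<open>Suc q\<close> can
    change.\<close>
  have "length (L @ x) < w * (q + 2)" using L assms(2) by simp
  then have "q' < q + 2" using q'
    by (metis assms(3) div_less_iff_less_mult le_less_trans mult.commute)
  then consider "q' < q" | "q' = q" | "q' = Suc q" by linarith
  then show "(A(b + q := or (A (b + q)) (push_bit r (val x) mod 2 ^ w),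
      Suc (b + q) := drop_bit (w - r) (val x))) (b + q') = val (take w (drop (w * q') (L @ x)))"
  proof cases
    case 1
    have "w * Suc q' \<le> w * q" using 1 by (intro mult_le_mono2) simp
    then have "w * q' \<le> length L" "w \<le> length L - w * q'" using L by simp_all
    then have "take w (drop (w * q') (L @ x)) = take w (drop (w * q') L)" by simp
    then show ?thesis using 1 assms(1) by (simp add: stream_def q_def del: take_append drop_append)
  next
    case 2
    have A: "A (b + q) = val (take w (drop (w * q) L))" using assms(1) by (simp add: stream_def q_def)
    have "or (A (b + q)) (push_bit r (val x) mod 2 ^ w) = val (take w (drop (w * q) (L @ x)))"
      unfolding A using L
      by (intro bit_eqI) (auto simp: bit_simps bit_val nth_append take_bit_eq_mod[symmetric])
    with 2 show ?thesis by simp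
  next
    case 3
    have "drop_bit (w - r) (val x) = val (take w (drop (w * Suc q) (L @ x)))"
      using L assms(2)
      by (intro bit_eqI) (auto simp: bit_simps bit_val nth_append algebra_simps)
    with 3 show ?thesis by simp
  qed
qed

text \<open>Word index and bit offset of the bit position \<open>j * u\<close>. The product itself
  may overflow a machine word, whereas \<open>j mod w * u\<close> stays below
  \<open>w * u\<close>.\<close>

lemma div_mod_scale:
  fixes j u w :: nat assumes "0 < w"
  shows "j div w * u + (j mod w * u) div w = (j * u) div w" "(j mod w * u) mod w = (j * u) mod w"
proof -
  have "j * u = (j div w * w + j mod w) * u" by simp
  also have "\<dots> = w * (j div w * u) + j mod w * u" by (simp only: algebra_simps)
  finally have *: "j * u = w * (j div w * u) + j mod w * u" .
  show "j div w * u + (j mod w * u) div w = (j * u) div w"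
    by (simp only: *) (use assms in simp)
  show "(j mod w * u) mod w = (j * u) mod w" by (simp add: mod_mult_left_eq)
qed

section \<open>Programs appending to and reading from bit streams\<close>

abbreviation add_exp (infixl "+\<^sub>e" 65) where "a +\<^sub>e b \<equiv> Op Add a b"
abbreviation sub_exp (infixl "-\<^sub>e" 65) where "a -\<^sub>e b \<equiv> Op Sub a b"
abbreviation mul_exp (infixl "*\<^sub>e" 70) where "a *\<^sub>e b \<equiv> Op Mul a b"
abbreviation div_exp (infixl "div\<^sub>e" 70) where "a div\<^sub>e b \<equiv> Op Div a b"
abbreviation mod_exp (infixl "mod\<^sub>e" 70) where "a mod\<^sub>e b \<equiv> Op Mod a b"
abbreviation shl_exp (infixl "<<\<^sub>e" 67) where "a <<\<^sub>e b \<equiv> Op Shl a b"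
abbreviation shr_exp (infixl ">>\<^sub>e" 67) where "a >>\<^sub>e b \<equiv> Op Shr a b"
abbreviation and_exp (infixl "&\<^sub>e" 62) where "a &\<^sub>e b \<equiv> Op And a b"
abbreviation or_exp (infixl "|\<^sub>e" 61) where "a |\<^sub>e b \<equiv> Op Or a b"
abbreviation less_exp (infix "<\<^sub>e" 50) where "a <\<^sub>e b \<equiv> Op Lt a b"

text \<open>
  Arrays 3 and 4 hold the digit streams of the current and of the next level, array 9 the sizes of the
  nodes. In the counting sort, array 10 holds the next free position of each node and array 11 the
  sorted digits.
\<close>

abbreviation (input) "r_w \<equiv> 2 :: nat"
abbreviation (input) "r_k \<equiv> 3 :: nat"
abbreviation (input) "r_chunk \<equiv> 4 :: nat"
abbreviation (input) "r_width \<equiv> 5 :: nat"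
abbreviation (input) "r_depth \<equiv> 6 :: nat"
abbreviation (input) "r_node \<equiv> 7 :: nat"
abbreviation (input) "r_shift \<equiv> 8 :: nat"
abbreviation (input) "r_bit \<equiv> 9 :: nat"
abbreviation (input) "r_out \<equiv> 10 :: nat"
abbreviation (input) "r_start \<equiv> 11 :: nat"
abbreviation (input) "r_pos \<equiv> 12 :: nat"
abbreviation (input) "r_i \<equiv> 13 :: nat"
abbreviation (input) "r_end \<equiv> 14 :: nat"
abbreviation (input) "r_step \<equiv> 15 :: nat"
abbreviation (input) "r_len \<equiv> 16 :: nat"
abbreviation (input) "r_val \<equiv> 17 :: nat"
abbreviation (input) "r_cnt \<equiv> 18 :: nat"
abbreviation (input) "r_t \<equiv> 19 :: nat"
abbreviation (input) "r_q \<equiv> 20 :: nat"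
abbreviation (input) "r_r \<equiv> 21 :: nat"
abbreviation (input) "r_j \<equiv> 22 :: nat"
abbreviation (input) "r_base \<equiv> 23 :: nat"
abbreviation (input) "r_unit \<equiv> 24 :: nat"
abbreviation (input) "r_per_word \<equiv> 25 :: nat"
abbreviation (input) "r_x \<equiv> 26 :: nat"
abbreviation (input) "r_y \<equiv> 27 :: nat"
abbreviation (input) "r_g \<equiv> 28 :: nat"

text \<open>
  Positions are counted in units of \<open>r_unit\<close> bits, since bit positions need not fit in a machine word.
\<close>

definition append_prog :: "nat \<Rightarrow> com" where
  "append_prog a =
     Assign r_t (Reg r_j mod\<^sub>e Reg r_w *\<^sub>e Reg r_unit) ;;
     Assign r_q (Reg r_base +\<^sub>e (Reg r_j div\<^sub>e Reg r_w *\<^sub>e Reg r_unit +\<^sub>e Reg r_t div\<^sub>e Reg r_w)) ;;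
     Assign r_r (Reg r_t mod\<^sub>e Reg r_w) ;;
     Store a (Reg r_q) (Load a (Reg r_q) |\<^sub>e (Reg r_val <<\<^sub>e Reg r_r)) ;;
     Store a (Reg r_q +\<^sub>e Const 1) (Reg r_val >>\<^sub>e (Reg r_w -\<^sub>e Reg r_r)) ;;
     Assign r_j (Reg r_j +\<^sub>e Reg r_cnt)"

lemma eval_Add: "eval w e1 st + eval w e2 st < 2 ^ w \<Longrightarrow> eval w (e1 +\<^sub>e e2) st = eval w e1 st + eval w e2 st"
  by simp

lemma sub_mod_eq:
  fixes a b :: nat assumes "b \<le> a" "a < 2 ^ w"
  shows "(a + 2 ^ w - b) mod 2 ^ w = a - b"
proof -
  have "a + 2 ^ w - b = (a - b) + 2 ^ w" using assms by simp
  also have "\<dots> mod 2 ^ w = a - b"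
    using assms by (simp only: mod_add_self2) (simp add: less_imp_diff_less)
  finally show ?thesis .
qed

lemma eval_Sub: "eval w e2 st \<le> eval w e1 st \<Longrightarrow> eval w e1 st < 2 ^ w \<Longrightarrow>
    eval w (e1 -\<^sub>e e2) st = eval w e1 st - eval w e2 st"
  by (simp add: sub_mod_eq)

text \<open>The cells below \<open>b\<close> are reported as unchanged because array 2 holds the
  bitmasks of earlier nodes there, which \<open>agree\<close> cannot protect.\<close>

lemma append_prog:
  assumes "reg st r_w = w" "2 \<le> w" "reg st r_unit = u" "w * u < 2 ^ w" "reg st r_base = b"
    and "reg st r_j * u = length L" "stream w (mem st a) b L" "b + length L div w + 1 < 2 ^ w"
    and "reg st r_val = val x" "length x \<le> w" "reg st r_j + reg st r_cnt < 2 ^ w"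
  shows "wp w (append_prog a) st (\<lambda>t s. t \<le> 50 \<and> reg s r_j = reg st r_j + reg st r_cnt \<and>
    stream w (mem s a) b (L @ x) \<and> (\<forall>q<b. mem s a q = mem st a q))"
proof -
  let ?j = "reg st r_j"
  have w: "0 < w" "w < 2 ^ w" using assms(2) by simp_all
  have "?j mod w * u \<le> w * u" using w by (intro mult_le_mono1) (simp add: less_imp_le)
  then have t: "?j mod w * u < 2 ^ w" using assms(4) by linarith
  have q: "?j div w * u + (?j mod w * u) div w = length L div w"
    using div_mod_scale(1)[OF w(1), of ?j u] assms(6) by simp
  then have "?j div w * u < 2 ^ w" using assms(8) by linarith
  moreover have r: "(?j mod w * u) mod w = length L mod w"
    using div_mod_scale(2)[OF w(1), of ?j u] assms(6) by simp
  moreover have "(w + 2 ^ w - length L mod w) mod 2 ^ w = w - length L mod w"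
    using w by (intro sub_mod_eq) (simp_all add: less_imp_le)
  ultimately show ?thesis
    using assms t w stream_append[OF assms(7,10) w(1)]
    by (auto simp: append_prog_def wp_simps q r)
qed

definition pass_prog :: "nat \<Rightarrow> exp \<Rightarrow> exp \<Rightarrow> com" where
  "pass_prog a ev ec =
     While (Reg r_i <\<^sub>e Reg r_end) (
       If (Reg r_end -\<^sub>e Reg r_i <\<^sub>e Reg r_step) (Assign r_len (Reg r_end -\<^sub>e Reg r_i))
         (Assign r_len (Reg r_step)) ;;
       Assign r_val ev ;;
       Assign r_cnt ec ;;
       append_prog a ;;
       Assign r_i (Reg r_i +\<^sub>e Reg r_len))"

lemma written_append_prog [simp]:
  "written_regs (append_prog a) = {r_t, r_q, r_r, r_j}" "written_arrays (append_prog a) = {a}"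
  by (auto simp: append_prog_def)

lemma written_pass_prog [simp]:
  "written_regs (pass_prog a ev ec) = {r_i, r_len, r_val, r_cnt, r_t, r_q, r_r, r_j}"
  "written_arrays (pass_prog a ev ec) = {a}"
  by (auto simp: pass_prog_def)

text \<open>\<open>h\<close> gives the bits that one element contributes: a single bit, a digit, or
  nothing if the element is filtered out. One loop thus covers bitmasks, selection, copying and
  packing. \<open>ec\<close> counts units of \<open>u\<close> bits and is evaluated after
  \<open>r_val\<close> has been set. The caller is told that chunks start at multiples of
  \<open>m\<close> and that only the last one may be short, which matters when chunks are words of
  the packed input.\<close>

lemma pass_prog:
  fixes xs :: "'a list" and h :: "'a \<Rightarrow> bool list"
  assumes st: "reg st r_w = w" "2 \<le> w" "reg st r_unit = u" "0 < u" "w * u < 2 ^ w" "reg st r_base = b"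
    "reg st r_step = m" "0 < m" "reg st r_i = i0" "reg st r_end = i0 + length xs" "i0 + length xs < 2 ^ w"
    and L: "reg st r_j * u = length L" "stream w (mem st a) b L"
    and bound: "length L + length (concat (map h xs)) \<le> M * u" "M < 2 ^ w" "b + (M * u) div w + 1 < 2 ^ w"
    and chunk: "\<And>s y e. agree (pass_prog a ev ec) st s \<Longrightarrow> reg s r_i = i0 + y \<Longrightarrow> reg s r_len = e \<Longrightarrow>
      0 < e \<Longrightarrow> e \<le> m \<Longrightarrow> y + e \<le> length xs \<Longrightarrow> y mod m = 0 \<Longrightarrow> y + e = length xs \<or> e = m \<Longrightarrow>
      eval w ev s = val (concat (map h (take e (drop y xs)))) \<and>
      eval w ec (s\<lparr>reg := (reg s)(r_val := val (concat (map h (take e (drop y xs)))))\<rparr>) * u = length (concat (map h (take e (drop y xs)))) \<and>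
      length (concat (map h (take e (drop y xs)))) \<le> w"
    and c: "cost ev + cost ec \<le> 200"
  shows "wp w (pass_prog a ev ec) st (\<lambda>t s. t \<le> 400 * (length xs div m + 2) \<and>
    reg s r_j * u = length (L @ concat (map h xs)) \<and>
    stream w (mem s a) b (L @ concat (map h xs)) \<and> (\<forall>q<b. mem s a q = mem st a q))"
proof -
  \<comment> \<open>Ceiling division: a last, incomplete chunk takes a round of its own.\<close>
  define N where "N = (length xs + m - 1) div m"
  define pos where "pos c = min (c * m) (length xs)" for c
  define I where "I c s \<longleftrightarrow> reg s r_i = i0 + pos c \<and>
      reg s r_j * u = length (L @ concat (map h (take (pos c) xs))) \<and>
      stream w (mem s a) b (L @ concat (map h (take (pos c) xs))) \<and> (\<forall>q<b. mem s a q = mem st a q)" for c and s :: state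
  have N: "c * m < length xs" if "c < N" for c
  proof -
    have "Suc c \<le> N" using that by simp
    then have "Suc c * m \<le> length xs + m - 1" unfolding N_def
      by (metis assms(8) less_eq_div_iff_mult_less_eq)
    then show ?thesis using \<open>0 < m\<close> by simp
  qed
  have posN: "pos N = length xs"
  proof -
    have "length xs + m - 1 < N * m + m" unfolding N_def
      using assms(8) by (metis add.commute dividend_less_div_times)
    then show ?thesis by (simp add: pos_def)
  qed
  have Nle: "N \<le> length xs div m + 1"
  proof -
    have "N \<le> (length xs + m) div m" unfolding N_def by (intro div_le_mono) simp
    then show ?thesis using \<open>0 < m\<close> by simp
  qed
  \<comment> \<open>A round evaluates \<open>ev\<close> and \<open>ec\<close> for at most 200 and
    appends for at most 50; 390 leaves ample room for the remaining assignments.\<close>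
  have "wp w (pass_prog a ev ec) st (\<lambda>t s. t \<le> (\<Sum>c<N. 390) + (N + 1) * (cost (Reg r_i <\<^sub>e Reg r_end) + 1) \<and>
    I N s)"
    unfolding pass_prog_def
  proof (rule wp_While_rule, goal_cases)
    case 1
    show ?case using st L by (simp add: I_def pos_def)
  next
    case (3 s)
    then show ?case using st posN by (simp add: I_def agree_def)
  next
    case (2 c s)
    define y e where "y = c * m" and "e = min m (length xs - y)"
    have y: "y < length xs" "pos c = y" using N[OF 2(1)] by (simp_all add: y_def pos_def)
    have e: "0 < e" "e \<le> m" "y + e \<le> length xs" "pos (Suc c) = y + e" "y + e = length xs \<or> e = m"
      using y \<open>0 < m\<close> by (auto simp: e_def pos_def y_def)
    have agr: "agree (pass_prog a ev ec) st s" using 2(3) by (simp only: pass_prog_def)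
    then have s: "reg s r_w = w" "reg s r_unit = u" "reg s r_base = b" "reg s r_step = m"
      "reg s r_end = i0 + length xs" using st by (simp_all add: agree_def)
    have i: "reg s r_i = i0 + y" using 2(2) y by (simp add: I_def)
    let ?L = "L @ concat (map h (take y xs))"
    have J: "reg s r_j * u = length ?L" "stream w (mem s a) b ?L" "\<forall>q<b. mem s a q = mem st a q"
      using 2(2) y by (simp_all add: I_def)
    define x where "x = concat (map h (take e (drop y xs)))"
    have Lx: "?L @ x = L @ concat (map h (take (y + e) xs))"
      by (simp add: x_def take_add)
    have Lx': "concat (map h (take (y + e) xs)) = concat (map h (take y xs)) @ x"
      by (simp add: x_def take_add)
    have "length (concat (map h xs)) = length (concat (map h (take (y + e) xs))) + length (concat (map h (drop (y + e) xs)))"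
      by (metis append_take_drop_id concat_append length_append map_append)
    then have len: "length (?L @ x) \<le> M * u" using bound(1) unfolding Lx by simp
    define s1 where "s1 = s\<lparr>reg := (reg s)(r_len := e)\<rparr>"
    have agr1: "agree (pass_prog a ev ec) st s1"
      using agr by (simp add: agree_def s1_def)
    have ch: "eval w ev s1 = val x" "eval w ec (s1\<lparr>reg := (reg s1)(r_val := val x)\<rparr>) * u = length x" "length x \<le> w"
      using chunk[OF agr1, of y e] e y i by (simp_all add: s1_def x_def y_def)
    define cn where "cn = eval w ec (s1\<lparr>reg := (reg s1)(r_val := val x)\<rparr>)"
    define s3 where "s3 = s1\<lparr>reg := (reg s1)(r_val := val x, r_cnt := cn)\<rparr>"
    have sub: "(length xs + 2 ^ w - y) mod 2 ^ w = length xs - y"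
      using sub_mod_eq[of y "length xs" w] y st(11) by simp
    have "(reg s r_j + cn) * u \<le> M * u" using len J(1) ch(2) cn_def by (simp add: algebra_simps)
    then have jM: "reg s r_j + cn < 2 ^ w" using \<open>0 < u\<close> bound(2) by simp
    have "length ?L div w \<le> (M * u) div w" using len by (intro div_le_mono) simp
    then have bL: "b + length ?L div w + 1 < 2 ^ w" using bound(3) by linarith
    have ap: "wp w (append_prog a) s3 (\<lambda>t s. t \<le> 50 \<and> reg s r_j = reg s3 r_j + reg s3 r_cnt \<and>
      stream w (mem s a) b (?L @ x) \<and> (\<forall>q<b. mem s a q = mem s3 a q))"
      using s J bL ch(3) jM st by (intro append_prog) (simp_all add: s3_def s1_def)
    have E: "wp w (If (Reg r_end -\<^sub>e Reg r_i <\<^sub>e Reg r_step) (Assign r_len (Reg r_end -\<^sub>e Reg r_i))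
         (Assign r_len (Reg r_step))) s (\<lambda>t s'. t \<le> 10 \<and> s' = s1)"
      using y e by (simp add: wp_simps s i sub s1_def e_def min_def)
    have ie: "(i0 + y + e) mod 2 ^ w = i0 + y + e" using e st(11) by simp
    show ?case
    proof
      show "eval w (Reg r_i <\<^sub>e Reg r_end) s \<noteq> 0" using s i y by simp
      have A: "wp w (append_prog a ;; Assign r_i (Reg r_i +\<^sub>e Reg r_len)) s3 (\<lambda>t s'. t \<le> 60 \<and> I (Suc c) s')"
        apply (subst wp_Seq, rule wp_mono_agree[OF ap])
        using ch(2) J
        apply (auto simp: wp_simps agree_def I_def e s3_def s1_def i ie Lx' cn_def distrib_right)
        done
      show "wp w (If (Reg r_end -\<^sub>e Reg r_i <\<^sub>e Reg r_step) (Assign r_len (Reg r_end -\<^sub>e Reg r_i))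
         (Assign r_len (Reg r_step)) ;; Assign r_val ev ;; Assign r_cnt ec ;; append_prog a ;;
         Assign r_i (Reg r_i +\<^sub>e Reg r_len)) s (\<lambda>t s'. t \<le> 390 \<and> I (Suc c) s')"
        apply (subst wp_Seq, rule wp_mono[OF E])
        apply (subst wp_Seq, subst wp_Assign, subst wp_Seq, subst wp_Assign)
        apply (rule wp_mono)
        using A ch(1) apply (simp add: s3_def cn_def s1_def)
        using c apply simp
        done
    qed
  qed
  then show ?thesis
    apply (rule wp_mono)
    using Nle by (auto simp: I_def posN)
qed

section \<open>Extracting a window of bits from a stream\<close>

definition mask_exp :: "exp \<Rightarrow> exp" where
  "mask_exp e = (Const 1 <<\<^sub>e e) -\<^sub>e Const 1"

lemma eval_mask_exp:
  assumes "eval w e st < w"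
  shows "eval w (mask_exp e) st = mask (eval w e st)"
proof -
  have w: "(1::nat) < 2 ^ w" using assms by (intro one_less_power) auto
  have p: "(2::nat) ^ eval w e st < 2 ^ w" using assms by simp
  have "eval w (Const 1 <<\<^sub>e e) st = 2 ^ eval w e st" "eval w (Const 1) st = 1"
    using p w by (simp_all add: push_bit_eq_mult)
  then show ?thesis using p eval_Sub[of w "Const 1" st "Const 1 <<\<^sub>e e"]
    by (simp add: mask_eq_exp_minus_1 mask_exp_def)
qed

lemma cost_mask_exp [simp]: "cost (mask_exp e) = cost e + 4"
  by (simp add: mask_exp_def)

definition window_exp :: "nat \<Rightarrow> exp" where
  "window_exp a =
     (let t = Reg r_i mod\<^sub>e Reg r_w *\<^sub>e Reg r_width;
          q = Reg r_i div\<^sub>e Reg r_w *\<^sub>e Reg r_width +\<^sub>e t div\<^sub>e Reg r_w;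
          r = t mod\<^sub>e Reg r_w
      in (Load a q >>\<^sub>e r) |\<^sub>e (Load a (q +\<^sub>e Const 1) <<\<^sub>e (Reg r_w -\<^sub>e r)))"

definition read_exp :: "nat \<Rightarrow> exp" where
  "read_exp a = window_exp a &\<^sub>e mask_exp (Reg r_len *\<^sub>e Reg r_width)"

text \<open>The second word may lie beyond the stream and hold anything. In that case the window
  ends within the first word, and the bits of the second land above the mask.\<close>

lemma read_exp:
  assumes "reg st r_w = w" "2 \<le> w" "reg st r_width = d" "w * d < 2 ^ w"
    and "stream w (mem st a) 0 L" "reg st r_i * d + reg st r_len * d \<le> length L"
    and "length L div w + 1 < 2 ^ w" "reg st r_len * d < w"
  shows "eval w (read_exp a) st = val (take (reg st r_len * d) (drop (reg st r_i * d) L))"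
proof -
  let ?i = "reg st r_i" and ?e = "reg st r_len"
  define q r where "q = ?i * d div w" and "r = ?i * d mod w"
  have w: "0 < w" "w < 2 ^ w" using assms(2) by simp_all
  have "?i mod w * d \<le> w * d" using w by (intro mult_le_mono1) (simp add: less_imp_le)
  then have t: "?i mod w * d < 2 ^ w" using assms(4) by linarith
  have ql: "q \<le> length L div w" unfolding q_def using assms(6) by (intro div_le_mono) simp
  have q': "?i div w * d + (?i mod w * d) div w = q" "(?i mod w * d) mod w = r"
    using div_mod_scale[OF w(1), of ?i d] by (simp_all add: q_def r_def)
  then have "?i div w * d < 2 ^ w" "q < 2 ^ w" "Suc q < 2 ^ w" using ql assms(7) by linarith+
  moreover have rw: "r < w" using w by (simp add: r_def)
  then have "(w + 2 ^ w - r) mod 2 ^ w = w - r"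
    using w by (intro sub_mod_eq) (simp_all add: less_imp_le)
  moreover have "?e * d < 2 ^ w" using assms(8) w by linarith
  then have "eval w (Reg r_len *\<^sub>e Reg r_width) st = ?e * d" using assms(3) by simp
  then have "eval w (mask_exp (Reg r_len *\<^sub>e Reg r_width)) st = mask (?e * d)"
    using eval_mask_exp[of w "Reg r_len *\<^sub>e Reg r_width" st] assms(8,3) by simp
  moreover have "(1::nat) mod 2 ^ w = 1" using assms(2) by simp
  ultimately have "eval w (read_exp a) st =
      and (or (drop_bit r (mem st a q)) (take_bit w (push_bit (w - r) (mem st a (Suc q))))) (mask (?e * d))"
    unfolding read_exp_def window_exp_def Let_def using assms(1,3) t w
    by (simp add: q' take_bit_eq_mod)
  also have "\<dots> = val (take (?e * d) (drop (?i * d) L))"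
  proof (rule bit_eqI)
    fix b
    have id: "?i * d = w * q + r" by (simp add: q_def r_def)
    show "bit (and (or (drop_bit r (mem st a q)) (take_bit w (push_bit (w - r) (mem st a (Suc q))))) (mask (?e * d))) b
      \<longleftrightarrow> bit (val (take (?e * d) (drop (?i * d) L))) b"
    proof (cases "b < ?e * d")
      case True
      have bl: "w * q + r + b < length L" using True assms(6) id by simp
      have Aq: "mem st a q = val (take w (drop (w * q) L))"
        using assms(5) ql by (simp add: stream_def)
      show ?thesis
      proof (cases "r + b < w")
        case 1: True
        have "(w * q + r + b) div w = q" "(w * q + r + b) mod w = r + b" using 1
          by (simp_all add: add.assoc)
        then show ?thesis
          using stream_bit[OF assms(5) bl w(1)] True assms(6) id 1
          by (auto simp: bit_simps bit_val add.assoc)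
      next
        case 2: False
        have "w * q + r + b = w * Suc q + (r + b - w)" using 2 by simp
        moreover have "r + b - w < w" using rw True assms(8) by simp
        ultimately have "(w * q + r + b) div w = Suc q" "(w * q + r + b) mod w = r + b - w"
          by (metis div_mult_self4 div_less add.right_neutral w(1) less_not_refl2 add.commute,
              metis mod_mult_self4 mod_less add.commute)
        then show ?thesis
          using stream_bit[OF assms(5) bl w(1)] True assms(6,8) id 2 rw
          by (auto simp: bit_simps bit_val add.assoc Aq add.commute[of b r])
      qed
    next
      case False
      then show ?thesis by (simp add: bit_simps bit_val)
    qed
  qed
  finally show ?thesis .
qed

lemma cost_read_exp [simp]: "cost (read_exp a) = 57"
  by (simp add: read_exp_def window_exp_def Let_def)

section \<open>Lookup tables\<close>

text \<open>A right fold over the digits of \<open>x\<close> in base \<open>2 ^ d\<close>, lowest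
  digit first. The step receives all of \<open>x\<close> and the result for the remaining digits, as
  in a table filled by increasing index. The guard on \<open>d\<close> ensures termination.\<close>

function digit_rec :: "nat \<Rightarrow> (nat \<Rightarrow> nat \<Rightarrow> nat) \<Rightarrow> nat \<Rightarrow> nat" where
  "digit_rec d f x = (if x = 0 \<or> d = 0 then 0 else f x (digit_rec d f (drop_bit d x)))"
  by auto
termination
  by (relation "measure (\<lambda>(d, f, x). x)") (auto simp: drop_bit_eq_div intro!: div_less_dividend one_less_power)

declare digit_rec.simps [simp del]

lemma digit_rec_0 [simp]: "digit_rec d f 0 = 0"
  by (simp add: digit_rec.simps)

text \<open>A number does not show how many leading zero digits it stands for. Stopping at 0 is
  harmless for steps that map 0 and 0 to 0, which includes selecting the digits with bit 0: zero
  digits add only zero bits.\<close>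

lemma digit_rec_eq: "0 < d \<Longrightarrow> f 0 0 = 0 \<Longrightarrow> digit_rec d f x = f x (digit_rec d f (drop_bit d x))"
  by (cases "x = 0") (simp_all add: digit_rec.simps[of d f x])

definition sel_step :: "bool \<Rightarrow> nat \<Rightarrow> nat \<Rightarrow> nat \<Rightarrow> nat \<Rightarrow> nat" where
  "sel_step b d t x y = (if bit x t = b then take_bit d x + 2 ^ d * y else y)"

definition bits_step :: "nat \<Rightarrow> nat \<Rightarrow> nat \<Rightarrow> nat" where
  "bits_step t x y = of_bool (bit x t) + 2 * y"

text \<open>Only ones are counted. A step that counts zeros would not fix 0 and would depend on the
  unknown number of leading zero digits; the number of zeros is obtained by subtraction from the
  chunk length.\<close>

definition count_step :: "nat \<Rightarrow> nat \<Rightarrow> nat \<Rightarrow> nat" where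
  "count_step t x y = of_bool (bit x t) + y"

lemma step_0 [simp]: "sel_step b d t 0 0 = 0" "bits_step t 0 0 = 0" "count_step t 0 0 = 0"
  by (simp_all add: sel_step_def bits_step_def count_step_def)

text \<open>Table entries never exceed their index, so computing them causes no overflow.\<close>

lemma digit_rec_le:
  assumes "0 < d" "\<And>x y. y \<le> drop_bit d x \<Longrightarrow> f x y \<le> x"
  shows "digit_rec d f x \<le> x"
proof (induction x rule: less_induct)
  case (less x)
  show ?case
  proof (cases "x = 0")
    case False
    then have "drop_bit d x < x" using assms(1) one_less_power[of "2::nat" d] by (simp add: drop_bit_eq_div)
    from less[OF this] show ?thesis using assms False by (simp add: digit_rec.simps[of d f x])
  qed simp
qed

lemma step_le:
  assumes "t < d" "y \<le> drop_bit d x"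
  shows "sel_step b d t x y \<le> x" "bits_step t x y \<le> x" "count_step t x y \<le> x"
proof -
  have x: "take_bit d x + 2 ^ d * drop_bit d x = x"
    by (simp add: take_bit_eq_mod drop_bit_eq_div)
  have 2: "2 * drop_bit d x \<le> 2 ^ d * drop_bit d x"
    using assms(1) by (intro mult_le_mono1) (cases d, auto)
  have b: "of_bool (bit x t) \<le> take_bit d x"
  proof (cases "bit x t")
    case True
    then have "bit (take_bit d x) t" using assms(1) by (simp add: bit_take_bit_iff)
    then have "take_bit d x \<noteq> 0" by (metis bit_0_eq bot_apply bot_bool_def)
    then show ?thesis by simp
  qed simp
  have m: "2 ^ d * y \<le> 2 ^ d * drop_bit d x" using assms(2) by simp
  have y: "y \<le> x" "take_bit d x + 2 ^ d * y \<le> x" "of_bool (bit x t) + 2 * y \<le> x"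
    using x m 2 assms(2) b by linarith+
  show "sel_step b d t x y \<le> x" using y by (simp add: sel_step_def)
  show "bits_step t x y \<le> x" "count_step t x y \<le> x"
    using y by (simp_all add: bits_step_def count_step_def)
qed

lemma val_digit:
  assumes "length g = d"
  shows "take_bit d (val (g @ bs)) = val g" "drop_bit d (val (g @ bs)) = val bs"
    "t < d \<Longrightarrow> bit (val (g @ bs)) t \<longleftrightarrow> g ! t"
  using assms by (auto intro!: bit_eqI simp: bit_simps bit_val nth_append)

lemma digit_rec_val:
  assumes "t < d" "\<forall>g\<in>set gs. length g = d"
  shows "digit_rec d (sel_step b d t) (val (concat gs)) = val (concat (filter (\<lambda>g. g ! t = b) gs))"
    and "digit_rec d (bits_step t) (val (concat gs)) = val (map (\<lambda>g. g ! t) gs)"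
    and "digit_rec d (count_step t) (val (concat gs)) = length (filter (\<lambda>g. g ! t) gs)"
  using assms(2)
proof (induction gs)
  case (Cons g gs)
  have d: "0 < d" using assms(1) by simp
  have rec: "digit_rec d f (val (g @ concat gs)) = f (val (g @ concat gs)) (digit_rec d f (val (concat gs)))"
    if "f 0 0 = 0" "length g = d" for f
    using digit_rec_eq[of d f, OF d that(1), of "val (g @ concat gs)"] that(2) by (simp only: val_digit)
  { case 1
    have "val g + 2 ^ d * val cs = val (g @ cs)" for cs using 1 by (simp add: val_append)
    then show ?case using Cons.IH(1) 1 assms(1) by (simp add: rec sel_step_def val_digit)
  next
    case 2
    then show ?case using Cons.IH(2) assms(1) by (simp add: rec bits_step_def val_digit)
  next
    case 3
    then show ?case using Cons.IH(3) assms(1) by (simp add: rec count_step_def val_digit) }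
qed simp_all

abbreviation (input) "a_zeros \<equiv> 5 :: nat"
abbreviation (input) "a_ones \<equiv> 6 :: nat"
abbreviation (input) "a_bits \<equiv> 7 :: nat"
abbreviation (input) "a_count \<equiv> 8 :: nat"

definition table_loop :: com where
  "table_loop =
     While (Reg r_x <\<^sub>e (Const 1 <<\<^sub>e Reg r_chunk *\<^sub>e Reg r_width)) (
       Assign r_y (Reg r_x >>\<^sub>e Reg r_width) ;;
       Assign r_t ((Reg r_x >>\<^sub>e Reg r_bit) &\<^sub>e Const 1) ;;
       Assign r_g (Reg r_x &\<^sub>e mask_exp (Reg r_width)) ;;
       If (Reg r_t)
         (Store a_ones (Reg r_x) (Reg r_g +\<^sub>e (Load a_ones (Reg r_y) <<\<^sub>e Reg r_width)) ;;
          Store a_zeros (Reg r_x) (Load a_zeros (Reg r_y)))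
         (Store a_ones (Reg r_x) (Load a_ones (Reg r_y)) ;;
          Store a_zeros (Reg r_x) (Reg r_g +\<^sub>e (Load a_zeros (Reg r_y) <<\<^sub>e Reg r_width))) ;;
       Store a_bits (Reg r_x) (Reg r_t +\<^sub>e (Load a_bits (Reg r_y) <<\<^sub>e Const 1)) ;;
       Store a_count (Reg r_x) (Reg r_t +\<^sub>e Load a_count (Reg r_y)) ;;
       Assign r_x (Reg r_x +\<^sub>e Const 1))"

definition table_prog :: com where
  "table_prog =
     Store a_zeros (Const 0) (Const 0) ;; Store a_ones (Const 0) (Const 0) ;;
     Store a_bits (Const 0) (Const 0) ;; Store a_count (Const 0) (Const 0) ;;
     Assign r_x (Const 1) ;; table_loop"

lemma written_table_prog [simp]:
  "written_regs table_prog = {r_x, r_y, r_t, r_g}"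
  "written_arrays table_prog = {a_zeros, a_ones, a_bits, a_count}"
  by (auto simp: table_prog_def table_loop_def)

definition tables_upto :: "nat \<Rightarrow> nat \<Rightarrow> nat \<Rightarrow> state \<Rightarrow> bool" where
  "tables_upto d t X s \<longleftrightarrow> (\<forall>x<X. mem s a_zeros x = digit_rec d (sel_step False d t) x \<and>
     mem s a_ones x = digit_rec d (sel_step True d t) x \<and>
     mem s a_bits x = digit_rec d (bits_step t) x \<and> mem s a_count x = digit_rec d (count_step t) x)"

text \<open>Dynamic programming by increasing index: \<open>drop_bit d x < x\<close> for positive
  \<open>x\<close>, so the entry for the remaining digits is already there and each new entry takes
  constant time.\<close>

lemma table_prog:
  assumes "reg st r_chunk = m" "reg st r_width = d" "reg st r_bit = t" "t < d" "m * d < w" "0 < m"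
  shows "wp w table_prog st (\<lambda>s' s. s' \<le> 100 * 2 ^ (m * d) \<and> tables_upto d t (2 ^ (m * d)) s)"
proof -
  define X where "X = (2::nat) ^ (m * d)"
  have md: "d \<le> m * d" "0 < d" using assms by simp_all
  have w: "1 < w" "d < w" "t < w" using assms md by (linarith | simp)+
  have X: "X < 2 ^ w" "1 < X" using assms md one_less_power[of "2::nat" "m * d"] by (auto simp: X_def)
  have lim: "m * d < 2 ^ w" using assms(5) less_exp[of w] by linarith
  have one: "1 < (2::nat) ^ w" using w by (intro one_less_power) simp_all
  \<comment> \<open>Entry 0 is stored before the loop, so round \<open>i\<close> fills index
    \<open>Suc i\<close> and \<open>X - 1\<close> rounds suffice.\<close>
  define I where "I i s \<longleftrightarrow> reg s r_x = Suc i \<and> tables_upto d t (Suc i) s" for i and s :: state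
  define st1 where "st1 = st\<lparr>mem := (mem st)(a_zeros := (mem st a_zeros)(0 := 0),
     a_ones := (mem st a_ones)(0 := 0), a_bits := (mem st a_bits)(0 := 0), a_count := (mem st a_count)(0 := 0)),
     reg := (reg st)(r_x := 1)\<rparr>"
  have loop: "wp w table_loop st1 (\<lambda>t s. t \<le> (\<Sum>i<X - 1. 70) +
      (X - 1 + 1) * (cost (Reg r_x <\<^sub>e (Const 1 <<\<^sub>e Reg r_chunk *\<^sub>e Reg r_width)) + 1) \<and> I (X - 1) s)"
    unfolding table_loop_def
  proof (rule wp_While_rule, goal_cases)
    case 1
    show ?case by (simp add: I_def st1_def tables_upto_def)
  next
    case (3 s)
    then show ?case using assms lim one X by (simp add: I_def agree_def st1_def push_bit_eq_mult X_def)
  next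
    case (2 i s)
    define x y where "x = Suc i" and "y = drop_bit d x"
    have s: "reg s r_chunk = m" "reg s r_width = d" "reg s r_bit = t" "reg s r_x = x"
      using 2 assms by (simp_all add: agree_def st1_def I_def x_def)
    have x: "0 < x" "x < X" using 2(1) by (simp_all add: x_def)
    have y: "y < x" using x md one_less_power[of "2::nat" d] by (simp add: y_def drop_bit_eq_div)
    have T: "mem s a_zeros y = digit_rec d (sel_step False d t) y"
     "mem s a_ones y = digit_rec d (sel_step True d t) y"
     "mem s a_bits y = digit_rec d (bits_step t) y" "mem s a_count y = digit_rec d (count_step t) y"
      using 2(2) y by (simp_all add: I_def tables_upto_def x_def)
    have rec: "digit_rec d (sel_step b d t) x = sel_step b d t x (digit_rec d (sel_step b d t) y)"
      "digit_rec d (bits_step t) x = bits_step t x (digit_rec d (bits_step t) y)"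
      "digit_rec d (count_step t) x = count_step t x (digit_rec d (count_step t) y)" for b
      unfolding y_def by (rule digit_rec_eq; simp add: md)+
    have le: "digit_rec d (sel_step b d t) x < 2 ^ w" "digit_rec d (bits_step t) x < 2 ^ w"
      "digit_rec d (count_step t) x < 2 ^ w" for b
      using digit_rec_le[OF md(2), of _ x] step_le[OF assms(4)] x X by (meson le_less_trans less_trans)+
    have tb: "and (drop_bit t x) 1 = of_bool (bit x t)"
      by (simp add: and_one_eq bit_iff_odd drop_bit_eq_div mod2_eq_if)
    have mask: "and x (eval w (mask_exp (Reg r_width)) s') = take_bit d x" if "reg s' r_width = d" for s'
      using eval_mask_exp[of w "Reg r_width" s'] w that by (simp add: take_bit_eq_mask)
    have next_le: "Suc x < 2 ^ w" using x X by simp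
    have up: "tables_upto d t (Suc x) s'" if "reg s' r_x = Suc x"
      "\<forall>a \<in> {a_zeros, a_ones, a_bits, a_count}. \<forall>z. z \<noteq> x \<longrightarrow> mem s' a z = mem s a z"
      "mem s' a_zeros x = digit_rec d (sel_step False d t) x"
      "mem s' a_ones x = digit_rec d (sel_step True d t) x"
      "mem s' a_bits x = digit_rec d (bits_step t) x" "mem s' a_count x = digit_rec d (count_step t) x" for s'
      using that 2(2) by (auto simp: tables_upto_def I_def x_def less_Suc_eq)
    have v: "(take_bit d x + push_bit d (digit_rec d (sel_step b d t) y) mod 2 ^ w) mod 2 ^ w = digit_rec d (sel_step b d t) x"
        if "bit x t = b" for b
      using rec(1)[of b] le(1)[of b] that by (simp add: sel_step_def push_bit_eq_mult mult.commute)
    have v': "digit_rec d (sel_step b d t) y = digit_rec d (sel_step b d t) x" if "bit x t \<noteq> b" for b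
      using rec(1)[of b] that by (simp add: sel_step_def)
    have v'': "bit x t \<Longrightarrow> Suc (digit_rec d (bits_step t) y * 2 mod 2 ^ w) mod 2 ^ w = digit_rec d (bits_step t) x"
      "\<not> bit x t \<Longrightarrow> digit_rec d (bits_step t) y * 2 mod 2 ^ w = digit_rec d (bits_step t) x"
      "bit x t \<Longrightarrow> Suc (digit_rec d (count_step t) y) mod 2 ^ w = digit_rec d (count_step t) x"
      "\<not> bit x t \<Longrightarrow> digit_rec d (count_step t) y = digit_rec d (count_step t) x"
      using rec(2,3) le(2,3) by (simp_all add: bits_step_def count_step_def mod_Suc_eq mult.commute)
    have one': "Suc 0 mod 2 ^ w = Suc 0" using one w by simp
    have 1: "eval w (Reg r_x <\<^sub>e (Const 1 <<\<^sub>e Reg r_chunk *\<^sub>e Reg r_width)) s \<noteq> 0"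
      using s x X lim one by (simp add: push_bit_eq_mult X_def)
    show ?case
    proof (cases "bit x t")
      case True
      show ?thesis
        by (rule conjI[OF 1]) (simp add: wp_simps s mask tb[simplified] one' T True v v' v'' w(1)[THEN less_trans[OF zero_less_one]] next_le le I_def up flip: x_def y_def)
    next
      case False
      show ?thesis
        by (rule conjI[OF 1]) (simp add: wp_simps s mask tb[simplified] one' T False v v' v'' w(1)[THEN less_trans[OF zero_less_one]] next_le le I_def up flip: x_def y_def)
    qed
  qed
  have "(\<Sum>i<X - 1. 70) + (X - 1 + 1) * (cost (Reg r_x <\<^sub>e (Const 1 <<\<^sub>e Reg r_chunk *\<^sub>e Reg r_width)) + 1) + 20 \<le> 100 * X"
    using X(2) by (simp add: algebra_simps)
  then have "wp w table_loop st1 (\<lambda>t s. t + 20 \<le> 100 * X \<and> I (X - 1) s)"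
    by (intro wp_mono[OF loop]) auto
  then show ?thesis
    using X(2) one w by (simp add: table_prog_def wp_simps st1_def I_def X_def[symmetric]) (erule wp_mono, auto)
qed

section \<open>Digits\<close>

definition digit :: "nat \<Rightarrow> nat \<Rightarrow> nat \<Rightarrow> bool list" where
  "digit sh d c = map (\<lambda>b. bit c (sh + b)) [0..<d]"

lemma length_digit [simp]: "length (digit sh d c) = d"
  by (simp add: digit_def)

lemma val_digit_eq: "val (digit sh d c) = take_bit d (drop_bit sh c)"
  by (rule bit_eqI) (auto simp: bit_val digit_def bit_simps)

lemma length_concat_digits [simp]: "length (concat (map (digit sh d) xs)) = length xs * d"
  by (induction xs) auto

lemma take_concat_digits: "take (e * d) (concat (map (digit sh d) xs)) = concat (map (digit sh d) (take e xs))"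
proof (induction xs arbitrary: e)
  case (Cons x xs)
  then show ?case by (cases e) auto
qed simp

lemma drop_concat_digits: "drop (e * d) (concat (map (digit sh d) xs)) = concat (map (digit sh d) (drop e xs))"
proof (induction xs arbitrary: e)
  case (Cons x xs)
  then show ?case by (cases e) auto
qed simp

text \<open>Each word by itself is a string of digits, but the words together form a
  \<open>stream\<close> only if \<open>d\<close> divides \<open>w\<close>, since
  \<open>w mod d\<close> bits of every word stay empty. Hence even the plain input has to be copied
  before it can be read as a stream.\<close>

lemma packed_eq_val:
  assumes "set xs \<subseteq> {..<2 ^ d}"
  shows "packed w d xs j = val (concat (map (digit 0 d) (take (w div d) (drop (w div d * j) xs))))"
proof -
  have "horner_sum id (2 ^ d) ys = val (concat (map (digit 0 d) ys))" if "set ys \<subseteq> {..<2 ^ d}" for ys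
    using that by (induction ys) (simp_all add: horner_sum_append val_digit_eq take_bit_nat_eq_self)
  moreover have "set (take (w div d) (drop (w div d * j) xs)) \<subseteq> {..<2 ^ d}"
    using assms by (meson order_trans set_drop_subset set_take_subset)
  ultimately show ?thesis by (simp add: packed_def Let_def)
qed

text \<open>For entries of one bit no position of a word is lost, so the required output format is
  that of a \<open>stream\<close>.\<close>

lemma packed_bits_eq_val: "packed_bits w B j = val (take w (drop (w * j) B))"
proof -
  have "horner_sum id 2 (map of_bool ys) = val ys" for ys by (induction ys) simp_all
  then show ?thesis by (simp add: packed_bits_def packed_def take_map drop_map)
qed

lemma num_words_eq:
  assumes "0 < w"
  shows "num_words w B = (length B + w - 1) div w"
proof -
  let ?a = "length B" and ?q = "(length B + w - 1) div w"
  have "?q * w \<le> ?a + w - 1" "?a + w - 1 < ?q * w + w"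
    using assms by (simp, metis add.commute dividend_less_div_times)
  then have "?q * w < ?a + w" "?a \<le> ?q * w" using assms by linarith+
  then have "real ?q * real w < real ?a + real w" "real ?a \<le> real ?q * real w"
    by (metis of_nat_add of_nat_less_iff of_nat_mult, metis of_nat_le_iff of_nat_mult)
  then have "\<lceil>real ?a / real w\<rceil> = int ?q"
    using assms by (intro ceiling_unique) (simp_all add: field_simps)
  then show ?thesis by (simp add: num_words_def)
qed

section \<open>The nodes of the wavelet tree in heap order\<close>

text \<open>A comparison of bit lengths: \<open>x\<close> has \<open>k + 1\<close> bits,
  \<open>u\<close> has \<open>d + 1\<close>, and the shift removes \<open>j\<close>. It fixes the
  witness of the existential quantifier in \<open>node\<close>.\<close>

lemma drop_bit_heap_unique:
  fixes x :: nat
  assumes "2 ^ k \<le> x" "x < 2 ^ Suc k" "2 ^ d \<le> u" "u < 2 ^ Suc d" "drop_bit j x = u"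
  shows "j + d = k"
proof -
  have u: "u = x div 2 ^ j" using assms(5) by (simp add: drop_bit_eq_div)
  have "2 ^ d * 2 ^ j \<le> u * 2 ^ j" using assms(3) by simp
  also have "\<dots> \<le> x" by (simp add: u)
  finally have "2 ^ (d + j) < (2::nat) ^ Suc k" using assms(2) by (simp add: power_add)
  then have 1: "d + j < Suc k" by (rule power_less_imp_less_exp[rotated]) simp
  have "x < Suc u * 2 ^ j" unfolding u by (metis dividend_less_div_times mult_Suc zero_less_numeral zero_less_power)
  also have "\<dots> \<le> 2 ^ Suc d * 2 ^ j" using assms(4) by (intro mult_le_mono1) simp
  finally have "(2::nat) ^ k < 2 ^ (Suc d + j)" using assms(1) by (simp add: power_add)
  then have "k < Suc d + j" by (rule power_less_imp_less_exp[rotated]) simp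
  with 1 show ?thesis by simp
qed

locale wavelet =
  fixes k :: nat and s :: "nat list"
  assumes k: "0 < k" and alphabet: "set s \<subseteq> {..<2 ^ k}" and size: "2 ^ k \<le> length s"
begin

definition n :: nat where "n = length s"

text \<open>
  The leaf of the character \<open>c\<close> has heap position \<open>2 ^ k + c\<close>, and the ancestors of a position are its
  prefixes in binary.
\<close>

definition node :: "nat \<Rightarrow> nat list" where
  "node u = filter (\<lambda>c. \<exists>j. drop_bit j (2 ^ k + c) = u) s"

definition mask_of :: "nat \<Rightarrow> bool list" where
  "mask_of u = map (\<lambda>c. bit c (k - 1 - floor_log u)) (node u)"

text \<open>The nodes of level \<open>d\<close> to the left of \<open>v\<close>. The length is the
  offset of node \<open>v\<close> in the stream of its level.\<close>

definition prefix :: "nat \<Rightarrow> nat \<Rightarrow> nat list" where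
  "prefix d v = concat (map node [2 ^ d..<v])"

text \<open>This is the string sorted stably by the top \<open>d\<close> bits, because heap order
  within a level is the order of these bits.\<close>

definition level :: "nat \<Rightarrow> nat list" where
  "level d = prefix d (2 ^ Suc d)"

lemma floor_log_node: "2 ^ d \<le> u \<Longrightarrow> u < 2 ^ Suc d \<Longrightarrow> floor_log u = d"
  by (rule floor_log_eqI) (auto intro: less_le_trans[of 0 "2 ^ d"])

lemma node_eq:
  assumes "2 ^ d \<le> u" "u < 2 ^ Suc d" "d \<le> k"
  shows "node u = filter (\<lambda>c. drop_bit (k - d) (2 ^ k + c) = u) s"
  unfolding node_def
proof (rule filter_cong[OF refl])
  fix c assume "c \<in> set s"
  then have "2 ^ k + c < 2 ^ Suc k" using alphabet by auto
  then show "(\<exists>j. drop_bit j (2 ^ k + c) = u) \<longleftrightarrow> drop_bit (k - d) (2 ^ k + c) = u"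
    using drop_bit_heap_unique[of k "2 ^ k + c" d u] assms by (metis add_diff_cancel_right' le_add1)
qed

lemma bit_leaf: "c < 2 ^ k \<Longrightarrow> i < k \<Longrightarrow> bit (2 ^ k + c) i = bit (c :: nat) i"
  by (metis add.commute bit_take_bit_iff mod_add_self2 mod_less take_bit_eq_mod)

text \<open>Extending an ancestor by one more bit doubles its position and adds the bit. Both sides
  filter \<open>s\<close>, so the order of the characters is kept.\<close>

lemma node_child:
  assumes "2 ^ d \<le> u" "u < 2 ^ Suc d" "d < k"
  shows "node (2 * u) = filter (\<lambda>c. \<not> bit c (k - 1 - d)) (node u)"
    and "node (2 * u + 1) = filter (\<lambda>c. bit c (k - 1 - d)) (node u)"
proof -
  define j where "j = k - 1 - d"
  have j: "k - d = Suc j" "k - Suc d = j" "j < k" using assms(3) by (simp_all add: j_def)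
  have x: "drop_bit j x = 2 * u + of_bool b \<longleftrightarrow> drop_bit (Suc j) x = u \<and> bit x j = b" for x b
  proof -
    have "drop_bit (Suc j) x = drop_bit j x div 2" by (simp only: drop_bit_eq_div power_Suc2 div_mult2_eq)
    moreover have "bit x j \<longleftrightarrow> odd (drop_bit j x)" by (simp add: bit_iff_odd drop_bit_eq_div)
    ultimately show ?thesis by (cases b) (auto elim: evenE oddE)
  qed
  have c: "node (2 * u + of_bool b) = filter (\<lambda>c. bit c j = b) (node u)" for b
  proof -
    have "node (2 * u + of_bool b) = filter (\<lambda>c. drop_bit (k - Suc d) (2 ^ k + c) = 2 * u + of_bool b) s"
      using assms by (intro node_eq) (auto simp: of_bool_def)
    also have "\<dots> = filter (\<lambda>c. bit c j = b \<and> drop_bit (k - d) (2 ^ k + c) = u) s"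
      using alphabet j by (intro filter_cong) (auto simp: x bit_leaf)
    also have "\<dots> = filter (\<lambda>c. bit c j = b) (node u)"
      using assms node_eq[of d u] by (simp add: conj_commute)
    finally show ?thesis .
  qed
  show "node (2 * u) = filter (\<lambda>c. \<not> bit c (k - 1 - d)) (node u)" using c[of False] by (simp add: j_def)
  show "node (2 * u + 1) = filter (\<lambda>c. bit c (k - 1 - d)) (node u)" using c[of True] by (simp add: j_def)
qed

lemma node_root: "node (Suc 0) = s"
proof -
  have "drop_bit k (2 ^ k + c) = Suc 0" if "c \<in> set s" for c
    using that alphabet by (auto simp: drop_bit_eq_div)
  then show ?thesis using node_eq[of 0 "Suc 0"] by simp
qed

lemma prefix_Suc: "2 ^ d \<le> v \<Longrightarrow> prefix d (Suc v) = prefix d v @ node v"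
  by (simp add: prefix_def)

lemma prefix_self [simp]: "prefix d (2 ^ d) = []"
  by (simp add: prefix_def)

text \<open>The reason why one output stream suffices: when nodes are handled from left to right and
  the zeros of a node are appended before its ones, the next level arises in heap order.\<close>

lemma prefix_children:
  assumes "2 ^ d \<le> v"
  shows "prefix (Suc d) (2 * Suc v) = prefix (Suc d) (2 * v) @ node (2 * v) @ node (2 * v + 1)"
  using assms prefix_Suc[of "Suc d" "2 * v"] prefix_Suc[of "Suc d" "2 * v + 1"] by simp

text \<open>At each node boundary the read position in level \<open>d\<close> and the write position
  in level \<open>Suc d\<close> coincide, since a node passes on every one of its characters to a
  child.\<close>

lemma length_prefix_children:
  assumes "2 ^ d \<le> v" "v \<le> 2 ^ Suc d" "d < k"
  shows "length (prefix (Suc d) (2 * v)) = length (prefix d v)"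
  using assms(1,2)
proof (induction v rule: dec_induct)
  case base
  show ?case by (simp add: prefix_def)
next
  case (step v)
  have "length (node (2 * v)) + length (node (2 * v + 1)) = length (node v)"
    using node_child[of d v] step assms(3) sum_length_filter_compl[of "\<lambda>c. bit c (k - 1 - d)" "node v"] by simp
  then show ?case using step prefix_children[of d v] by (simp add: prefix_Suc)
qed

lemma length_level: "d \<le> k \<Longrightarrow> length (level d) = n"
proof (induction d)
  case 0
  then show ?case using prefix_Suc[of 0 "Suc 0"]
    by (simp add: level_def prefix_def node_root n_def numeral_2_eq_2)
next
  case (Suc d)
  then show ?case using length_prefix_children[of d "2 ^ Suc d"] by (simp add: level_def)
qed

lemma level_0: "level 0 = s"
  by (simp add: level_def prefix_def node_root numeral_2_eq_2)

lemma length_prefix_le: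
  assumes "v < 2 ^ Suc d" "2 ^ d \<le> v" "d \<le> k"
  shows "length (prefix d v) + length (node v) \<le> n"
proof -
  have "[2 ^ d..<2 ^ Suc d] = [2 ^ d..<v] @ v # [Suc v..<2 ^ Suc d]"
    using assms by (metis le_add_diff_inverse less_imp_le upt_add_eq_append upt_conv_Cons)
  then have "level d = prefix d v @ node v @ concat (map node [Suc v..<2 ^ Suc d])"
    by (simp add: level_def prefix_def)
  then show ?thesis using length_level[OF assms(3)] by simp
qed

lemma take_drop_level:
  assumes "v < 2 ^ Suc d" "2 ^ d \<le> v"
  shows "take (length (node v)) (drop (length (prefix d v)) (level d)) = node v"
proof -
  have "[2 ^ d..<2 ^ Suc d] = [2 ^ d..<v] @ v # [Suc v..<2 ^ Suc d]"
    using assms by (metis le_add_diff_inverse less_imp_le upt_add_eq_append upt_conv_Cons)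
  then show ?thesis by (simp add: level_def prefix_def)
qed

text \<open>The tree strips the bits it has used, whereas \<open>node\<close> keeps whole
  characters. The induction therefore speaks of the subtree at \<open>u\<close>, whose string is
  \<open>node u\<close> truncated to the \<open>j\<close> remaining bits.\<close>

lemma bitmasks_wavelet_tree:
  "(v, B) \<in> bitmasks 1 (wavelet_tree k s) \<Longrightarrow> 1 \<le> v \<and> v < 2 ^ k \<and> B = mask_of v"
proof -
  have "\<forall>(v, B) \<in> bitmasks u (wavelet_tree j (map (take_bit j) (node u))).
      1 \<le> v \<and> v < 2 ^ k \<and> B = mask_of v"
    if "j + d = k" "2 ^ d \<le> u" "u < 2 ^ Suc d" for j d u
    using that
  proof (induction j arbitrary: d u)
    case (Suc j)
    have j: "k - 1 - d = j" "d < k" using Suc.prems(1) by simp_all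
    have "node (2 * u) = filter (\<lambda>c. \<not> bit c j) (node u)" "node (2 * u + 1) = filter (\<lambda>c. bit c j) (node u)"
      using node_child[OF Suc.prems(2,3) j(2)] by (simp_all only: j(1))
    then have ch: "map (take_bit j) (filter (\<lambda>c. \<not> bit c j) (map (take_bit (Suc j)) (node u))) =
        map (take_bit j) (node (2 * u))"
      "map (take_bit j) (filter (\<lambda>c. bit c j) (map (take_bit (Suc j)) (node u))) =
        map (take_bit j) (node (2 * u + 1))"
      by (simp_all add: filter_map o_def bit_take_bit_iff)
    have "(2::nat) ^ Suc d \<le> 2 ^ k" using j(2) by (intro power_increasing) simp_all
    then have "1 \<le> u" "u < 2 ^ k" using Suc.prems(2,3) by (auto intro: less_le_trans order_trans[of 1 "2 ^ d"])
    moreover have "map (\<lambda>c. bit c j) (map (take_bit (Suc j)) (node u)) = mask_of u"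
      using floor_log_node[OF Suc.prems(2,3)] j by (simp add: mask_of_def bit_take_bit_iff)
    ultimately show ?case
      using Suc.IH[of "Suc d" "2 * u"] Suc.IH[of "Suc d" "2 * u + 1"] Suc.prems
      unfolding wavelet_tree.simps bitmasks.simps ch by fastforce
  qed simp
  from this[of k 0 1] have "\<forall>(v, B) \<in> bitmasks 1 (wavelet_tree k (map (take_bit k) s)).
      1 \<le> v \<and> v < 2 ^ k \<and> B = mask_of v" by (simp add: node_root)
  moreover have "map (take_bit k) s = s"
    using alphabet by (intro map_idI) (auto simp: take_bit_nat_eq_self)
  ultimately show "(v, B) \<in> bitmasks 1 (wavelet_tree k s) \<Longrightarrow> 1 \<le> v \<and> v < 2 ^ k \<and> B = mask_of v"
    by auto
qed

section \<open>Word size and layout of the output\<close>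

definition w :: nat where "w = word_size n"

definition block :: "nat \<Rightarrow> nat" where
  "block u = (length (node u) + w - 1) div w"

definition out_pos :: "nat \<Rightarrow> nat" where
  "out_pos u = (\<Sum>x\<in>{1..<u}. block x)"

lemma n_pos: "2 \<le> n"
proof -
  have "(2::nat) ^ 1 \<le> 2 ^ k" using k by (intro power_increasing) simp_all
  then show ?thesis using size by (simp add: n_def)
qed

lemma n_less: "n < 2 ^ (w - 1)" "2 ^ (w - 2) \<le> n"
proof -
  have w: "w = floor_log n + 2" using n_pos by (simp add: w_def word_size_def floor_log_altdef)
  show "n < 2 ^ (w - 1)" using floor_log_exp2_gt[of n] by (simp add: w)
  show "2 ^ (w - 2) \<le> n" using floor_log_exp2_le[of n] n_pos by (simp add: w)
qed

lemma k_less: "k + 2 \<le> w"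
proof -
  have "(2::nat) ^ k < 2 ^ (w - 1)" using size n_less(1) unfolding n_def by (rule le_less_trans)
  then have "k < w - 1" using power_less_imp_less_exp[of "2::nat" k "w - 1"] by simp
  then show ?thesis by simp
qed

lemma w_ge: "3 \<le> w"
  using k_less k by simp

lemma two_n_less: "2 * n < 2 ^ w"
  using n_less(1) power_Suc[of "2::nat" "w - 1"] w_ge by simp

lemma sum_length_node: "d \<le> k \<Longrightarrow> (\<Sum>x\<in>{1..<2 ^ d}. length (node x)) = n * d"
proof (induction d)
  case (Suc d)
  have "{1..<2 ^ Suc d} = {1..<2 ^ d} \<union> {2 ^ d..<2 ^ Suc d :: nat}"
    by (intro ivl_disj_un(17)[symmetric]) simp_all
  moreover have "(\<Sum>x\<in>{2 ^ d..<2 ^ Suc d}. length (node x)) = length (level d)"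
    by (simp add: level_def prefix_def length_concat o_def sum_list_distinct_conv_sum_set)
  ultimately show ?case using Suc length_level[of d] by (simp add: sum.union_disjoint)
qed simp

lemma out_pos_Suc: "1 \<le> u \<Longrightarrow> out_pos (Suc u) = out_pos u + block u"
  by (simp add: out_pos_def)

lemma out_pos_mono: "u \<le> v \<Longrightarrow> out_pos u \<le> out_pos v"
  unfolding out_pos_def by (intro sum_mono2) auto

text \<open>All bitmasks together have \<open>n * k < n * w\<close> bits, and each node before
  \<open>u\<close> wastes less than one word. With \<open>u < 2 ^ k <= n\<close> this stays below
  \<open>2 * n\<close> words, and the slack of 2 leaves room for the word past the end that an
  append overwrites.\<close>

lemma out_pos_bound:
  assumes "1 \<le> u" "u < 2 ^ k"
  shows "out_pos u + length (node u) div w + 2 < 2 ^ w"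
proof -
  have w: "0 < w" using w_ge by simp
  have "block x * w \<le> length (node x) + w - 1" for x by (simp add: block_def)
  then have "block x * w \<le> length (node x) + w" for x
    by (rule order_trans) simp
  then have "(\<Sum>x\<in>{1..<u}. block x * w) \<le> (\<Sum>x\<in>{1..<u}. length (node x) + w)"
    by (intro sum_mono)
  then have "out_pos u * w + length (node u) \<le> (\<Sum>x\<in>{1..<u}. length (node x)) + length (node u) + (u - 1) * w"
    by (simp add: out_pos_def sum_distrib_right sum.distrib)
  also have "(\<Sum>x\<in>{1..<u}. length (node x)) + length (node u) = (\<Sum>x\<in>{1..<Suc u}. length (node x))"
    using assms by simp
  also have "\<dots> \<le> (\<Sum>x\<in>{1..<2 ^ k}. length (node x))"
    using assms by (intro sum_mono2) auto
  also have "\<dots> = n * k" using sum_length_node[of k] by simp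
  finally have *: "out_pos u * w + length (node u) \<le> n * k + (u - 1) * w" by simp
  have "n * k < n * w" using n_pos k_less by simp
  then have "out_pos u * w + length (node u) < (n + (u - 1)) * w" using * unfolding add_mult_distrib by linarith
  moreover have "(out_pos u + length (node u) div w) * w \<le> out_pos u * w + length (node u)"
    by (simp add: add_mult_distrib)
  ultimately have "(out_pos u + length (node u) div w) * w < (n + (u - 1)) * w" by linarith
  then have "out_pos u + length (node u) div w < n + (u - 1)" by simp
  then show ?thesis using assms size two_n_less by (simp add: n_def)
qed

lemma stores_bitmasksI:
  assumes "\<And>u. 1 \<le> u \<Longrightarrow> u < 2 ^ k \<Longrightarrow> mem st 1 u = out_pos u \<and>
    (\<forall>j < block u. mem st 2 (out_pos u + j) = val (take w (drop (w * j) (mask_of u))))"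
  shows "stores_bitmasks w (wavelet_tree k s) st"
proof -
  have w: "0 < w" using w_ge by simp
  have nw: "num_words w (mask_of u) = block u" for u
    using num_words_eq[OF w] by (simp add: block_def mask_of_def)
  have bnd: "out_pos u + block u \<le> 2 ^ w" if "1 \<le> u" "u < 2 ^ k" for u
  proof -
    have "block u \<le> (length (node u) + w) div w" unfolding block_def by (intro div_le_mono) simp
    then have "block u \<le> length (node u) div w + 1" using w by simp
    then show ?thesis using out_pos_bound[OF that] by simp
  qed
  have disj: "{out_pos u ..< out_pos u + block u} \<inter> {out_pos v ..< out_pos v + block v} = {}"
    if "u < v" "1 \<le> u" for u v
    using out_pos_mono[of "Suc u" v] out_pos_Suc[of u] that by auto
  show ?thesis
    unfolding stores_bitmasks_def
  proof (intro conjI ballI, goal_cases)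
    case (1 x)
    obtain v B where x: "x = (v, B)" by (cases x)
    with 1 have v: "1 \<le> v" "v < 2 ^ k" "B = mask_of v" using bitmasks_wavelet_tree by blast+
    then show ?case using assms[OF v(1,2)] bnd[OF v(1,2)] by (simp add: x nw packed_bits_eq_val)
  next
    case (2 x)
    obtain v B where x: "x = (v, B)" by (cases x)
    with 2 have v: "1 \<le> v" "v < 2 ^ k" "B = mask_of v" using bitmasks_wavelet_tree by blast+
    show ?case unfolding x
    proof (clarify)
      fix v' B' assume "(v', B') \<in> bitmasks 1 (wavelet_tree k s)" and ne: "v \<noteq> v'"
      then have v': "1 \<le> v'" "v' < 2 ^ k" "B' = mask_of v'" using bitmasks_wavelet_tree by blast+
      show "{mem st 1 v..<mem st 1 v + num_words w B} \<inter>
          {mem st 1 v'..<mem st 1 v' + num_words w B'} = {}"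
        using v v' ne assms[of v] assms[of v'] disj[of v v'] disj[of v' v]
        by (cases v v' rule: linorder_cases) (auto simp: nw)
    qed
  qed
qed

end

section \<open>Processing one node\<close>

text \<open>The chunks of a node are read three times: both children go to the same stream, so all
  zeros must have been appended before the first one is. The sizes of the children are the distances
  that the write position moves.\<close>

definition node_prog :: com where
  "node_prog =
     Store 1 (Reg r_node) (Reg r_out) ;;
     Store 2 (Reg r_out) (Const 0) ;;
     Assign r_step (Reg r_chunk) ;;
     Assign r_end (Reg r_start +\<^sub>e Load 9 (Reg r_node)) ;;
     Assign r_i (Reg r_start) ;; Assign r_j (Const 0) ;;
     Assign r_base (Reg r_out) ;; Assign r_unit (Const 1) ;;
     pass_prog 2 (Load a_bits (read_exp 3)) (Reg r_len) ;;
     Assign r_i (Reg r_start) ;; Assign r_j (Reg r_pos) ;;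
     Assign r_base (Const 0) ;; Assign r_unit (Reg r_width) ;;
     pass_prog 4 (Load a_zeros (read_exp 3)) (Reg r_len -\<^sub>e Load a_count (read_exp 3)) ;;
     Store 9 (Reg r_node +\<^sub>e Reg r_node) (Reg r_j -\<^sub>e Reg r_pos) ;;
     Assign r_pos (Reg r_j) ;; Assign r_i (Reg r_start) ;;
     pass_prog 4 (Load a_ones (read_exp 3)) (Load a_count (read_exp 3)) ;;
     Store 9 (Reg r_node +\<^sub>e Reg r_node +\<^sub>e Const 1) (Reg r_j -\<^sub>e Reg r_pos) ;;
     Assign r_pos (Reg r_j) ;;
     Assign r_out (Reg r_out +\<^sub>e (Load 9 (Reg r_node) +\<^sub>e (Reg r_w -\<^sub>e Const 1)) div\<^sub>e Reg r_w) ;;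
     Assign r_start (Reg r_end) ;;
     Assign r_node (Reg r_node +\<^sub>e Const 1)"

lemma written_node_prog [simp]:
  "written_regs node_prog = {r_node, r_out, r_start, r_pos, r_i, r_end, r_step, r_len, r_val, r_cnt,
     r_t, r_q, r_r, r_j, r_base, r_unit}"
  "written_arrays node_prog = {1, 2, 4, 9}"
  by (auto simp: node_prog_def)

section \<open>Parameters of digits and chunks\<close>

context wavelet
begin

definition chunk :: nat where "chunk = floor_sqrt (w div 2)"

definition width :: nat where "width = min k chunk"

text \<open>\<open>d - d mod width\<close> is the first level of the current group. For an
  incomplete last group the truncated subtraction yields 0: the digit then also contains bits that
  have already been used, and all digits keep the same width.\<close>

definition shift :: "nat \<Rightarrow> nat" where
  "shift d = k - (d - d mod width + width)"

definition bitpos :: "nat \<Rightarrow> nat" where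
  "bitpos d = k - 1 - d - shift d"

lemma chunk_pos: "1 \<le> chunk" "chunk * chunk \<le> w div 2"
  using w_ge floor_sqrt_power2_le[of "w div 2"]
  by (auto simp: chunk_def power2_eq_square Suc_le_eq)

lemma width_pos: "1 \<le> width" "width \<le> chunk" "width \<le> k" "chunk * width \<le> w div 2"
  using chunk_pos k order_trans[OF mult_le_mono2[of "min k chunk" chunk chunk], of "w div 2"]
  by (simp_all add: width_def)

lemma bitpos: "d < k \<Longrightarrow> bitpos d < width" "d < k \<Longrightarrow> shift d + bitpos d = k - 1 - d"
proof -
  assume d: "d < k"
  have "d mod width < width" using width_pos by simp
  then show "bitpos d < width" using d width_pos by (auto simp: bitpos_def shift_def)
  have "d mod width \<le> d" by simp
  then have "shift d \<le> k - 1 - d" using \<open>d mod width < width\<close> unfolding shift_def by linarith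
  then show "shift d + bitpos d = k - 1 - d" by (simp add: bitpos_def)
qed

lemma chunk_width_less: "chunk * width < w" "chunk * width < 2 ^ w"
  using width_pos(4) w_ge less_exp[of w] by linarith+

text \<open>Bit offsets of the form \<open>j mod w * width\<close> must be computable without
  overflow.\<close>

lemma w_chunk_less: "w * chunk < 2 ^ w"
proof -
  define h where "h = w div 2"
  have h: "w \<le> 2 * h + 1" "2 * h \<le> w" by (simp_all add: h_def)
  \<comment> \<open>This is \<open>(chunk - 1)^2 >= 0\<close>. It bounds \<open>chunk\<close> by
    about half of \<open>h\<close>, and \<open>h + 1 <= 2 ^ h\<close> then does the rest uniformly,
    without inspecting small word sizes.\<close>
  have "2 * chunk \<le> chunk * chunk + 1" by (cases chunk) auto
  then have c: "2 * chunk \<le> h + 1" using chunk_pos(2) by (simp add: h_def)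
  have "w * (2 * chunk) \<le> (2 * h + 1) * (h + 1)"
    by (rule mult_le_mono[OF h(1) c])
  moreover have "(2 * h + 1) * (h + 1) < 2 * ((h + 1) * (h + 1))" by simp
  moreover have "(h + 1) * (h + 1) \<le> 2 ^ h * 2 ^ h"
    using less_exp[of h] by (intro mult_le_mono) (simp_all add: Suc_le_eq)
  moreover have "(2::nat) ^ h * 2 ^ h = 2 ^ (2 * h)" by (simp add: power_add mult_2)
  moreover have "(2::nat) ^ (2 * h) \<le> 2 ^ w" using h(2) by (intro power_increasing) simp_all
  ultimately show ?thesis by linarith
qed

lemma w_width_less: "w * width < 2 ^ w"
  using w_chunk_less width_pos(2) by (meson le_less_trans mult_le_mono2)

lemma stream_fits: "(n * width) div w + 2 < 2 ^ w" "n < 2 ^ w"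
proof -
  have "width \<le> w" using width_pos k_less by simp
  then have "(n * width) div w \<le> (n * w) div w" by (intro div_le_mono mult_le_mono2)
  then have "(n * width) div w \<le> n" using w_ge by simp
  then show "(n * width) div w + 2 < 2 ^ w" using two_n_less n_pos n_less(1) w_ge
    by (cases "n = 2") (auto dest: less_imp_le)
  show "n < 2 ^ w" using two_n_less by simp
qed

abbreviation digits :: "nat \<Rightarrow> nat list \<Rightarrow> bool list" where
  "digits d xs \<equiv> concat (map (digit (shift d) width) xs)"

definition constants :: "state \<Rightarrow> bool" where
  "constants st \<longleftrightarrow> reg st 0 = n \<and> reg st 1 = 2 ^ k \<and> reg st r_w = w \<and> reg st r_k = k \<and>
     reg st r_chunk = chunk \<and> reg st r_width = width \<and> reg st r_per_word = w div k \<and> mem st 0 = packed w k s"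

definition level_ready :: "nat \<Rightarrow> state \<Rightarrow> bool" where
  "level_ready d st \<longleftrightarrow> constants st \<and> reg st r_depth = d \<and> reg st r_shift = shift d \<and> reg st r_bit = bitpos d \<and>
     tables_upto width (bitpos d) (2 ^ (chunk * width)) st \<and> stream w (mem st 3) 0 (digits d (level d))"

lemma level_ready_agree:
  assumes "level_ready d st" "\<forall>r \<in> {0, 1, 2, 3, 4, 5, 6, 8, 9, 25}. reg st' r = reg st r"
    "\<forall>a \<in> {0, 3, 5, 6, 7, 8}. mem st' a = mem st a"
  shows "level_ready d st'"
  using assms by (simp add: level_ready_def constants_def tables_upto_def)

lemma length_node_le: "d \<le> k \<Longrightarrow> 2 ^ d \<le> v \<Longrightarrow> v < 2 ^ Suc d \<Longrightarrow> length (node v) \<le> n"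
  using length_prefix_le[of v d] by simp

text \<open>Taking and dropping characters is taking and dropping bits, scaled by
  \<open>width\<close>. A chunk has at most \<open>chunk * width\<close> bits, so its value is a
  valid table index.\<close>

lemma read_chunk:
  assumes "level_ready d st" "2 ^ d \<le> v" "v < 2 ^ Suc d" "d < k"
    and "reg st r_i = length (prefix d v) + y" "reg st r_len = e" "e \<le> chunk" "y + e \<le> length (node v)"
  defines "xs \<equiv> take e (drop y (node v))"
  shows "eval w (read_exp 3) st = val (digits d xs)"
    and "eval w (Load a_bits (read_exp 3)) st = val (map (\<lambda>c. bit c (k - 1 - d)) xs)"
    and "eval w (Load a_zeros (read_exp 3)) st = val (digits d (filter (\<lambda>c. \<not> bit c (k - 1 - d)) xs))"
    and "eval w (Load a_ones (read_exp 3)) st = val (digits d (filter (\<lambda>c. bit c (k - 1 - d)) xs))"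
    and "eval w (Load a_count (read_exp 3)) st = length (filter (\<lambda>c. bit c (k - 1 - d)) xs)"
proof -
  have e: "e * width \<le> chunk * width" using assms by simp
  have len: "length (digits d (level d)) = n * width" using length_level assms by simp
  let ?i = "length (prefix d v) + y"
  have "?i + e \<le> n" using length_prefix_le[of v d] assms by simp
  then have i: "?i * width + e * width \<le> n * width" by (simp flip: add_mult_distrib)
  have "drop ?i (level d) = drop y (drop (length (prefix d v)) (level d))" by (simp add: add.commute)
  then have "take e (drop ?i (level d)) = take e (drop y (take (length (node v)) (drop (length (prefix d v)) (level d))))"
    using assms(8) by (simp add: drop_take min_def add.commute)
  then have tk: "take e (drop ?i (level d)) = xs"
    using take_drop_level[OF assms(3,2)] by (simp add: xs_def)
  have "eval w (read_exp 3) st = val (take (e * width) (drop (?i * width) (digits d (level d))))"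
    using read_exp[of st w width 3 "digits d (level d)"] assms w_ge w_width_less i stream_fits
      chunk_width_less e unfolding len by (simp add: level_ready_def constants_def)
  then show r: "eval w (read_exp 3) st = val (digits d xs)"
    by (simp add: take_concat_digits drop_concat_digits tk)
  have b: "digit (shift d) width c ! bitpos d = bit c (k - 1 - d)" for c
    using bitpos assms(4) by (simp add: digit_def)
  have "val (digits d xs) < 2 ^ (length xs * width)" using val_less[of "digits d xs"] by simp
  also have "\<dots> \<le> 2 ^ (chunk * width)" using assms(7) by (intro power_increasing mult_le_mono1) (simp_all add: xs_def)
  finally have lt: "val (digits d xs) < 2 ^ (chunk * width)" .
  define gs where "gs = map (digit (shift d) width) xs"
  have gs: "\<forall>g\<in>set gs. length g = width" by (auto simp: gs_def)
  have fl: "filter (\<lambda>g. P (g ! bitpos d)) gs = map (digit (shift d) width) (filter (\<lambda>c. P (bit c (k - 1 - d))) xs)" for P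
    by (simp add: gs_def filter_map o_def b)
  have T: "tables_upto width (bitpos d) (2 ^ (chunk * width)) st" using assms(1) by (simp add: level_ready_def)
  note D = digit_rec_val[OF bitpos(1)[OF assms(4)] gs]
  show "eval w (Load a_bits (read_exp 3)) st = val (map (\<lambda>c. bit c (k - 1 - d)) xs)"
    using D(2) T lt r by (simp add: tables_upto_def gs_def[symmetric]) (simp add: gs_def o_def b)
  show "eval w (Load a_zeros (read_exp 3)) st = val (digits d (filter (\<lambda>c. \<not> bit c (k - 1 - d)) xs))"
    using D(1)[of False] T lt r fl[of "\<lambda>b. b = False"] by (simp add: tables_upto_def gs_def[symmetric])
  show "eval w (Load a_ones (read_exp 3)) st = val (digits d (filter (\<lambda>c. bit c (k - 1 - d)) xs))"
    using D(1)[of True] T lt r fl[of "\<lambda>b. b = True"] by (simp add: tables_upto_def gs_def[symmetric])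
  show "eval w (Load a_count (read_exp 3)) st = length (filter (\<lambda>c. bit c (k - 1 - d)) xs)"
    using D(3) T lt r fl[of "\<lambda>b. b"] by (simp add: tables_upto_def gs_def[symmetric])
qed

definition at_node :: "nat \<Rightarrow> nat \<Rightarrow> state \<Rightarrow> bool" where
  "at_node d v st \<longleftrightarrow> level_ready d st \<and> 2 ^ d \<le> v \<and> v < 2 ^ Suc d \<and> d < k \<and>
     reg st r_i = length (prefix d v) \<and> reg st r_end = length (prefix d v) + length (node v) \<and> reg st r_step = chunk"

lemma at_nodeD:
  assumes "at_node d v st"
  shows "reg st r_w = w" "2 \<le> w" "0 < chunk" "reg st r_step = chunk" "reg st r_i = length (prefix d v)"
    "reg st r_end = length (prefix d v) + length (node v)"
    "length (prefix d v) + length (node v) < 2 ^ w"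
  using assms length_prefix_le[of v d] stream_fits w_ge chunk_pos
  by (auto simp: at_node_def level_ready_def constants_def)

text \<open>The count is looked up after \<open>r_val\<close> has been overwritten; hence the
  arbitrary value \<open>z\<close>.\<close>

lemma read_chunk':
  assumes "at_node d v st" "agree (pass_prog a ev ec) st st'" "a = 2 \<or> a = 4"
    "reg st' r_i = length (prefix d v) + y" "reg st' r_len = e" "e \<le> chunk" "y + e \<le> length (node v)"
  shows "eval w (Load a_bits (read_exp 3)) st' = val (map (\<lambda>c. bit c (k - 1 - d)) (take e (drop y (node v))))"
    and "eval w (Load a_zeros (read_exp 3)) st' =
      val (digits d (filter (\<lambda>c. \<not> bit c (k - 1 - d)) (take e (drop y (node v)))))"
    and "eval w (Load a_ones (read_exp 3)) st' =
      val (digits d (filter (\<lambda>c. bit c (k - 1 - d)) (take e (drop y (node v)))))"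
    and "eval w (Load a_count (read_exp 3)) (st'\<lparr>reg := (reg st')(r_val := z)\<rparr>) =
      length (filter (\<lambda>c. bit c (k - 1 - d)) (take e (drop y (node v))))"
proof -
  have "level_ready d st'" "level_ready d (st'\<lparr>reg := (reg st')(r_val := z)\<rparr>)"
    by (rule level_ready_agree[of d st]; use assms in \<open>auto simp: at_node_def agree_def\<close>)+
  then show "eval w (Load a_bits (read_exp 3)) st' = val (map (\<lambda>c. bit c (k - 1 - d)) (take e (drop y (node v))))"
    "eval w (Load a_zeros (read_exp 3)) st' =
      val (digits d (filter (\<lambda>c. \<not> bit c (k - 1 - d)) (take e (drop y (node v)))))"
    "eval w (Load a_ones (read_exp 3)) st' =
      val (digits d (filter (\<lambda>c. bit c (k - 1 - d)) (take e (drop y (node v)))))"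
    "eval w (Load a_count (read_exp 3)) (st'\<lparr>reg := (reg st')(r_val := z)\<rparr>) =
      length (filter (\<lambda>c. bit c (k - 1 - d)) (take e (drop y (node v))))"
    using assms unfolding at_node_def
    by (intro read_chunk[where d = d and v = v and y = y and e = e]; simp)+
qed

lemma length_digits_chunk: "e \<le> chunk \<Longrightarrow> length (digits d (filter P (take e xs))) \<le> w"
proof -
  assume "e \<le> chunk"
  have "length (filter P (take e xs)) \<le> chunk"
    using length_filter_le[of P "take e xs"] \<open>e \<le> chunk\<close> by simp
  then have "length (digits d (filter P (take e xs))) \<le> chunk * width"
    unfolding length_concat_digits by (rule mult_le_mono1)
  then show ?thesis using chunk_width_less(1) by linarith
qed

lemma pass_bits:
  assumes "at_node d v st" "reg st r_unit = 1" "reg st r_base = out_pos v" "reg st r_j = 0"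
    "mem st 2 (out_pos v) = 0"
  shows "wp w (pass_prog 2 (Load a_bits (read_exp 3)) (Reg r_len)) st (\<lambda>t s'.
    t \<le> 400 * (length (node v) div chunk + 2) \<and> stream w (mem s' 2) (out_pos v) (mask_of v) \<and>
    (\<forall>q < out_pos v. mem s' 2 q = mem st 2 q))"
proof -
  let ?h = "\<lambda>c. [bit c (k - 1 - d)]"
  have v: "2 ^ d \<le> v" "v < 2 ^ Suc d" "d < k" using assms by (simp_all add: at_node_def)
  have c: "concat (map ?h xs) = map (\<lambda>c. bit c (k - 1 - d)) xs" for xs by (induction xs) simp_all
  have m: "mask_of v = concat (map ?h (node v))" using v by (simp add: c mask_of_def floor_log_node)
  have "(2::nat) ^ Suc d \<le> 2 ^ k" using v(3) by (intro power_increasing) simp_all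
  then have v': "1 \<le> v" "v < 2 ^ k" using v order_trans[of 1 "2 ^ d" v] by simp_all
  have cw: "chunk \<le> w" using chunk_width_less(1) width_pos(1)
    by (metis less_imp_le_nat mult.right_neutral mult_le_mono2 order_trans)
  have "wp w (pass_prog 2 (Load a_bits (read_exp 3)) (Reg r_len)) st (\<lambda>t s'.
    t \<le> 400 * (length (node v) div chunk + 2) \<and>
    reg s' r_j * 1 = length ([] @ concat (map ?h (node v))) \<and>
    stream w (mem s' 2) (out_pos v) ([] @ concat (map ?h (node v))) \<and>
    (\<forall>q < out_pos v. mem s' 2 q = mem st 2 q))"
  proof (rule pass_prog[where M = "length (node v)" and m = chunk])
    fix s' y e
    assume *: "agree (pass_prog 2 (Load a_bits (read_exp 3)) (Reg r_len)) st s'"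
      "reg s' r_i = length (prefix d v) + y" "reg s' r_len = e"
      "0 < e" "e \<le> chunk" "y + e \<le> length (node v)"
    show "eval w (Load a_bits (read_exp 3)) s' = val (concat (map ?h (take e (drop y (node v))))) \<and>
      eval w (Reg r_len) (s'\<lparr>reg := (reg s')(r_val := val (concat (map ?h (take e (drop y (node v))))))\<rparr>) * 1
        = length (concat (map ?h (take e (drop y (node v))))) \<and>
      length (concat (map ?h (take e (drop y (node v))))) \<le> w"
      unfolding c using read_chunk'(1)[OF assms(1) *(1) disjI1[OF refl] *(2,3,5,6)] * cw by simp
  qed (use assms at_nodeD[OF assms(1)] out_pos_bound[OF v'] length_node_le[of d v] v less_exp[of w] stream_fits in
        \<open>auto simp: stream_Nil c\<close>)
  then show ?thesis unfolding m by (rule wp_mono) simp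
qed

text \<open>A filter is written as a concatenation in which rejected characters contribute the empty
  list. The unit is one digit, so positions count characters.\<close>

lemma pass_select:
  assumes "at_node d v st" "reg st r_unit = width" "reg st r_base = 0" "reg st r_j = length ys"
    "stream w (mem st 4) 0 (digits d ys)" "length ys + length (filter (\<lambda>c. bit c (k - 1 - d) = b) (node v)) \<le> n"
    and "ev = Load (if b then a_ones else a_zeros) (read_exp 3)"
    and "ec = (if b then Load a_count (read_exp 3) else Reg r_len -\<^sub>e Load a_count (read_exp 3))"
  shows "wp w (pass_prog 4 ev ec) st (\<lambda>t s'. t \<le> 400 * (length (node v) div chunk + 2) \<and>
    reg s' r_j = length (ys @ filter (\<lambda>c. bit c (k - 1 - d) = b) (node v)) \<and>
    stream w (mem s' 4) 0 (digits d (ys @ filter (\<lambda>c. bit c (k - 1 - d) = b) (node v))))"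
proof -
  let ?P = "\<lambda>c. bit c (k - 1 - d) = b"
  let ?h = "\<lambda>c. if bit c (k - 1 - d) = b then digit (shift d) width c else []"
  have c: "concat (map ?h xs) = digits d (filter ?P xs)" for xs by (induction xs) simp_all
  have bound: "length (digits d ys) + length (concat (map ?h (node v))) \<le> n * width"
    unfolding c using assms(6) by (simp flip: add_mult_distrib)
  have "wp w (pass_prog 4 ev ec) st (\<lambda>t s'. t \<le> 400 * (length (node v) div chunk + 2) \<and>
    reg s' r_j * width = length (digits d ys @ concat (map ?h (node v))) \<and>
    stream w (mem s' 4) 0 (digits d ys @ concat (map ?h (node v))) \<and> (\<forall>q<0. mem s' 4 q = mem st 4 q))"
  proof (rule pass_prog[where u = width and M = n and m = chunk])
    fix s' y e
    assume *: "agree (pass_prog 4 ev ec) st s'" "reg s' r_i = length (prefix d v) + y" "reg s' r_len = e"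
      "0 < e" "e \<le> chunk" "y + e \<le> length (node v)"
    let ?xs = "take e (drop y (node v))"
    note r = read_chunk'[OF assms(1) *(1) disjI2[OF refl] *(2,3,5,6)]
    have "eval w ec (s'\<lparr>reg := (reg s')(r_val := z)\<rparr>) = length (filter ?P ?xs)" for z
    proof (cases b)
      case True
      then show ?thesis using r(4) assms(8) by simp
    next
      case False
      have l: "length ?xs = e" using *(6) by simp
      then have "length (filter ?P ?xs) + length (filter (\<lambda>c. bit c (k - 1 - d)) ?xs) = e"
        using False sum_length_filter_compl[of "\<lambda>c. bit c (k - 1 - d)" ?xs] by simp
      moreover have "e < 2 ^ w" using *(6) at_nodeD(7)[OF assms(1)] by simp
      ultimately show ?thesis
        using False r(4)[of z] assms(8) *(3) eval_Sub[of w "Load a_count (read_exp 3)" _ "Reg r_len"]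
        by (simp del: eval.simps(3,4) eval_op.simps)
    qed
    moreover have "eval w ev s' = val (concat (map ?h ?xs))"
      unfolding c using r(2,3) assms(7) by (cases b) simp_all
    ultimately show "eval w ev s' = val (concat (map ?h ?xs)) \<and>
      eval w ec (s'\<lparr>reg := (reg s')(r_val := val (concat (map ?h ?xs)))\<rparr>) * width = length (concat (map ?h ?xs)) \<and>
      length (concat (map ?h ?xs)) \<le> w"
      unfolding c using length_digits_chunk[OF *(5)] by simp
  qed (use assms at_nodeD[OF assms(1)] w_width_less width_pos stream_fits bound in \<open>simp_all\<close>)
  then show ?thesis
    unfolding c by (rule wp_mono) (use width_pos in \<open>auto simp flip: add_mult_distrib\<close>)
qed

end

section \<open>Invariants carried from node to node\<close>

context wavelet
begin

definition outputs :: "nat \<Rightarrow> state \<Rightarrow> bool" where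
  "outputs v st \<longleftrightarrow> (\<forall>u. 1 \<le> u \<and> u < v \<longrightarrow> mem st 1 u = out_pos u \<and>
     (\<forall>j < block u. mem st 2 (out_pos u + j) = val (take w (drop (w * j) (mask_of u)))))"

definition counts :: "nat \<Rightarrow> state \<Rightarrow> bool" where
  "counts v st \<longleftrightarrow> (\<forall>u. 1 \<le> u \<and> u < v \<longrightarrow> mem st 9 u = length (node u))"

text \<open>The blocks of the nodes before \<open>v\<close> end at \<open>out_pos v\<close> at the
  latest, and appending to the bitmask of \<open>v\<close> leaves all lower cells alone.\<close>

lemma outputs_cong:
  assumes "outputs v st" "\<forall>u<v. mem st' 1 u = mem st 1 u" "\<forall>q < out_pos v. mem st' 2 q = mem st 2 q"
  shows "outputs v st'"
  unfolding outputs_def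
proof (intro allI impI)
  fix u assume u: "1 \<le> u \<and> u < v"
  then have "out_pos u + block u \<le> out_pos v"
    using out_pos_Suc[of u] out_pos_mono[of "Suc u" v] by simp
  then show "mem st' 1 u = out_pos u \<and>
     (\<forall>j < block u. mem st' 2 (out_pos u + j) = val (take w (drop (w * j) (mask_of u))))"
    using u assms by (auto simp: outputs_def)
qed

lemma counts_cong: "counts v st \<Longrightarrow> \<forall>u<v. mem st' 9 u = mem st 9 u \<Longrightarrow> counts v st'"
  by (simp add: counts_def)

text \<open>Exactly the positions below \<open>2 * v\<close> are the root or have a parent before
  \<open>v\<close>, so these are the nodes whose sizes are known when \<open>v\<close> is
  reached.\<close>

definition node_inv :: "nat \<Rightarrow> nat \<Rightarrow> state \<Rightarrow> bool" where
  "node_inv d v st \<longleftrightarrow> level_ready d st \<and> reg st r_node = v \<and> reg st r_out = out_pos v \<and>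
     reg st r_start = length (prefix d v) \<and> reg st r_pos = length (prefix d v) \<and>
     stream w (mem st 4) 0 (digits d (prefix (Suc d) (2 * v))) \<and> outputs v st \<and> counts (2 * v) st"

text \<open>The part of the invariant that survives all three passes. The two streams being written
  are left out and tracked separately.\<close>

definition inside_node :: "nat \<Rightarrow> nat \<Rightarrow> state \<Rightarrow> bool" where
  "inside_node d v st \<longleftrightarrow> level_ready d st \<and> reg st r_node = v \<and> reg st r_out = out_pos v \<and>
     reg st r_start = length (prefix d v) \<and> reg st r_end = length (prefix d v) + length (node v) \<and>
     reg st r_step = chunk \<and> outputs v st \<and> mem st 1 v = out_pos v \<and> counts (2 * v) st"

lemma inside_node_cong:
  assumes "inside_node d v st"
    "\<forall>r \<in> {0, 1, 2, 3, 4, 5, 6, 7, 8, 9, 10, 11, 14, 15, 25}. reg st' r = reg st r"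
    "\<forall>a \<in> {0, 1, 3, 5, 6, 7, 8}. mem st' a = mem st a" "\<forall>u<2 * v. mem st' 9 u = mem st 9 u"
    "\<forall>q < out_pos v. mem st' 2 q = mem st 2 q"
  shows "inside_node d v st'"
  using assms level_ready_agree[of d st st'] outputs_cong[of v st st'] counts_cong[of "2 * v" st st']
  by (simp add: inside_node_def)

lemma outputs_Suc:
  assumes "outputs v st" "mem st 1 v = out_pos v" "stream w (mem st 2) (out_pos v) (mask_of v)"
  shows "outputs (Suc v) st"
proof -
  have "block v \<le> (length (node v) + w) div w" unfolding block_def by (intro div_le_mono) simp
  then have "block v \<le> length (node v) div w + 1" using w_ge by simp
  then have "\<forall>j<block v. mem st 2 (out_pos v + j) = val (take w (drop (w * j) (mask_of v)))"
    using assms(3) by (auto simp: stream_def mask_of_def)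
  then show ?thesis using assms(1,2) by (auto simp: outputs_def less_Suc_eq)
qed

text \<open>Each of the three passes costs 400 per full chunk and the equivalent of two more chunks.
  The latter make up most of the additive constant, which even an empty node has to pay.\<close>

lemma node_prog:
  assumes inv: "node_inv d v st" and v: "2 ^ d \<le> v" "v < 2 ^ Suc d" and d: "d < k"
  shows "wp w node_prog st (\<lambda>t s'. t \<le> 1200 * (length (node v) div chunk) + 2700 \<and> node_inv d (Suc v) s')"
proof -
  let ?len = "length (node v)" and ?L = "length (prefix d v)"
  let ?Z = "filter (\<lambda>c. bit c (k - 1 - d) = False) (node v)"
  let ?O = "filter (\<lambda>c. bit c (k - 1 - d) = True) (node v)"
  let ?X = "prefix (Suc d) (2 * v)"
  have "(2::nat) ^ Suc d \<le> 2 ^ k" using d by (intro power_increasing) simp_all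
  then have v': "1 \<le> v" "v < 2 ^ k" using v order_trans[of 1 "2 ^ d" v] by simp_all
  have w0: "0 < w" using w_ge by simp
  have ZO: "node (2 * v) = ?Z" "node (2 * v + 1) = ?O" using node_child[OF v d] by simp_all
  have len: "length ?Z + length ?O = ?len"
    using sum_length_filter_compl[of "\<lambda>c. bit c (k - 1 - d)" "node v"] by simp
  have X: "length ?X = ?L" using length_prefix_children[of d v] v d by simp
  have Ln: "?L + ?len \<le> n" using length_prefix_le[of v d] v d by simp
  have big: "n < 2 ^ w" "2 * v + 1 < 2 ^ w" "2 ^ w > (1::nat)" "2 \<le> w"
    using two_n_less v' size w_ge by (auto simp: n_def intro: one_less_power)
  have blk: "(out_pos v + (?len + (w - 1)) div w) = out_pos (Suc v)"
    using out_pos_Suc[OF v'(1)] w_ge by (simp add: block_def)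
  have "block v \<le> (?len + w) div w" unfolding block_def by (intro div_le_mono) simp
  then have "block v \<le> ?len div w + 1" using w_ge by simp
  then have out_less: "out_pos (Suc v) < 2 ^ w" using out_pos_bound[OF v'] out_pos_Suc[OF v'(1)] by simp
  \<comment> \<open>The sum formed for rounding up to whole words does not overflow, since
    \<open>n\<close> and \<open>w - 1\<close> are both below half of \<open>2 ^ w\<close>.\<close>
  have "2 ^ w = 2 * (2::nat) ^ (w - 1)" using power_Suc[of "2::nat" "w - 1"] w_ge by simp
  then have lw: "?len + (w - 1) < 2 ^ w" using Ln n_less(1) less_exp[of "w - 1"] by linarith
  have prefix': "prefix (Suc d) (2 * Suc v) = ?X @ ?Z @ ?O"
    using prefix_children[OF v(1)] ZO by simp
  \<comment> \<open>The program is cut at the passes and verified from its end, so that the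
    specification of each suffix is the continuation of the pass before it.\<close>
  define seg4 where "seg4 = Store 9 (Reg r_node +\<^sub>e Reg r_node +\<^sub>e Const 1) (Reg r_j -\<^sub>e Reg r_pos) ;;
     Assign r_pos (Reg r_j) ;;
     Assign r_out (Reg r_out +\<^sub>e (Load 9 (Reg r_node) +\<^sub>e (Reg r_w -\<^sub>e Const 1)) div\<^sub>e Reg r_w) ;;
     Assign r_start (Reg r_end) ;;
     Assign r_node (Reg r_node +\<^sub>e Const 1)"
  have s4: "wp w seg4 s1 (\<lambda>t s'. t \<le> 60 \<and> node_inv d (Suc v) s')"
    if s1: "inside_node d v s1" "stream w (mem s1 2) (out_pos v) (mask_of v)" "counts (2 * v + 1) s1"
      "reg s1 r_pos = length (?X @ ?Z)" "reg s1 r_j = length (?X @ ?Z @ ?O)"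
      "stream w (mem s1 4) 0 (digits d (?X @ ?Z @ ?O))" for s1
  proof -
    have c: "mem s1 9 v = ?len" "reg s1 r_w = w" using s1(1) v'
      by (auto simp: inside_node_def counts_def level_ready_def constants_def)
    have e1: "eval w (Reg r_node +\<^sub>e Reg r_node +\<^sub>e Const 1) s1 = Suc (2 * v)"
      using s1(1) big by (simp add: inside_node_def)
    have e2: "eval w (Reg r_j -\<^sub>e Reg r_pos) s1 = length ?O"
      by (subst eval_Sub) (use s1(4,5) X len Ln big in simp_all)
    have sub1: "(w + 2 ^ w - Suc 0) mod 2 ^ w = w - 1"
      using sub_mod_eq[of 1 w w] big less_exp[of w] by simp
    have e3: "eval w (Reg r_out +\<^sub>e (Load 9 (Reg r_node) +\<^sub>e (Reg r_w -\<^sub>e Const 1)) div\<^sub>e Reg r_w) s' = out_pos (Suc v)"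
      if s': "reg s' r_out = out_pos v" "mem s' 9 v = ?len" "reg s' r_node = v" "reg s' r_w = w" for s'
    proof -
      have "eval w (Reg r_w -\<^sub>e Const 1) s' = w - 1" using s' sub1 big by simp
      moreover have "eval w (Load 9 (Reg r_node)) s' = ?len" using s' by simp
      ultimately have "eval w (Load 9 (Reg r_node) +\<^sub>e (Reg r_w -\<^sub>e Const 1)) s' = ?len + (w - 1)"
        using eval_Add[of w "Load 9 (Reg r_node)" s' "Reg r_w -\<^sub>e Const 1"] lw by argo
      then have "eval w ((Load 9 (Reg r_node) +\<^sub>e (Reg r_w -\<^sub>e Const 1)) div\<^sub>e Reg r_w) s' = (?len + (w - 1)) div w"
        unfolding eval.simps(3)[of w Div] eval_op.simps eval.simps(2) s'(4) by simp
      then show ?thesis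
        using eval_Add[of w "Reg r_out" s' "(Load 9 (Reg r_node) +\<^sub>e (Reg r_w -\<^sub>e Const 1)) div\<^sub>e Reg r_w"]
          out_less blk s'(1) unfolding eval.simps(2) by argo
    qed
    have fin: "node_inv d (Suc v) s2"
      if s2: "\<forall>r \<in> {0, 1, 2, 3, 4, 5, 6, 8, 9, 25}. reg s2 r = reg s1 r" "\<forall>a. a \<noteq> 9 \<longrightarrow> mem s2 a = mem s1 a"
        "mem s2 9 = (mem s1 9)(Suc (2 * v) := length ?O)" "reg s2 r_pos = length (?X @ ?Z @ ?O)"
        "reg s2 r_out = out_pos (Suc v)" "reg s2 r_start = ?L + ?len" "reg s2 r_node = Suc v" for s2
      unfolding node_inv_def
    proof (intro conjI)
      show "level_ready d s2"
        by (rule level_ready_agree[of d s1]) (use s1(1) s2(1,2) in \<open>simp_all add: inside_node_def\<close>)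
      have "outputs (Suc v) s1"
        by (rule outputs_Suc) (use s1(1,2) in \<open>simp_all add: inside_node_def\<close>)
      then show "outputs (Suc v) s2" by (rule outputs_cong) (simp_all add: s2(2))
      show "counts (2 * Suc v) s2" using s1(3) ZO
        by (auto simp: counts_def s2(3) less_Suc_eq)
      show "stream w (mem s2 4) 0 (digits d (prefix (Suc d) (2 * Suc v)))"
        using s1(6) unfolding prefix' by (simp add: s2(2))
      show "reg s2 r_pos = length (prefix d (Suc v))"
        using s2(4) X len by (simp add: prefix_Suc[OF v(1)])
    qed (use s2 in \<open>simp_all add: prefix_Suc[OF v(1)]\<close>)
    have v1: "Suc v < 2 ^ w" using big by simp
    have r: "reg s1 r_out = out_pos v" "reg s1 r_node = v" "reg s1 r_end = ?L + ?len"
      using s1(1) by (simp_all add: inside_node_def)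
    show ?thesis
      unfolding seg4_def wp_simps e1 e2
      apply (subst e3)
          apply (simp_all add: r c w0 v1)
      apply (rule fin)
            apply (simp_all add: s1(5))
      done
  qed
  define seg3 where "seg3 = Store 9 (Reg r_node +\<^sub>e Reg r_node) (Reg r_j -\<^sub>e Reg r_pos) ;;
     Assign r_pos (Reg r_j) ;; Assign r_i (Reg r_start) ;;
     pass_prog 4 (Load a_ones (read_exp 3)) (Load a_count (read_exp 3)) ;; seg4"
  have s3: "wp w seg3 s1 (\<lambda>t s'. t \<le> 400 * (?len div chunk + 2) + 80 \<and> node_inv d (Suc v) s')"
    if s1: "inside_node d v s1" "stream w (mem s1 2) (out_pos v) (mask_of v)"
      "reg s1 r_pos = length ?X" "reg s1 r_j = length (?X @ ?Z)"
      "stream w (mem s1 4) 0 (digits d (?X @ ?Z))" "reg s1 r_base = 0" "reg s1 r_unit = width" for s1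
  proof -
    have sub: "(?L + length ?Z + 2 ^ w - ?L) mod 2 ^ w = length ?Z"
      using sub_mod_eq[of ?L "?L + length ?Z" w] len Ln big by simp
    define s2 where "s2 = s1\<lparr>mem := (mem s1)(9 := (mem s1 9)(2 * v := length ?Z)),
      reg := (reg s1)(r_pos := length (?X @ ?Z), r_i := ?L)\<rparr>"
    have in2: "inside_node d v s2" using s1(1) by (rule inside_node_cong) (auto simp: s2_def)
    have p: "wp w (pass_prog 4 (Load a_ones (read_exp 3)) (Load a_count (read_exp 3))) s2
      (\<lambda>t s'. t \<le> 400 * (?len div chunk + 2) \<and> reg s' r_j = length ((?X @ ?Z) @ ?O) \<and>
      stream w (mem s' 4) 0 (digits d ((?X @ ?Z) @ ?O)))"
    proof (rule pass_select)
      show "at_node d v s2" using in2 v d by (auto simp: at_node_def inside_node_def s2_def)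
      show "length (?X @ ?Z) + length ?O \<le> n" using X len Ln by simp
    qed (use s1 in \<open>simp_all add: s2_def\<close>)
    have "wp w (pass_prog 4 (Load a_ones (read_exp 3)) (Load a_count (read_exp 3)) ;; seg4) s2
      (\<lambda>t s'. t \<le> 400 * (?len div chunk + 2) + 60 \<and> node_inv d (Suc v) s')"
    proof (subst wp_Seq, rule wp_mono_agree[OF p])
      fix t s'
      assume s': "t \<le> 400 * (?len div chunk + 2) \<and> reg s' r_j = length ((?X @ ?Z) @ ?O) \<and>
          stream w (mem s' 4) 0 (digits d ((?X @ ?Z) @ ?O))"
        and ag: "agree (pass_prog 4 (Load a_ones (read_exp 3)) (Load a_count (read_exp 3))) s2 s'"
      have "inside_node d v s'" using in2 by (rule inside_node_cong) (use ag in \<open>auto simp: agree_def\<close>)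
      moreover have "counts (2 * v + 1) s'"
        using s1(1) ZO ag by (auto simp: counts_def inside_node_def less_Suc_eq agree_def s2_def)
      ultimately have "wp w seg4 s' (\<lambda>t s'. t \<le> 60 \<and> node_inv d (Suc v) s')"
        using s' ag s1 by (intro s4) (simp_all add: agree_def s2_def)
      then show "wp w seg4 s' (\<lambda>t' s''. t + t' \<le> 400 * (?len div chunk + 2) + 60 \<and> node_inv d (Suc v) s'')"
        by (rule wp_mono) (use s' in auto)
    qed
    then show ?thesis
      using s1(1) sub big X w0
      by (simp add: seg3_def wp_simps inside_node_def s1(3,4) mult_2[symmetric] s2_def) (erule wp_mono, erule wp_mono, auto)
  qed
  define seg2 where "seg2 = Assign r_i (Reg r_start) ;; Assign r_j (Reg r_pos) ;;
     Assign r_base (Const 0) ;; Assign r_unit (Reg r_width) ;;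
     pass_prog 4 (Load a_zeros (read_exp 3)) (Reg r_len -\<^sub>e Load a_count (read_exp 3)) ;; seg3"
  have s2: "wp w seg2 s1 (\<lambda>t s'. t \<le> 800 * (?len div chunk + 2) + 100 \<and> node_inv d (Suc v) s')"
    if s1: "inside_node d v s1" "stream w (mem s1 2) (out_pos v) (mask_of v)"
      "reg s1 r_pos = length ?X" "stream w (mem s1 4) 0 (digits d ?X)" for s1
  proof -
    let ?c = "Reg r_len -\<^sub>e Load a_count (read_exp 3)"
    define s2 where "s2 = s1\<lparr>reg := (reg s1)(r_i := ?L, r_j := length ?X, r_base := 0, r_unit := width)\<rparr>"
    have in2: "inside_node d v s2" using s1(1) by (rule inside_node_cong) (auto simp: s2_def)
    have p: "wp w (pass_prog 4 (Load a_zeros (read_exp 3)) ?c) s2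
      (\<lambda>t s'. t \<le> 400 * (?len div chunk + 2) \<and> reg s' r_j = length (?X @ ?Z) \<and>
      stream w (mem s' 4) 0 (digits d (?X @ ?Z)))"
    proof (rule pass_select)
      show "at_node d v s2" using in2 v d by (auto simp: at_node_def inside_node_def s2_def)
      show "length ?X + length ?Z \<le> n" using X len Ln by simp
    qed (use s1 in \<open>simp_all add: s2_def\<close>)
    have "wp w (pass_prog 4 (Load a_zeros (read_exp 3)) ?c ;; seg3) s2
      (\<lambda>t s'. t \<le> 800 * (?len div chunk + 2) + 80 \<and> node_inv d (Suc v) s')"
    proof (subst wp_Seq, rule wp_mono_agree[OF p])
      fix t s'
      assume s': "t \<le> 400 * (?len div chunk + 2) \<and> reg s' r_j = length (?X @ ?Z) \<and>
          stream w (mem s' 4) 0 (digits d (?X @ ?Z))"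
        and ag: "agree (pass_prog 4 (Load a_zeros (read_exp 3)) ?c) s2 s'"
      have "inside_node d v s'" using in2 by (rule inside_node_cong) (use ag in \<open>auto simp: agree_def\<close>)
      then have "wp w seg3 s' (\<lambda>t s'. t \<le> 400 * (?len div chunk + 2) + 80 \<and> node_inv d (Suc v) s')"
        using s' ag s1 by (intro s3) (simp_all add: agree_def s2_def)
      then show "wp w seg3 s' (\<lambda>t' s''. t + t' \<le> 800 * (?len div chunk + 2) + 80 \<and> node_inv d (Suc v) s'')"
        by (rule wp_mono) (use s' in auto)
    qed
    moreover have "reg s1 r_start = ?L" "reg s1 r_width = width"
      using s1(1) by (simp_all add: inside_node_def level_ready_def constants_def)
    ultimately show ?thesis
      by (simp add: seg2_def wp_simps s1(3) s2_def) (erule wp_mono, erule wp_mono, auto)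
  qed
  define s1 where "s1 = st\<lparr>mem := (mem st)(1 := (mem st 1)(v := out_pos v), 2 := (mem st 2)(out_pos v := 0)),
    reg := (reg st)(r_step := chunk, r_end := ?L + ?len, r_i := ?L, r_j := 0, r_base := out_pos v, r_unit := 1)\<rparr>"
  have in1: "inside_node d v s1"
    unfolding inside_node_def
  proof (intro conjI)
    show "level_ready d s1"
      by (rule level_ready_agree[of d st]) (use inv in \<open>auto simp: s1_def node_inv_def\<close>)
    have "outputs v st" using inv by (simp add: node_inv_def)
    then show "outputs v s1" by (rule outputs_cong) (auto simp: s1_def)
  qed (use inv in \<open>auto simp: s1_def node_inv_def counts_def\<close>)
  have p: "wp w (pass_prog 2 (Load a_bits (read_exp 3)) (Reg r_len)) s1 (\<lambda>t s'.
    t \<le> 400 * (?len div chunk + 2) \<and> stream w (mem s' 2) (out_pos v) (mask_of v) \<and>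
    (\<forall>q < out_pos v. mem s' 2 q = mem s1 2 q))"
  proof (rule pass_bits)
    show "at_node d v s1" using in1 v d by (auto simp: at_node_def inside_node_def s1_def)
  qed (simp_all add: s1_def)
  have "wp w (pass_prog 2 (Load a_bits (read_exp 3)) (Reg r_len) ;; seg2) s1
      (\<lambda>t s'. t \<le> 1200 * (?len div chunk + 2) + 100 \<and> node_inv d (Suc v) s')"
  proof (subst wp_Seq, rule wp_mono_agree[OF p])
    fix t s'
    assume s': "t \<le> 400 * (?len div chunk + 2) \<and> stream w (mem s' 2) (out_pos v) (mask_of v) \<and>
        (\<forall>q < out_pos v. mem s' 2 q = mem s1 2 q)"
      and ag: "agree (pass_prog 2 (Load a_bits (read_exp 3)) (Reg r_len)) s1 s'"
    have "inside_node d v s'" using in1 by (rule inside_node_cong) (use ag s' in \<open>auto simp: agree_def\<close>)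
    then have "wp w seg2 s' (\<lambda>t s'. t \<le> 800 * (?len div chunk + 2) + 100 \<and> node_inv d (Suc v) s')"
      using s' ag inv X by (intro s2) (simp_all add: agree_def s1_def node_inv_def)
    then show "wp w seg2 s' (\<lambda>t' s''. t + t' \<le> 1200 * (?len div chunk + 2) + 100 \<and> node_inv d (Suc v) s'')"
      by (rule wp_mono) (use s' in auto)
  qed
  moreover have "reg st r_node = v" "reg st r_out = out_pos v" "reg st r_start = ?L" "reg st r_chunk = chunk"
    "mem st 9 v = ?len"
    using inv v' by (auto simp: node_inv_def level_ready_def constants_def counts_def)
  moreover have "?L + ?len < 2 ^ w" using Ln big by simp
  moreover have node_prog: "node_prog =
     Store 1 (Reg r_node) (Reg r_out) ;;
     Store 2 (Reg r_out) (Const 0) ;;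
     Assign r_step (Reg r_chunk) ;;
     Assign r_end (Reg r_start +\<^sub>e Load 9 (Reg r_node)) ;;
     Assign r_i (Reg r_start) ;; Assign r_j (Const 0) ;;
     Assign r_base (Reg r_out) ;; Assign r_unit (Const 1) ;;
     pass_prog 2 (Load a_bits (read_exp 3)) (Reg r_len) ;; seg2"
    by (simp only: node_prog_def seg2_def seg3_def seg4_def)
  ultimately show ?thesis
    using big(3,4) w0 unfolding node_prog by (simp add: wp_simps s1_def) (erule wp_mono, erule wp_mono, auto)
qed

end

section \<open>Processing one level\<close>

text \<open>Rounding down is superadditive: the full chunks of all nodes of a level together number
  at most \<open>n div chunk\<close>. Incomplete chunks are paid by the constant per node.\<close>

lemma sum_div_le: "(\<Sum>i\<in>A. f i div (c::nat)) \<le> (\<Sum>i\<in>A. f i) div c"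
proof (induction A rule: infinite_finite_induct)
  case (insert x A)
  have "f x div c + (\<Sum>i\<in>A. f i) div c \<le> (f x + (\<Sum>i\<in>A. f i)) div c"
    by (cases "c = 0") (auto simp: less_eq_div_iff_mult_less_eq add_mult_distrib intro: add_mono)
  then show ?case using insert by simp
qed simp_all

text \<open>On level \<open>d\<close> the shifted position is 1, and it first becomes 2 at the
  position \<open>2 ^ Suc d\<close>, where the next level begins.\<close>

definition nodes_prog :: com where
  "nodes_prog =
     Store 4 (Const 0) (Const 0) ;; Assign r_pos (Const 0) ;; Assign r_start (Const 0) ;;
     While ((Reg r_node >>\<^sub>e Reg r_depth) <\<^sub>e Const 2) node_prog"

definition setup_prog :: "nat \<Rightarrow> exp \<Rightarrow> com" where
  "setup_prog a e =
     Store a (Const 0) (Const 0) ;; Assign r_i (Const 0) ;; Assign r_end (Reg 0) ;; Assign r_step e ;;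
     Assign r_j (Const 0) ;; Assign r_base (Const 0) ;; Assign r_unit (Reg r_width)"

text \<open>Array names are fixed in the program text, so the two streams cannot simply exchange
  roles. Copying adds one more term \<open>n div chunk\<close> per level.\<close>

definition copy_prog :: com where
  "copy_prog = setup_prog 3 (Reg r_chunk) ;; pass_prog 3 (read_exp 4) (Reg r_len)"

definition unpack_prog :: com where
  "unpack_prog = setup_prog 4 (Reg r_per_word) ;;
     pass_prog 4 (Load 0 (Reg r_i div\<^sub>e Reg r_per_word)) (Reg r_len)"

definition pack_prog :: com where
  "pack_prog = setup_prog 4 (Const 1) ;; pass_prog 4 (Load 11 (Reg r_i)) (Const 1)"

text \<open>Prefix sums of the counting sort. The counting itself is not repeated: array 9 already
  has the node sizes, recorded while the level above was processed.\<close>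

definition offsets_prog :: com where
  "offsets_prog =
     Assign r_x (Const 0) ;; Assign r_y (Const 1 <<\<^sub>e Reg r_depth) ;;
     While ((Reg r_y >>\<^sub>e Reg r_depth) <\<^sub>e Const 2)
       (Store 10 (Reg r_y) (Reg r_x) ;;
        Assign r_x (Reg r_x +\<^sub>e Load 9 (Reg r_y)) ;;
        Assign r_y (Reg r_y +\<^sub>e Const 1))"

text \<open>Register 1 holds \<open>2 ^ k\<close>, so \<open>2 ^ k + c\<close>, the heap position of
  the leaf of \<open>c\<close>, shifted by \<open>k - d\<close> is its ancestor on level
  \<open>d\<close>.\<close>

definition scatter_prog :: com where
  "scatter_prog =
     Assign r_i (Const 0) ;;
     While (Reg r_i <\<^sub>e Reg 0)
       (Assign r_x ((Load 0 (Reg r_i div\<^sub>e Reg r_per_word) >>\<^sub>e (Reg r_i mod\<^sub>e Reg r_per_word *\<^sub>e Reg r_k)) &\<^sub>e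
          mask_exp (Reg r_k)) ;;
        Assign r_y ((Reg 1 +\<^sub>e Reg r_x) >>\<^sub>e (Reg r_k -\<^sub>e Reg r_depth)) ;;
        Store 11 (Load 10 (Reg r_y)) ((Reg r_x >>\<^sub>e Reg r_shift) &\<^sub>e mask_exp (Reg r_width)) ;;
        Store 10 (Reg r_y) (Load 10 (Reg r_y) +\<^sub>e Const 1) ;;
        Assign r_i (Reg r_i +\<^sub>e Const 1))"

lemma written_level_progs [simp]:
  "written_regs nodes_prog = {r_node, r_out, r_start, r_pos, r_i, r_end, r_step, r_len, r_val, r_cnt,
     r_t, r_q, r_r, r_j, r_base, r_unit}" "written_arrays nodes_prog = {1, 2, 4, 9}"
  "written_regs (setup_prog a e) = {r_i, r_end, r_step, r_j, r_base, r_unit}" "written_arrays (setup_prog a e) = {a}"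
  "written_regs copy_prog = {r_i, r_end, r_step, r_len, r_val, r_cnt, r_t, r_q, r_r, r_j, r_base, r_unit}"
  "written_arrays copy_prog = {3}"
  "written_regs unpack_prog = {r_i, r_end, r_step, r_len, r_val, r_cnt, r_t, r_q, r_r, r_j, r_base, r_unit}"
  "written_arrays unpack_prog = {4}"
  "written_regs pack_prog = {r_i, r_end, r_step, r_len, r_val, r_cnt, r_t, r_q, r_r, r_j, r_base, r_unit}"
  "written_arrays pack_prog = {4}"
  "written_regs offsets_prog = {r_x, r_y}" "written_arrays offsets_prog = {10}"
  "written_regs scatter_prog = {r_i, r_x, r_y}" "written_arrays scatter_prog = {10, 11}"
  by (auto simp: nodes_prog_def setup_prog_def copy_prog_def unpack_prog_def pack_prog_def
      offsets_prog_def scatter_prog_def)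

lemma val_window: "and (drop_bit r (val bs)) (mask e) = val (take e (drop r bs))"
  by (rule bit_eqI) (auto simp: bit_simps bit_val)

context wavelet
begin

lemma shift_less_two:
  fixes v :: nat
  shows "drop_bit d v < 2 \<longleftrightarrow> v < 2 ^ Suc d"
proof -
  have "v div 2 ^ d < 2 \<longleftrightarrow> v < 2 * 2 ^ d" by (rule div_less_iff_less_mult) simp
  then show ?thesis by (simp add: drop_bit_eq_div)
qed

lemma two_less: "2 < (2::nat) ^ w"
  using power_strict_increasing[of 1 w "2::nat"] w_ge by simp

lemma nodes_prog:
  assumes st: "level_ready d st" "reg st r_node = 2 ^ d" "reg st r_out = out_pos (2 ^ d)"
    "outputs (2 ^ d) st" "counts (2 ^ Suc d) st" and d: "d < k"
  shows "wp w nodes_prog st (\<lambda>t s'. t \<le> 1200 * (n div chunk) + 2730 * 2 ^ d \<and> node_inv d (2 ^ Suc d) s')"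
proof -
  define s1 where "s1 = st\<lparr>mem := (mem st)(4 := (mem st 4)(0 := 0)), reg := (reg st)(r_pos := 0, r_start := 0)\<rparr>"
  have inv: "node_inv d (2 ^ d) s1"
    unfolding node_inv_def
  proof (intro conjI)
    show "level_ready d s1"
      by (rule level_ready_agree[of d st]) (use st in \<open>auto simp: s1_def\<close>)
    show "outputs (2 ^ d) s1" by (rule outputs_cong[OF st(4)]) (auto simp: s1_def)
    show "counts (2 * 2 ^ d) s1" using counts_cong[OF st(5)] by (auto simp: s1_def)
    show "stream w (mem s1 4) 0 (digits d (prefix (Suc d) (2 * 2 ^ d)))"
      using prefix_self[of "Suc d"] by (simp add: s1_def stream_Nil)
  qed (use st in \<open>simp_all add: s1_def\<close>)
  let ?T = "\<lambda>i. 1200 * (length (node (2 ^ d + i)) div chunk) + 2700"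
  let ?c = "(Reg r_node >>\<^sub>e Reg r_depth) <\<^sub>e Const 2"
  have loop: "wp w (While ?c node_prog) s1 (\<lambda>t s. t \<le> (\<Sum>i<2 ^ d. ?T i) + (2 ^ d + 1) * (cost ?c + 1) \<and>
    node_inv d (2 ^ d + 2 ^ d) s)"
  proof (rule wp_While_rule[where I = "\<lambda>i. node_inv d (2 ^ d + i)"])
    show "node_inv d (2 ^ d + 0) s1" using inv by simp
  next
    fix i s assume i: "i < 2 ^ d" and s: "node_inv d (2 ^ d + i) s"
    have c: "drop_bit d (2 ^ d + i) < 2" using i shift_less_two[of d "2 ^ d + i"] by simp
    have "wp w node_prog s (\<lambda>t s'. t \<le> ?T i \<and> node_inv d (Suc (2 ^ d + i)) s')"
      by (rule node_prog[OF s]) (use i d in auto)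
    then show "eval w ?c s \<noteq> 0 \<and> wp w node_prog s (\<lambda>t s'. t \<le> ?T i \<and> node_inv d (2 ^ d + Suc i) s')"
      using s c two_less by (simp add: node_inv_def level_ready_def)
  next
    fix s assume "node_inv d (2 ^ d + 2 ^ d) s"
    then show "eval w ?c s = 0"
      using shift_less_two[of d "2 ^ d + 2 ^ d"] two_less by (simp add: node_inv_def level_ready_def)
  qed
  have "(\<Sum>i<2 ^ d. length (node (2 ^ d + i))) = length (level d)"
  proof -
    have "length (level d) = (\<Sum>u\<in>{2 ^ d..<2 ^ d + 2 ^ d}. length (node u))"
      by (simp add: level_def prefix_def length_concat o_def sum_list_distinct_conv_sum_set mult_2)
    also have "\<dots> = (\<Sum>i<2 ^ d. length (node (2 ^ d + i)))"
      using sum.shift_bounds_nat_ivl[of "\<lambda>u. length (node u)" 0 "2 ^ d" "2 ^ d"]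
      by (simp add: lessThan_atLeast0 add.commute)
    finally show ?thesis by simp
  qed
  then have "(\<Sum>i<2 ^ d. length (node (2 ^ d + i)) div chunk) \<le> n div chunk"
    using sum_div_le[of "\<lambda>i. length (node (2 ^ d + i))" chunk "{..<2 ^ d}"] length_level[of d] d by simp
  then have "(\<Sum>i<2 ^ d. ?T i) \<le> 1200 * (n div chunk) + 2700 * 2 ^ d"
    by (simp add: sum.distrib flip: sum_distrib_left)
  moreover have "(1::nat) \<le> 2 ^ d" by simp
  moreover have "(2 ^ d + 1) * (cost ?c + 1) = 6 * 2 ^ d + 6" by simp
  ultimately have "(\<Sum>i<2 ^ d. ?T i) + (2 ^ d + 1) * (cost ?c + 1) + 9 \<le> 1200 * (n div chunk) + 2730 * 2 ^ d"
    by linarith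
  then have "wp w (While ?c node_prog) s1 (\<lambda>t s. t + 9 \<le> 1200 * (n div chunk) + 2730 * 2 ^ d \<and>
      node_inv d (2 ^ d + 2 ^ d) s)"
    by (intro wp_mono[OF loop], elim conjE, intro conjI) (linarith, assumption)
  moreover have "2 ^ d + 2 ^ d = (2::nat) ^ Suc d" by simp
  ultimately have "wp w (While ?c node_prog) s1 (\<lambda>t s. t + 9 \<le> 1200 * (n div chunk) + 2730 * 2 ^ d \<and>
      node_inv d (2 ^ Suc d) s)"
    by (simp only:)
  then show ?thesis
    unfolding nodes_prog_def wp_simps by (simp add: s1_def) (erule wp_mono, auto)
qed

lemma copy_prog:
  assumes st: "constants st" "stream w (mem st 4) 0 (digits d (level d))" and d: "d < k"
  shows "wp w copy_prog st (\<lambda>t s'. t \<le> 400 * (n div chunk) + 840 \<and>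
    stream w (mem s' 3) 0 (digits d (level d)))"
proof -
  define s1 where "s1 = st\<lparr>mem := (mem st)(3 := (mem st 3)(0 := 0)),
    reg := (reg st)(r_i := 0, r_end := n, r_step := chunk, r_j := 0, r_base := 0, r_unit := width)\<rparr>"
  have c: "reg st r_w = w" "reg st r_width = width" "reg st 0 = n" "reg st r_chunk = chunk"
    using st by (simp_all add: constants_def)
  have len: "length (level d) = n" using length_level d by simp
  have "wp w (pass_prog 3 (read_exp 4) (Reg r_len)) s1 (\<lambda>t s'. t \<le> 400 * (length (level d) div chunk + 2) \<and>
    reg s' r_j * width = length ([] @ digits d (level d)) \<and>
    stream w (mem s' 3) 0 ([] @ digits d (level d)) \<and> (\<forall>q<0. mem s' 3 q = mem s1 3 q))"
  proof (rule pass_prog[where M = n and m = chunk and ?i0.0 = 0])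
    fix s y e
    assume s: "agree (pass_prog 3 (read_exp 4) (Reg r_len)) s1 s" "reg s r_i = 0 + y" "reg s r_len = e"
      "e \<le> chunk" "y + e \<le> length (level d)"
    have e: "e * width < w"
      using mult_le_mono1[OF s(4)] chunk_width_less(1) by (rule le_less_trans)
    have "eval w (read_exp 4) s = val (take (reg s r_len * width) (drop (reg s r_i * width) (digits d (level d))))"
      by (rule read_exp[where L = "digits d (level d)"])
        (use s st c w_ge w_width_less stream_fits e len in \<open>simp_all add: agree_def s1_def flip: add_mult_distrib\<close>)
    then show "eval w (read_exp 4) s = val (digits d (take e (drop y (level d)))) \<and>
      eval w (Reg r_len) (s\<lparr>reg := (reg s)(r_val := val (digits d (take e (drop y (level d)))))\<rparr>) * width =
        length (digits d (take e (drop y (level d)))) \<and> length (digits d (take e (drop y (level d)))) \<le> w"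
      using s e by (simp add: take_concat_digits drop_concat_digits)
  qed (use c w_ge w_width_less width_pos chunk_pos stream_fits len in \<open>simp_all add: s1_def stream_Nil\<close>)
  then show ?thesis
    using c len by (simp add: copy_prog_def setup_prog_def wp_simps s1_def) (erule wp_mono, auto)
qed

lemma per_word: "0 < w div k" "w div k * k \<le> w"
  using k_less k by (auto simp: div_greater_zero_iff)

text \<open>Input words are appended whole, without splitting them into characters; the time is
  therefore proportional to their number and not to \<open>n\<close>.\<close>

lemma unpack_prog:
  assumes st: "constants st" and wd: "width = k"
  shows "wp w unpack_prog st (\<lambda>t s'. t \<le> 400 * (n div (w div k)) + 840 \<and>
    stream w (mem s' 4) 0 (concat (map (digit 0 k) s)))"
proof -
  define p where "p = w div k"
  have p: "0 < p" "p * k \<le> w" using per_word by (simp_all add: p_def)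
  define s1 where "s1 = st\<lparr>mem := (mem st)(4 := (mem st 4)(0 := 0)),
    reg := (reg st)(r_i := 0, r_end := n, r_step := p, r_j := 0, r_base := 0, r_unit := k)\<rparr>"
  have c: "reg st r_w = w" "reg st r_width = k" "reg st 0 = n" "reg st r_per_word = p" "mem st 0 = packed w k s"
    using st wd by (simp_all add: constants_def p_def)
  have len: "length s = n" by (simp add: n_def)
  let ?ev = "Load 0 (Reg r_i div\<^sub>e Reg r_per_word)" and ?D = "\<lambda>xs. concat (map (digit 0 k) xs)"
  have "wp w (pass_prog 4 ?ev (Reg r_len)) s1 (\<lambda>t s'. t \<le> 400 * (length s div p + 2) \<and>
    reg s' r_j * k = length ([] @ ?D s) \<and>
    stream w (mem s' 4) 0 ([] @ ?D s) \<and> (\<forall>q<0. mem s' 4 q = mem s1 4 q))"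
  proof (rule pass_prog[where M = n and m = p and ?i0.0 = 0])
    fix s' y e
    assume s': "agree (pass_prog 4 ?ev (Reg r_len)) s1 s'" "reg s' r_i = 0 + y" "reg s' r_len = e"
      "e \<le> p" "y + e \<le> length s" "y mod p = 0" "y + e = length s \<or> e = p"
    have y: "p * (y div p) = y" using s'(6) mult_div_mod_eq[of p y] by simp
    \<comment> \<open>Only the last chunk can have fewer than \<open>p\<close> characters, and there
      the input ends as well; so each chunk is exactly one input word.\<close>
    have "take p (drop y s) = take e (drop y s)" using s'(4,7) by auto
    moreover have "eval w ?ev s' = packed w k s (y div p)"
      using s'(1,2) c by (simp add: agree_def s1_def)
    ultimately have "eval w ?ev s' = val (?D (take e (drop y s)))"
      using packed_eq_val[OF alphabet, of w "y div p"] y by (simp add: p_def)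
    moreover have "e * k \<le> w" using s'(4) p(2) by (meson mult_le_mono1 order_trans)
    ultimately show "eval w ?ev s' = val (?D (take e (drop y s))) \<and>
      eval w (Reg r_len) (s'\<lparr>reg := (reg s')(r_val := val (?D (take e (drop y s))))\<rparr>) * k =
        length (?D (take e (drop y s))) \<and> length (?D (take e (drop y s))) \<le> w"
      using s' by simp
  qed (use c w_ge w_width_less k stream_fits len p wd in \<open>simp_all add: s1_def stream_Nil\<close>)
  then show ?thesis
    using c len by (simp add: unpack_prog_def setup_prog_def wp_simps s1_def p_def) (erule wp_mono, auto)
qed

lemma pack_prog:
  assumes st: "constants st" and d: "d < k"
    and F: "\<forall>i<n. mem st 11 i = val (digit (shift d) width (level d ! i))"
  shows "wp w pack_prog st (\<lambda>t s'. t \<le> 400 * n + 840 \<and> stream w (mem s' 4) 0 (digits d (level d)))"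
proof -
  define s1 where "s1 = st\<lparr>mem := (mem st)(4 := (mem st 4)(0 := 0)),
    reg := (reg st)(r_i := 0, r_end := n, r_step := 1, r_j := 0, r_base := 0, r_unit := width)\<rparr>"
  have c: "reg st r_w = w" "reg st r_width = width" "reg st 0 = n"
    using st by (simp_all add: constants_def)
  have len: "length (level d) = n" using length_level d by simp
  have "wp w (pass_prog 4 (Load 11 (Reg r_i)) (Const 1)) s1 (\<lambda>t s'. t \<le> 400 * (length (level d) div 1 + 2) \<and>
    reg s' r_j * width = length ([] @ digits d (level d)) \<and>
    stream w (mem s' 4) 0 ([] @ digits d (level d)) \<and> (\<forall>q<0. mem s' 4 q = mem s1 4 q))"
  proof (rule pass_prog[where M = n and ?i0.0 = 0])
    fix s y e
    assume s: "agree (pass_prog 4 (Load 11 (Reg r_i)) (Const 1)) s1 s" "reg s r_i = 0 + y" "0 < e"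
      "e \<le> 1" "y + e \<le> length (level d)"
    have e: "take e (drop y (level d)) = [level d ! y]" "y < n"
      using s(3-5) len by (auto simp: Cons_nth_drop_Suc[symmetric] le_Suc_eq)
    have "mem s 11 = mem st 11" using s(1) by (simp add: agree_def s1_def)
    then show "eval w (Load 11 (Reg r_i)) s = val (digits d (take e (drop y (level d)))) \<and>
      eval w (Const 1) (s\<lparr>reg := (reg s)(r_val := val (digits d (take e (drop y (level d)))))\<rparr>) * width =
        length (digits d (take e (drop y (level d)))) \<and> length (digits d (take e (drop y (level d)))) \<le> w"
      unfolding e using s(2) F e(2) two_less width_pos k_less by simp
  qed (use c w_ge w_width_less width_pos stream_fits len in \<open>simp_all add: s1_def stream_Nil\<close>)
  then show ?thesis
    using c len two_less w_ge by (simp add: pack_prog_def setup_prog_def wp_simps s1_def) (erule wp_mono, auto)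
qed

lemma offsets_prog:
  assumes st: "constants st" "reg st r_depth = d" "counts (2 ^ Suc d) st" and d: "d < k"
  shows "wp w offsets_prog st (\<lambda>t s'. t \<le> 40 * 2 ^ d \<and>
    (\<forall>u. 2 ^ d \<le> u \<and> u < 2 ^ Suc d \<longrightarrow> mem s' 10 u = length (prefix d u)))"
proof -
  let ?c = "(Reg r_y >>\<^sub>e Reg r_depth) <\<^sub>e Const 2"
  define body where "body = Store 10 (Reg r_y) (Reg r_x) ;; Assign r_x (Reg r_x +\<^sub>e Load 9 (Reg r_y)) ;;
        Assign r_y (Reg r_y +\<^sub>e Const 1)"
  define s1 where "s1 = st\<lparr>reg := (reg st)(r_x := 0, r_y := 2 ^ d)\<rparr>"
  define I where "I i s' \<longleftrightarrow> reg s' r_y = 2 ^ d + i \<and> reg s' r_x = length (prefix d (2 ^ d + i)) \<and>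
    (\<forall>u. 2 ^ d \<le> u \<and> u < 2 ^ d + i \<longrightarrow> mem s' 10 u = length (prefix d u))" for i and s' :: state
  have "(2::nat) ^ Suc d \<le> 2 ^ k" using d by (intro power_increasing) simp_all
  then have big: "2 ^ Suc d < (2::nat) ^ w" using two_n_less size unfolding n_def by linarith
  have loop: "wp w (While ?c body) s1 (\<lambda>t s. t \<le> (\<Sum>i<(2::nat) ^ d. 20) + (2 ^ d + 1) * (cost ?c + 1) \<and> I (2 ^ d) s)"
  proof (rule wp_While_rule)
    show "I 0 s1" by (simp add: I_def s1_def)
  next
    fix i s assume i: "i < 2 ^ d" and s: "I i s" and ag: "agree (While ?c body) s1 s"
    have c: "drop_bit d (2 ^ d + i) < 2" using i shift_less_two[of d "2 ^ d + i"] by simp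
    have r: "reg s r_depth = d" "mem s 9 = mem st 9" using ag st by (simp_all add: agree_def s1_def body_def)
    have cn: "mem st 9 (2 ^ d + i) = length (node (2 ^ d + i))"
      using st(3) i by (auto simp: counts_def intro: order_trans[of "Suc 0" "2 ^ d"])
    have "length (prefix d (2 ^ d + i)) + length (node (2 ^ d + i)) < 2 ^ w"
      using length_prefix_le[of "2 ^ d + i" d] i d stream_fits by simp
    moreover have "Suc (2 ^ d + i) < 2 ^ w" using i big by simp
    ultimately show "eval w ?c s \<noteq> 0 \<and> wp w body s (\<lambda>t s'. t \<le> 20 \<and> I (Suc i) s')"
      using s c two_less w_ge r cn by (simp add: body_def wp_simps I_def prefix_Suc less_Suc_eq)
  next
    fix s assume "I (2 ^ d) s" "agree (While ?c body) s1 s"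
    then show "eval w ?c s = 0"
      using shift_less_two[of d "2 ^ d + 2 ^ d"] two_less st by (simp add: I_def agree_def s1_def body_def)
  qed
  have "(1::nat) \<le> 2 ^ d" by simp
  moreover have "(2 ^ d + 1) * (cost ?c + 1) = 6 * 2 ^ d + 6" "(\<Sum>i<(2::nat) ^ d. 20) = 20 * (2::nat) ^ d" by simp_all
  ultimately have "(\<Sum>i<(2::nat) ^ d. 20) + (2 ^ d + 1) * (cost ?c + 1) + 6 \<le> 40 * 2 ^ d"
    by linarith
  moreover have "(2::nat) ^ d < 2 ^ w" "2 ^ d + 2 ^ d = (2::nat) ^ Suc d" using big unfolding power_Suc by linarith+
  moreover have prog: "offsets_prog = Assign r_x (Const 0) ;; Assign r_y (Const 1 <<\<^sub>e Reg r_depth) ;; While ?c body"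
    by (simp only: offsets_prog_def body_def)
  ultimately show ?thesis
    using loop st(2) two_less w_ge unfolding prog
    by (simp add: wp_simps s1_def push_bit_eq_mult) (erule wp_mono, auto simp: I_def)
qed

section \<open>Positions within a level and the counting sort\<close>

lemma node_nth:
  assumes "2 ^ d \<le> u" "u < 2 ^ Suc d" "j < length (node u)"
  shows "level d ! (length (prefix d u) + j) = node u ! j"
proof -
  let ?D = "drop (length (prefix d u)) (level d)"
  have t: "take (length (node u)) ?D = node u" by (rule take_drop_level[OF assms(2,1)])
  then have "length (node u) \<le> length ?D" by (metis length_take min.cobounded1)
  then have "j < length ?D" using assms(3) by linarith
  then have "level d ! (length (prefix d u) + j) = ?D ! j" by simp
  also have "\<dots> = take (length (node u)) ?D ! j" using assms(3) by simp
  finally show ?thesis unfolding t .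
qed

text \<open>Turns what the sort guarantees for each node into a statement about each position of the
  level.\<close>

lemma index_of_level:
  assumes "i < length (prefix d v)" "2 ^ d \<le> v"
  shows "\<exists>u j. 2 ^ d \<le> u \<and> u < v \<and> j < length (node u) \<and> i = length (prefix d u) + j"
  using assms(2,1)
proof (induction v rule: dec_induct)
  case base
  then show ?case by simp
next
  case (step v)
  show ?case
  proof (cases "i < length (prefix d v)")
    case True
    then show ?thesis using step.IH less_Suc_eq by blast
  next
    case False
    then have "i - length (prefix d v) < length (node v) \<and> i = length (prefix d v) + (i - length (prefix d v))"
      using step by (simp add: prefix_Suc)
    then show ?thesis using step.hyps by blast
  qed
qed

text \<open>This keeps the writes of the counting sort for different nodes apart.\<close>

lemma prefix_disjoint:
  assumes "2 ^ d \<le> u" "u < v"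
  shows "length (prefix d u) + length (node u) \<le> length (prefix d v)"
proof -
  have "prefix d v = prefix d (Suc u) @ concat (map node [Suc u..<v])"
    using assms upt_add_eq_append[of "2 ^ d" "Suc u" "v - Suc u"] by (simp add: prefix_def del: upt_Suc)
  then show ?thesis using prefix_Suc[OF assms(1)] by simp
qed

text \<open>After \<open>i\<close> characters the cursor of \<open>u\<close> has advanced by
  \<open>length (part i u)\<close>. Scanning in input order sends the j-th character of a node to
  its j-th cell, so the sort is stable.\<close>

lemma scatter_prog:
  assumes st: "constants st" "reg st r_depth = d" "reg st r_shift = shift d" and d: "d < k"
    and off: "\<forall>u. 2 ^ d \<le> u \<and> u < 2 ^ Suc d \<longrightarrow> mem st 10 u = length (prefix d u)"
  shows "wp w scatter_prog st (\<lambda>t s'. t \<le> 80 * n + 20 \<and>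
    (\<forall>i<n. mem s' 11 i = val (digit (shift d) width (level d ! i))))"
proof -
  define p where "p = w div k"
  have p: "0 < p" "p * k \<le> w" using per_word by (simp_all add: p_def)
  define anc where "anc c = drop_bit (k - d) (2 ^ k + c)" for c :: nat
  define part where "part i u = filter (\<lambda>c. anc c = u) (take i s)" for i u
  let ?ex = "(Load 0 (Reg r_i div\<^sub>e Reg r_per_word) >>\<^sub>e (Reg r_i mod\<^sub>e Reg r_per_word *\<^sub>e Reg r_k)) &\<^sub>e
          mask_exp (Reg r_k)"
  let ?ey = "(Reg 1 +\<^sub>e Reg r_x) >>\<^sub>e (Reg r_k -\<^sub>e Reg r_depth)"
  let ?ed = "(Reg r_x >>\<^sub>e Reg r_shift) &\<^sub>e mask_exp (Reg r_width)"
  define body where "body = Assign r_x ?ex ;; Assign r_y ?ey ;;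
        Store 11 (Load 10 (Reg r_y)) ?ed ;;
        Store 10 (Reg r_y) (Load 10 (Reg r_y) +\<^sub>e Const 1) ;;
        Assign r_i (Reg r_i +\<^sub>e Const 1)"
  define s1 where "s1 = st\<lparr>reg := (reg st)(r_i := 0)\<rparr>"
  define I where "I i s' \<longleftrightarrow> reg s' r_i = i \<and>
    (\<forall>u. 2 ^ d \<le> u \<and> u < 2 ^ Suc d \<longrightarrow> mem s' 10 u = length (prefix d u) + length (part i u) \<and>
      (\<forall>j < length (part i u). mem s' 11 (length (prefix d u) + j) = val (digit (shift d) width (node u ! j))))"
    for i and s' :: state
  have len: "length s = n" by (simp add: n_def)
  have nd: "node u = filter (\<lambda>c. anc c = u) s" if "2 ^ d \<le> u" "u < 2 ^ Suc d" for u
    using node_eq[OF that] d by (simp add: anc_def)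
  have sz: "2 ^ k \<le> n" using size by (simp add: n_def)
  have loop: "wp w (While (Reg r_i <\<^sub>e Reg 0) body) s1 (\<lambda>t s. t \<le> (\<Sum>i<n. 70) + (n + 1) * (cost (Reg r_i <\<^sub>e Reg 0) + 1) \<and> I n s)"
  proof (rule wp_While_rule)
    show "I 0 s1" using off by (simp add: I_def s1_def part_def)
  next
    fix s' assume "I n s'" "agree (While (Reg r_i <\<^sub>e Reg 0) body) s1 s'"
    then show "eval w (Reg r_i <\<^sub>e Reg 0) s' = 0"
      using st by (simp add: I_def agree_def s1_def body_def constants_def)
  next
    fix i s' assume i: "i < n" and I: "I i s'" and ag: "agree (While (Reg r_i <\<^sub>e Reg 0) body) s1 s'"
    define c u where "c = s ! i" and "u = anc c"
    have r: "reg s' 0 = n" "reg s' 1 = 2 ^ k" "reg s' r_w = w" "reg s' r_k = k" "reg s' r_width = width"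
      "reg s' r_per_word = p" "reg s' r_depth = d" "reg s' r_shift = shift d" "mem s' 0 = packed w k s" "reg s' r_i = i"
      using ag st I by (simp_all add: agree_def s1_def body_def constants_def p_def I_def)
    have cs: "c \<in> set s" using i len by (simp add: c_def)
    then have c: "c < 2 ^ k" using alphabet by auto
    have "2 ^ d * 2 ^ (k - d) = (2::nat) ^ k" using d by (simp flip: power_add)
    then have u: "2 ^ d \<le> u" "u < 2 ^ Suc d"
      using c d by (auto simp: u_def anc_def drop_bit_eq_div less_eq_div_iff_mult_less_eq div_less_iff_less_mult mult.assoc)
    have m: "i mod p < p" using p by simp
    \<comment> \<open>Character \<open>i\<close> is entry \<open>i mod p\<close> of input word
      \<open>i div p\<close>.\<close>
    have "take 1 (drop (i mod p) (take p (drop (p * (i div p)) s))) = take 1 (drop i s)"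
      using m by (simp add: drop_take)
    also have "\<dots> = [c]" using i len by (simp add: c_def Cons_nth_drop_Suc[symmetric])
    finally have tk: "take 1 (drop (i mod p) (take p (drop (p * (i div p)) s))) = [c]" .
    have "packed w k s (i div p) = val (concat (map (digit 0 k) (take p (drop (p * (i div p)) s))))"
      using packed_eq_val[OF alphabet] by (simp add: p_def)
    then have "and (drop_bit (i mod p * k) (packed w k s (i div p))) (mask k) =
        val (take (1 * k) (drop (i mod p * k) (concat (map (digit 0 k) (take p (drop (p * (i div p)) s))))))"
      by (simp add: val_window)
    also have "\<dots> = val (digit 0 k c)"
      unfolding take_concat_digits drop_concat_digits tk by simp
    also have "\<dots> = c" using c by (simp add: val_digit_eq take_bit_nat_eq_self)
    finally have x: "and (drop_bit (i mod p * k) (packed w k s (i div p))) (mask k) = c" .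
    have "i mod p * k \<le> p * k" using m by simp
    then have mk: "i mod p * k < 2 ^ w" using p less_exp[of w] by linarith
    have ex: "eval w ?ex s' = c"
      using x mk eval_mask_exp[of w "Reg r_k" s'] r k_less by simp
    have ey: "eval w ?ey s'' = u" if "reg s'' = (reg s')(r_x := c)" for s''
      using that r c sz two_n_less d sub_mod_eq[of d k w] k_less less_exp[of w]
      by (simp add: u_def anc_def)
    have ed: "eval w ?ed s'' = val (digit (shift d) width c)" if "reg s'' = (reg s')(r_x := c, r_y := u)" for s''
      using that r eval_mask_exp[of w "Reg r_width" s''] width_pos k_less
      by (simp add: val_digit_eq take_bit_eq_mask)
    have P: "part (Suc i) v = part i v @ (if v = u then [c] else [])" for v
      using i len by (auto simp: part_def take_Suc_conv_app_nth u_def c_def)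
    \<comment> \<open>The characters of a node seen so far, the current one if it belongs there, and
      those to come. Hence the current character has index \<open>length (part i u)\<close> in its
      node.\<close>
    have split: "node v = part i v @ (if v = u then [c] else []) @ filter (\<lambda>c. anc c = v) (drop (Suc i) s)"
      if "2 ^ d \<le> v" "v < 2 ^ Suc d" for v
    proof -
      have "node v = part (Suc i) v @ filter (\<lambda>c. anc c = v) (drop (Suc i) s)"
        unfolding nd[OF that] part_def by (metis append_take_drop_id filter_append)
      then show ?thesis using P[of v] by simp
    qed
    define x where "x = length (prefix d u) + length (part i u)"
    have m10: "mem s' 10 u = x" using I u by (simp add: I_def x_def)
    have "length (part i u) < length (node u)" using split[OF u] by simp
    then have xn: "x < n" using length_prefix_le[OF u(2,1)] d by (simp add: x_def)
    then have x1: "Suc x < 2 ^ w" "Suc i < 2 ^ w" using i two_n_less by simp_all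
    \<comment> \<open>The cell about to be written is none of those already filled, neither in the
      same node nor in another one.\<close>
    have other: "length (prefix d v) + j \<noteq> x" if "2 ^ d \<le> v" "v < 2 ^ Suc d" "j < length (part i v)" for v j
    proof -
      have j: "j < length (node v)" using that(3) split[OF that(1,2)] by simp
      have lu: "length (part i u) < length (node u)" by fact
      consider "v = u" | "v < u" | "u < v" by linarith
      then show ?thesis
      proof cases
        case 1
        then show ?thesis using that(3) by (simp add: x_def)
      next
        case 2
        then show ?thesis using prefix_disjoint[OF that(1) 2] j by (simp add: x_def)
      next
        case 3
        then show ?thesis using prefix_disjoint[OF u(1) 3] lu by (simp add: x_def)
      qed
    qed
    have fin: "I (Suc i) s''" if s'': "reg s'' r_i = Suc i" "mem s'' 10 = (mem s' 10)(u := Suc x)"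
      "mem s'' 11 = (mem s' 11)(x := val (digit (shift d) width c))" for s''
      unfolding I_def
    proof (intro conjI allI impI)
      show "reg s'' r_i = Suc i" by fact
    next
      fix v :: nat assume v: "2 ^ d \<le> v \<and> v < 2 ^ Suc d"
      then show "mem s'' 10 v = length (prefix d v) + length (part (Suc i) v)"
        using I by (simp add: s'' P I_def x_def)
      fix j assume j: "j < length (part (Suc i) v)"
      show "mem s'' 11 (length (prefix d v) + j) = val (digit (shift d) width (node v ! j))"
      proof (cases "j < length (part i v)")
        case True
        then show ?thesis using I other[of v j] v by (simp add: s'' I_def)
      next
        case False
        then have "v = u" "j = length (part i u)" using j by (auto simp: P split: if_splits)
        then show ?thesis using split[OF u] by (simp add: s'' x_def nth_append)
      qed
    qed
    have "wp w body s' (\<lambda>t s'. t \<le> 70 \<and> I (Suc i) s')"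
      unfolding body_def wp_simps ex
      apply (subst ey, simp)+
      apply (subst ed, simp)+
      apply (rule conjI)
       apply simp
      apply (rule fin)
        apply (use x1 two_less w_ge r m10 in simp_all)
      done
    then show "eval w (Reg r_i <\<^sub>e Reg 0) s' \<noteq> 0 \<and> wp w body s' (\<lambda>t s'. t \<le> 70 \<and> I (Suc i) s')"
      using r i by simp
  qed
  have all: "\<forall>i<n. mem s' 11 i = val (digit (shift d) width (level d ! i))" if "I n s'" for s'
  proof (intro allI impI)
    fix i assume "i < n"
    then obtain u j where u: "2 ^ d \<le> u" "u < 2 ^ Suc d" "j < length (node u)" "i = length (prefix d u) + j"
      using index_of_level[of i d "2 ^ Suc d"] length_level[of d] d by (auto simp: level_def)
    moreover have "part n u = node u" using nd[OF u(1,2)] by (simp add: part_def n_def)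
    ultimately show "mem s' 11 i = val (digit (shift d) width (level d ! i))"
      using that node_nth[OF u(1-3)] by (simp add: I_def)
  qed
  have prog: "scatter_prog = Assign r_i (Const 0) ;; While (Reg r_i <\<^sub>e Reg 0) body"
    by (simp only: scatter_prog_def body_def)
  show ?thesis
    using loop unfolding prog by (simp add: wp_simps s1_def) (erule wp_mono, auto simp: all)
qed

end

text \<open>Subtraction of machine words wraps around, while \<open>shift\<close> relies on
  truncated subtraction; the first test makes up for the difference.\<close>

definition build_prog :: com where
  "build_prog =
     If (Reg r_depth +\<^sub>e Reg r_width <\<^sub>e Reg r_k)
       (Assign r_shift (Reg r_k -\<^sub>e (Reg r_depth +\<^sub>e Reg r_width))) (Assign r_shift (Const 0)) ;;
     If (Reg r_chunk <\<^sub>e Reg r_k) (offsets_prog ;; scatter_prog ;; pack_prog) unpack_prog"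

definition level_prog :: com where
  "level_prog =
     If (Reg r_depth mod\<^sub>e Reg r_width) Skip build_prog ;;
     copy_prog ;;
     Assign r_bit (Reg r_k -\<^sub>e Const 1 -\<^sub>e Reg r_depth -\<^sub>e Reg r_shift) ;;
     table_prog ;;
     nodes_prog ;;
     Assign r_depth (Reg r_depth +\<^sub>e Const 1)"

lemma written_build_prog [simp]:
  "written_regs build_prog = {r_shift, r_x, r_y, r_i, r_end, r_step, r_len, r_val, r_cnt, r_t, r_q, r_r, r_j, r_base, r_unit}"
  "written_arrays build_prog = {4, 10, 11}"
  by (auto simp: build_prog_def)

context wavelet
begin

lemma constants_agree:
  assumes "constants st" "\<forall>r \<in> {0, 1, 2, 3, 4, 5, 25}. reg st' r = reg st r" "mem st' 0 = mem st 0"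
  shows "constants st'"
  using assms by (simp add: constants_def)

definition build_cost :: nat where
  "build_cost = (if k \<le> chunk then 400 * (n div chunk) + 900 else 1000 * n)"

lemma build_prog:
  assumes st: "constants st" "reg st r_depth = d" "counts (2 ^ Suc d) st" and d: "d < k" "d mod width = 0"
  shows "wp w build_prog st (\<lambda>t s'. t \<le> build_cost \<and> reg s' r_shift = shift d \<and>
    stream w (mem s' 4) 0 (digits d (level d)))"
proof -
  define s1 where "s1 = st\<lparr>reg := (reg st)(r_shift := shift d)\<rparr>"
  have c1: "constants s1" by (rule constants_agree[OF st(1)]) (auto simp: s1_def)
  have r: "reg st r_k = k" "reg st r_width = width" "reg st r_chunk = chunk"
    using st by (simp_all add: constants_def)
  have "d + width \<le> 2 * w" using d k_less width_pos by simp
  moreover have "2 * w < 2 ^ w"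
  proof -
    have "w = Suc (w - 1)" using w_ge by simp
    moreover have "w - 1 \<ge> 2" using w_ge by simp
    moreover have "Suc m < 2 ^ m" if "m \<ge> 2" for m :: nat using that by (induction m rule: dec_induct) auto
    ultimately have "w < 2 ^ (w - 1)" by metis
    then show ?thesis using power_Suc[of "2::nat" "w - 1"] w_ge by simp
  qed
  ultimately have dw: "d + width < 2 ^ w" by simp
  have kw: "k < 2 ^ w" using k_less less_exp[of w] by linarith
  have sh: "shift d = k - (d + width)" using d by (simp add: shift_def)
  have A: "wp w (If (Reg r_depth +\<^sub>e Reg r_width <\<^sub>e Reg r_k)
       (Assign r_shift (Reg r_k -\<^sub>e (Reg r_depth +\<^sub>e Reg r_width))) (Assign r_shift (Const 0))) st
       (\<lambda>t s'. t \<le> 20 \<and> s' = s1)"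
    using r st(2) dw kw sub_mod_eq[of "d + width" k w] sh by (simp add: wp_simps s1_def)
  have B: "wp w (If (Reg r_chunk <\<^sub>e Reg r_k) (offsets_prog ;; scatter_prog ;; pack_prog) unpack_prog) s1
       (\<lambda>t s'. t + 20 \<le> build_cost \<and> reg s' r_shift = shift d \<and> stream w (mem s' 4) 0 (digits d (level d)))"
  proof (cases "k \<le> chunk")
    case True
    then have wk: "width = k" by (simp add: width_def)
    \<comment> \<open>The only multiple of \<open>width = k\<close> below \<open>k\<close> is 0, so
      the unsorted input is already in the required order.\<close>
    then have "d = 0" "shift d = 0" using d sh by simp_all
    then have D: "concat (map (digit 0 k) s) = digits d (level d)" using wk by (simp add: level_0)
    \<comment> \<open>An input word holds at least \<open>chunk\<close> characters, so copying by
      input words is no slower than copying by chunks.\<close>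
    have "chunk * k \<le> w" using mult_le_mono2[OF True, of chunk] chunk_pos(2) by linarith
    then have "chunk \<le> w div k" using k by (simp add: less_eq_div_iff_mult_less_eq)
    then have "n div (w div k) \<le> n div chunk" using chunk_pos by (intro div_le_mono2) simp_all
    then have "wp w unpack_prog s1 (\<lambda>t s'. t + 30 \<le> build_cost \<and> reg s' r_shift = shift d \<and>
        stream w (mem s' 4) 0 (digits d (level d)))"
      by (intro wp_mono_agree[OF unpack_prog[OF c1 wk]])
        (use True in \<open>auto simp: D build_cost_def agree_def s1_def\<close>)
    then show ?thesis
      using True r by (simp add: wp_simps s1_def) (erule wp_mono, auto)
  next
    case False
    have "counts (2 ^ Suc d) s1" using st(3) by (simp add: counts_def s1_def)
    then have o: "wp w offsets_prog s1 (\<lambda>t s'. t \<le> 40 * 2 ^ d \<and>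
      (\<forall>u. 2 ^ d \<le> u \<and> u < 2 ^ Suc d \<longrightarrow> mem s' 10 u = length (prefix d u)))"
      by (intro offsets_prog) (use c1 st d in \<open>auto simp: s1_def\<close>)
    have "(2::nat) ^ d \<le> 2 ^ k" using d by (intro power_increasing) simp_all
    then have dn: "2 ^ d \<le> n" using size unfolding n_def by (rule order_trans)
    have "wp w (offsets_prog ;; scatter_prog ;; pack_prog) s1
      (\<lambda>t s'. t \<le> 520 * n + 860 \<and> stream w (mem s' 4) 0 (digits d (level d)))"
    proof (subst wp_Seq, rule wp_mono_agree[OF o])
      fix t :: nat and s2
      assume s2: "t \<le> 40 * 2 ^ d \<and> (\<forall>u. 2 ^ d \<le> u \<and> u < 2 ^ Suc d \<longrightarrow> mem s2 10 u = length (prefix d u))"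
        and ag: "agree offsets_prog s1 s2"
      have c2: "constants s2" by (rule constants_agree[OF c1]) (use ag in \<open>auto simp: agree_def\<close>)
      have sc: "wp w scatter_prog s2 (\<lambda>t s'. t \<le> 80 * n + 20 \<and>
        (\<forall>i<n. mem s' 11 i = val (digit (shift d) width (level d ! i))))"
        by (rule scatter_prog) (use c2 s2 ag st d in \<open>auto simp: agree_def s1_def\<close>)
      show "wp w (scatter_prog ;; pack_prog) s2
        (\<lambda>t' s'. t + t' \<le> 520 * n + 860 \<and> stream w (mem s' 4) 0 (digits d (level d)))"
      proof (subst wp_Seq, rule wp_mono_agree[OF sc])
        fix t' :: nat and s3
        assume s3: "t' \<le> 80 * n + 20 \<and> (\<forall>i<n. mem s3 11 i = val (digit (shift d) width (level d ! i)))"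
          and ag3: "agree scatter_prog s2 s3"
        have c3: "constants s3" by (rule constants_agree[OF c2]) (use ag3 in \<open>auto simp: agree_def\<close>)
        show "wp w pack_prog s3
          (\<lambda>t'' s'. t + (t' + t'') \<le> 520 * n + 860 \<and> stream w (mem s' 4) 0 (digits d (level d)))"
          by (rule wp_mono[OF pack_prog[OF c3 d(1)]]) (use s2 s3 dn in auto)
      qed
    qed
    then have "wp w (offsets_prog ;; scatter_prog ;; pack_prog) s1
      (\<lambda>t s'. t + 30 \<le> build_cost \<and> reg s' r_shift = shift d \<and> stream w (mem s' 4) 0 (digits d (level d)))"
      by (rule wp_mono_agree) (use False n_pos in \<open>auto simp: build_cost_def agree_def s1_def\<close>)
    then show ?thesis
      using False r by (subst wp_If) (simp add: s1_def, erule wp_mono, auto)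
  qed
  show ?thesis
    unfolding build_prog_def by (subst wp_Seq, rule wp_mono[OF A]) (use B in \<open>auto elim!: wp_mono\<close>)
qed

text \<open>At the start of a group nothing is demanded of the stream, because it will be rebuilt
  from the input.\<close>

definition level_inv :: "nat \<Rightarrow> state \<Rightarrow> bool" where
  "level_inv d st \<longleftrightarrow> constants st \<and> reg st r_depth = d \<and>
     (d mod width \<noteq> 0 \<longrightarrow> reg st r_shift = shift d \<and> stream w (mem st 4) 0 (digits d (level d))) \<and>
     reg st r_node = 2 ^ d \<and> reg st r_out = out_pos (2 ^ d) \<and> outputs (2 ^ d) st \<and> counts (2 ^ Suc d) st"

text \<open>Within a group the digits consist of the same bits, so the stream written for the
  children is the one that the next level expects.\<close>

lemma shift_Suc: "Suc d mod width \<noteq> 0 \<Longrightarrow> shift (Suc d) = shift d"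
  by (auto simp: shift_def mod_Suc split: if_splits)

definition level_cost :: "nat \<Rightarrow> nat" where
  "level_cost d = (if d mod width = 0 then build_cost else 0) + 1600 * (n div chunk) + 2730 * 2 ^ d +
     100 * 2 ^ (chunk * width) + 1000"

lemma level_prog:
  assumes inv: "level_inv d st" and d: "d < k"
  shows "wp w level_prog st (\<lambda>t s'. t \<le> level_cost d \<and> level_inv (Suc d) s')"
proof -
  let ?bc = "if d mod width = 0 then build_cost else 0"
  have I: "constants st" "reg st r_depth = d" "reg st r_node = 2 ^ d" "reg st r_out = out_pos (2 ^ d)"
    "outputs (2 ^ d) st" "counts (2 ^ Suc d) st" "reg st r_width = width"
    using inv by (simp_all add: level_inv_def constants_def)
  have 1: "wp w (If (Reg r_depth mod\<^sub>e Reg r_width) Skip build_prog) st (\<lambda>t s'. t \<le> ?bc + 10 \<and>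
    reg s' r_shift = shift d \<and> stream w (mem s' 4) 0 (digits d (level d)))"
  proof (cases "d mod width = 0")
    case True
    have "wp w build_prog st (\<lambda>t s'. t \<le> build_cost \<and> reg s' r_shift = shift d \<and>
        stream w (mem s' 4) 0 (digits d (level d)))"
      by (rule build_prog[OF I(1,2,6) d True])
    then show ?thesis using True I by (subst wp_If) (simp, erule wp_mono, auto)
  next
    case False
    then show ?thesis using inv I by (subst wp_If) (simp add: wp_simps level_inv_def)
  qed
  have 2: "wp w (Assign r_bit (Reg r_k -\<^sub>e Const 1 -\<^sub>e Reg r_depth -\<^sub>e Reg r_shift) ;; table_prog ;; nodes_prog ;;
      Assign r_depth (Reg r_depth +\<^sub>e Const 1)) s2
      (\<lambda>t s'. t \<le> 100 * 2 ^ (chunk * width) + 1200 * (n div chunk) + 2730 * 2 ^ d + 30 \<and> level_inv (Suc d) s')"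
    if s2: "constants s2" "reg s2 r_depth = d" "reg s2 r_shift = shift d" "stream w (mem s2 3) 0 (digits d (level d))"
      "reg s2 r_node = 2 ^ d" "reg s2 r_out = out_pos (2 ^ d)" "outputs (2 ^ d) s2" "counts (2 ^ Suc d) s2" for s2
  proof -
    define s3 where "s3 = s2\<lparr>reg := (reg s2)(r_bit := bitpos d)\<rparr>"
    have big: "k < 2 ^ w" "1 < (2::nat) ^ w" using k_less less_exp[of w] k by linarith+
    have e: "eval w (Reg r_k -\<^sub>e Const 1 -\<^sub>e Reg r_depth -\<^sub>e Reg r_shift) s2 = bitpos d"
    proof -
      have a: "eval w (Reg r_k -\<^sub>e Const 1) s2 = k - 1"
        by (subst eval_Sub) (use s2 big k in \<open>auto simp: constants_def\<close>)
      have b: "eval w (Reg r_k -\<^sub>e Const 1 -\<^sub>e Reg r_depth) s2 = k - 1 - d"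
        using eval_Sub[of w "Reg r_depth" s2 "Reg r_k -\<^sub>e Const 1"] s2 a d big unfolding a eval.simps(2) by simp
      show ?thesis
        using eval_Sub[of w "Reg r_shift" s2 "Reg r_k -\<^sub>e Const 1 -\<^sub>e Reg r_depth"] s2 bitpos(2)[OF d] big
        unfolding b eval.simps(2) by (simp add: bitpos_def)
    qed
    have c3: "constants s3" by (rule constants_agree[OF s2(1)]) (auto simp: s3_def)
    have t: "wp w table_prog s3 (\<lambda>t s. t \<le> 100 * 2 ^ (chunk * width) \<and>
        tables_upto width (bitpos d) (2 ^ (chunk * width)) s)"
      by (rule table_prog) (use c3 bitpos[OF d] chunk_width_less chunk_pos in \<open>auto simp: s3_def constants_def\<close>)
    have "wp w (table_prog ;; nodes_prog ;; Assign r_depth (Reg r_depth +\<^sub>e Const 1)) s3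
      (\<lambda>t s'. t \<le> 100 * 2 ^ (chunk * width) + 1200 * (n div chunk) + 2730 * 2 ^ d + 10 \<and> level_inv (Suc d) s')"
    proof (subst wp_Seq, rule wp_mono_agree[OF t])
      fix t :: nat and s4
      assume s4: "t \<le> 100 * 2 ^ (chunk * width) \<and> tables_upto width (bitpos d) (2 ^ (chunk * width)) s4"
        and ag: "agree table_prog s3 s4"
      have c4: "constants s4" by (rule constants_agree[OF c3]) (use ag in \<open>auto simp: agree_def\<close>)
      have nd: "wp w nodes_prog s4 (\<lambda>t s'. t \<le> 1200 * (n div chunk) + 2730 * 2 ^ d \<and> node_inv d (2 ^ Suc d) s')"
      proof (rule nodes_prog)
        show "level_ready d s4" using c4 s4 ag s2 by (simp add: level_ready_def agree_def s3_def)
        show "outputs (2 ^ d) s4"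
          by (rule outputs_cong[OF s2(7)]) (use ag in \<open>auto simp: agree_def s3_def\<close>)
        show "counts (2 ^ Suc d) s4"
          by (rule counts_cong[OF s2(8)]) (use ag in \<open>auto simp: agree_def s3_def\<close>)
      qed (use ag s2 d in \<open>auto simp: agree_def s3_def\<close>)
      show "wp w (nodes_prog ;; Assign r_depth (Reg r_depth +\<^sub>e Const 1)) s4 (\<lambda>t' s'.
          t + t' \<le> 100 * 2 ^ (chunk * width) + 1200 * (n div chunk) + 2730 * 2 ^ d + 10 \<and> level_inv (Suc d) s')"
      proof (subst wp_Seq, rule wp_mono[OF nd])
        fix t' :: nat and s5
        assume s5: "t' \<le> 1200 * (n div chunk) + 2730 * 2 ^ d \<and> node_inv d (2 ^ Suc d) s5"
        define s6 where "s6 = s5\<lparr>reg := (reg s5)(r_depth := Suc d)\<rparr>"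
        have r5: "level_ready d s5" "reg s5 r_node = 2 ^ Suc d" "reg s5 r_out = out_pos (2 ^ Suc d)"
          "stream w (mem s5 4) 0 (digits d (level (Suc d)))" "outputs (2 ^ Suc d) s5" "counts (2 ^ Suc (Suc d)) s5"
          using s5 by (simp_all add: node_inv_def level_def)
        have "level_inv (Suc d) s6"
          unfolding level_inv_def
        proof (intro conjI)
          show "constants s6"
            by (rule constants_agree[of s5]) (use r5(1) in \<open>auto simp: level_ready_def s6_def\<close>)
          show "outputs (2 ^ Suc d) s6" by (rule outputs_cong[OF r5(5)]) (auto simp: s6_def)
          show "counts (2 ^ Suc (Suc d)) s6" by (rule counts_cong[OF r5(6)]) (auto simp: s6_def)
          show "Suc d mod width \<noteq> 0 \<longrightarrow>
              reg s6 r_shift = shift (Suc d) \<and> stream w (mem s6 4) 0 (digits (Suc d) (level (Suc d)))"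
            using r5(1,4) shift_Suc[of d] by (auto simp: s6_def level_ready_def)
        qed (use r5 in \<open>simp_all add: s6_def\<close>)
        moreover have "Suc d < 2 ^ w" using d big by simp
        moreover have "reg s5 r_depth = d" using r5 by (simp add: level_ready_def)
        ultimately show "wp w (Assign r_depth (Reg r_depth +\<^sub>e Const 1)) s5 (\<lambda>t'' s'.
            t + (t' + t'') \<le> 100 * 2 ^ (chunk * width) + 1200 * (n div chunk) + 2730 * 2 ^ d + 10 \<and> level_inv (Suc d) s')"
          using s4 s5 big w_ge by (simp add: wp_simps s6_def)
      qed
    qed
    then show ?thesis
      by (subst wp_Seq, subst wp_Assign, subst e) (simp add: s3_def, erule wp_mono, auto)
  qed
  show ?thesis
    unfolding level_prog_def
  proof (subst wp_Seq, rule wp_mono_agree[OF 1])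
    fix t :: nat and s1
    assume s1: "t \<le> ?bc + 10 \<and> reg s1 r_shift = shift d \<and> stream w (mem s1 4) 0 (digits d (level d))"
      and ag: "agree (If (Reg r_depth mod\<^sub>e Reg r_width) Skip build_prog) st s1"
    have c1: "constants s1" by (rule constants_agree[OF I(1)]) (use ag in \<open>auto simp: agree_def\<close>)
    have o1: "outputs (2 ^ d) s1" by (rule outputs_cong[OF I(5)]) (use ag in \<open>auto simp: agree_def\<close>)
    have n1: "counts (2 ^ Suc d) s1" by (rule counts_cong[OF I(6)]) (use ag in \<open>auto simp: agree_def\<close>)
    have cp: "wp w copy_prog s1 (\<lambda>t s'. t \<le> 400 * (n div chunk) + 840 \<and> stream w (mem s' 3) 0 (digits d (level d)))"
      by (rule copy_prog) (use c1 s1 d in auto)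
    show "wp w (copy_prog ;; Assign r_bit (Reg r_k -\<^sub>e Const 1 -\<^sub>e Reg r_depth -\<^sub>e Reg r_shift) ;; table_prog ;;
        nodes_prog ;; Assign r_depth (Reg r_depth +\<^sub>e Const 1)) s1
        (\<lambda>t' s'. t + t' \<le> level_cost d \<and> level_inv (Suc d) s')"
    proof (subst wp_Seq, rule wp_mono_agree[OF cp], goal_cases)
      case (1 t' s2)
      have c2: "constants s2" by (rule constants_agree[OF c1]) (use 1 in \<open>auto simp: agree_def\<close>)
      have o2: "outputs (2 ^ d) s2" by (rule outputs_cong[OF o1]) (use 1 in \<open>auto simp: agree_def\<close>)
      have n2: "counts (2 ^ Suc d) s2" by (rule counts_cong[OF n1]) (use 1 in \<open>auto simp: agree_def\<close>)
      show ?case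
        by (rule wp_mono, rule 2)
          (use 1 c2 o2 n2 s1 ag I in \<open>auto simp: agree_def level_cost_def\<close>)
    qed
  qed
qed

end

section \<open>The whole program\<close>

text \<open>There is no logarithm or root among the operations, so \<open>w\<close>,
  \<open>k\<close> and \<open>chunk\<close> are found by linear search in time proportional to
  \<open>w\<close>. The root has size \<open>n\<close> and position 1; its output address is the
  initial 0.\<close>

definition init_prog :: com where
  "init_prog =
     Assign r_w (Const 2) ;;
     While (Reg 0 >>\<^sub>e (Reg r_w -\<^sub>e Const 1)) (Assign r_w (Reg r_w +\<^sub>e Const 1)) ;;
     While (Reg 1 >>\<^sub>e (Reg r_k +\<^sub>e Const 1)) (Assign r_k (Reg r_k +\<^sub>e Const 1)) ;;
     Assign r_chunk (Const 1) ;;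
     While (Reg r_chunk <\<^sub>e Reg r_w div\<^sub>e Const 2 div\<^sub>e (Reg r_chunk +\<^sub>e Const 1))
       (Assign r_chunk (Reg r_chunk +\<^sub>e Const 1)) ;;
     If (Reg r_chunk <\<^sub>e Reg r_k) (Assign r_width (Reg r_chunk)) (Assign r_width (Reg r_k)) ;;
     Assign r_per_word (Reg r_w div\<^sub>e Reg r_k) ;;
     Assign r_node (Const 1) ;;
     Store 9 (Const 1) (Reg 0)"

definition wavelet_prog :: com where
  "wavelet_prog =
     If (Reg 1 <\<^sub>e Const 2) Skip (init_prog ;; While (Reg r_depth <\<^sub>e Reg r_k) level_prog)"

context wavelet
begin

lemma init_prog:
  "wp w init_prog (input_state k s) (\<lambda>t s'. t \<le> 100 * w \<and> level_inv 0 s')"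
proof -
  let ?st = "input_state k s"
  have st: "reg ?st 0 = n" "reg ?st (Suc 0) = 2 ^ k" "\<And>r. r \<noteq> 0 \<Longrightarrow> r \<noteq> 1 \<Longrightarrow> reg ?st r = 0"
    "mem ?st 0 = packed w k s"
    by (simp_all add: input_state_def n_def w_def)
  have big: "2 < (2::nat) ^ w" "w < 2 ^ w" using two_less by simp_all
  have w3: "3 \<le> w" by (rule w_ge)
  define s1 where "s1 = ?st\<lparr>reg := (reg ?st)(r_w := 2)\<rparr>"
  define s2 where "s2 = ?st\<lparr>reg := (reg ?st)(r_w := w)\<rparr>"
  define s3 where "s3 = ?st\<lparr>reg := (reg ?st)(r_w := w, r_k := k)\<rparr>"
  define s4 where "s4 = ?st\<lparr>reg := (reg ?st)(r_w := w, r_k := k, r_chunk := 1)\<rparr>"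
  define s5 where "s5 = ?st\<lparr>reg := (reg ?st)(r_w := w, r_k := k, r_chunk := chunk)\<rparr>"
  have 1: "wp w (While (Reg 0 >>\<^sub>e (Reg r_w -\<^sub>e Const 1)) (Assign r_w (Reg r_w +\<^sub>e Const 1))) s1
    (\<lambda>t s'. t \<le> 12 * w \<and> s' = s2)"
  proof (rule wp_mono, rule wp_While_rule[where N = "w - 2" and T = "\<lambda>i. 4" and
        I = "\<lambda>i s'. s' = ?st\<lparr>reg := (reg ?st)(r_w := i + 2)\<rparr>"])
    fix i s' assume i: "i < w - 2" and s': "s' = ?st\<lparr>reg := (reg ?st)(r_w := i + 2)\<rparr>"
    have i2: "i + 2 < 2 ^ w" using i big by linarith
    have "(2::nat) ^ (i + 1) \<le> 2 ^ (w - 2)" using i by (intro power_increasing) simp_all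
    then have "2 ^ (i + 1) \<le> n" using n_less(2) by linarith
    then have "drop_bit (i + 1) n \<noteq> 0" by (simp add: drop_bit_eq_div div_eq_0_iff)
    moreover have "(i + 2 + 2 ^ w - 1) mod 2 ^ w = i + 1"
      using sub_mod_eq[of 1 "i + 2" w] i2 by simp
    moreover have "i + 2 + 1 < 2 ^ w" using i big by linarith
    ultimately show "eval w (Reg 0 >>\<^sub>e (Reg r_w -\<^sub>e Const 1)) s' \<noteq> 0 \<and>
      wp w (Assign r_w (Reg r_w +\<^sub>e Const 1)) s' (\<lambda>t s'. t \<le> 4 \<and> s' = ?st\<lparr>reg := (reg ?st)(r_w := Suc i + 2)\<rparr>)"
      using s' st w3 by (simp add: wp_simps)
  next
    fix s' assume "s' = ?st\<lparr>reg := (reg ?st)(r_w := w - 2 + 2)\<rparr>"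
    moreover have "w - 2 + 2 = w" using w3 by simp
    ultimately have s': "s' = ?st\<lparr>reg := (reg ?st)(r_w := w)\<rparr>" by (simp only:)
    have "drop_bit (w - 1) n = 0" using n_less(1) by (simp add: drop_bit_eq_div)
    moreover have "(w + 2 ^ w - 1) mod 2 ^ w = w - 1" using sub_mod_eq[of 1 w w] w3 big by simp
    ultimately show "eval w (Reg 0 >>\<^sub>e (Reg r_w -\<^sub>e Const 1)) s' = 0"
      using s' st w3 by simp
  next
    show "s1 = ?st\<lparr>reg := (reg ?st)(r_w := 0 + 2)\<rparr>" by (simp only: s1_def add_0)
  next
    fix t s' assume a: "t \<le> (\<Sum>i<w - 2. 4) + (w - 2 + 1) * (cost (Reg 0 >>\<^sub>e (Reg r_w -\<^sub>e Const 1)) + 1) \<and>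
      s' = ?st\<lparr>reg := (reg ?st)(r_w := w - 2 + 2)\<rparr>"
    have "w - 2 + 2 = w" using w3 by simp
    with a have "s' = s2" unfolding s2_def by (simp only:)
    have "t \<le> 10 * (w - 2) + 6" using a by simp
    then have "t \<le> 12 * w" using w3 by linarith
    with \<open>s' = s2\<close> show "t \<le> 12 * w \<and> s' = s2" by simp
  qed
  have 2: "wp w (While (Reg 1 >>\<^sub>e (Reg r_k +\<^sub>e Const 1)) (Assign r_k (Reg r_k +\<^sub>e Const 1))) s2
    (\<lambda>t s'. t \<le> 12 * w \<and> s' = s3)"
  proof (rule wp_mono, rule wp_While_rule[where N = k and T = "\<lambda>i. 4" and
        I = "\<lambda>i s'. s' = ?st\<lparr>reg := (reg ?st)(r_w := w, r_k := i)\<rparr>"])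
    show "s2 = ?st\<lparr>reg := (reg ?st)(r_w := w, r_k := 0)\<rparr>"
      using st(3)[of r_k] by (auto simp: s2_def fun_eq_iff)
  next
    fix i s' assume i: "i < k" and s': "s' = ?st\<lparr>reg := (reg ?st)(r_w := w, r_k := i)\<rparr>"
    have "(2::nat) ^ (i + 1) \<le> 2 ^ k" using i by (intro power_increasing) simp_all
    then have "drop_bit (i + 1) (2 ^ k :: nat) \<noteq> 0" by (simp add: drop_bit_eq_div div_eq_0_iff)
    moreover have "Suc i < 2 ^ w" using i k_less big by linarith
    ultimately show "eval w (Reg 1 >>\<^sub>e (Reg r_k +\<^sub>e Const 1)) s' \<noteq> 0 \<and>
      wp w (Assign r_k (Reg r_k +\<^sub>e Const 1)) s' (\<lambda>t s'. t \<le> 4 \<and> s' = ?st\<lparr>reg := (reg ?st)(r_w := w, r_k := Suc i)\<rparr>)"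
      using s' st w3 by (simp add: wp_simps)
  next
    fix s' assume s': "s' = ?st\<lparr>reg := (reg ?st)(r_w := w, r_k := k)\<rparr>"
    have "drop_bit (k + 1) (2 ^ k :: nat) = 0" by (simp add: drop_bit_eq_div)
    moreover have "Suc k < 2 ^ w" using k_less big by linarith
    ultimately show "eval w (Reg 1 >>\<^sub>e (Reg r_k +\<^sub>e Const 1)) s' = 0"
      using s' st w3 by simp
  qed (use k_less in \<open>simp_all add: s3_def\<close>)
  let ?c = "Reg r_chunk <\<^sub>e Reg r_w div\<^sub>e Const 2 div\<^sub>e (Reg r_chunk +\<^sub>e Const 1)"
  have cw: "chunk \<le> w div 2" using chunk_pos by (metis le_square order_trans)
  \<comment> \<open>The condition \<open>(i + 1)^2 <= w div 2\<close> written as a division, which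
    keeps all intermediate values at most \<open>w\<close>.\<close>
  have test: "i < w div 2 div (i + 1) \<longleftrightarrow> i + 1 \<le> chunk" for i
    unfolding chunk_def le_floor_sqrt_iff
    by (simp add: Suc_le_eq[symmetric] less_eq_div_iff_mult_less_eq power2_eq_square del: Suc_le_eq)
  have 3: "wp w (While ?c (Assign r_chunk (Reg r_chunk +\<^sub>e Const 1))) s4
    (\<lambda>t s'. t \<le> 20 * w \<and> s' = s5)"
  proof (rule wp_mono, rule wp_While_rule[where N = "chunk - 1" and T = "\<lambda>i. 4" and
        I = "\<lambda>i s'. s' = ?st\<lparr>reg := (reg ?st)(r_w := w, r_k := k, r_chunk := i + 1)\<rparr>"])
    fix i s' assume i: "i < chunk - 1" and s': "s' = ?st\<lparr>reg := (reg ?st)(r_w := w, r_k := k, r_chunk := i + 1)\<rparr>"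
    have "i + 1 < w div 2 div (i + 1 + 1)" using i unfolding test by simp
    moreover have "i + 2 < 2 ^ w" using i cw big by linarith
    ultimately show "eval w ?c s' \<noteq> 0 \<and> wp w (Assign r_chunk (Reg r_chunk +\<^sub>e Const 1)) s'
      (\<lambda>t s'. t \<le> 4 \<and> s' = ?st\<lparr>reg := (reg ?st)(r_w := w, r_k := k, r_chunk := Suc i + 1)\<rparr>)"
      using s' w3 big by (simp add: wp_simps)
  next
    fix s' assume s': "s' = ?st\<lparr>reg := (reg ?st)(r_w := w, r_k := k, r_chunk := chunk - 1 + 1)\<rparr>"
    have "\<not> chunk < w div 2 div (chunk + 1)" unfolding test by simp
    moreover have "chunk + 1 < 2 ^ w" using cw big w3 by linarith
    ultimately show "eval w ?c s' = 0" using s' w3 big chunk_pos by simp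
  qed (use cw chunk_pos in \<open>simp_all add: s4_def s5_def\<close>)
  let ?fin = "If (Reg r_chunk <\<^sub>e Reg r_k) (Assign r_width (Reg r_chunk)) (Assign r_width (Reg r_k)) ;;
     Assign r_per_word (Reg r_w div\<^sub>e Reg r_k) ;; Assign r_node (Const 1) ;; Store 9 (Const 1) (Reg 0)"
  define s6 where "s6 = s5\<lparr>mem := (mem s5)(9 := (mem s5 9)(1 := n)),
    reg := (reg s5)(r_width := width, r_per_word := w div k, r_node := 1)\<rparr>"
  have 4: "wp w ?fin s5 (\<lambda>t s'. t \<le> 20 \<and> s' = s6)"
    using w3 st by (simp add: wp_simps s5_def s6_def width_def)
  \<comment> \<open>Level 0 starts a group, no node lies before the root, and the root is the only
    position below 2; what remains to be known is its size.\<close>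
  have 5: "level_inv 0 s6"
    using st by (auto simp: level_inv_def constants_def s6_def s5_def out_pos_def outputs_def counts_def
        node_root n_def less_Suc_eq numeral_2_eq_2)
  show ?thesis
    unfolding init_prog_def
    apply (subst wp_Seq, subst wp_Assign)
    apply (subst wp_Seq, rule wp_mono[where Q = "\<lambda>t s'. t \<le> 12 * w \<and> s' = s2"])
    subgoal using 1 two_less by (simp add: s1_def)
    apply (subst wp_Seq, rule wp_mono[where Q = "\<lambda>t s'. t \<le> 12 * w \<and> s' = s3"])
    subgoal using 2 by simp
    apply (subst wp_Seq, subst wp_Assign)
    apply (subst wp_Seq, rule wp_mono[where Q = "\<lambda>t s'. t \<le> 20 * w \<and> s' = s5"])
    subgoal using 3 w3 by (simp add: s3_def s4_def)
    apply (rule wp_mono[where Q = "\<lambda>t s'. t \<le> 20 \<and> s' = s6"])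
    subgoal using 4 by simp
    using 5 w3 by simp
qed

lemma levels_prog:
  assumes "level_inv 0 st"
  shows "wp w (While (Reg r_depth <\<^sub>e Reg r_k) level_prog) st
    (\<lambda>t s'. t \<le> (\<Sum>d<k. level_cost d) + (k + 1) * 4 \<and> level_inv k s')"
proof -
  have "wp w (While (Reg r_depth <\<^sub>e Reg r_k) level_prog) st
    (\<lambda>t s'. t \<le> (\<Sum>d<k. level_cost d) + (k + 1) * (cost (Reg r_depth <\<^sub>e Reg r_k) + 1) \<and> level_inv k s')"
  proof (rule wp_While_rule[where I = level_inv])
    show "level_inv 0 st" by fact
  next
    fix d s' assume "d < k" "level_inv d s'"
    then show "eval w (Reg r_depth <\<^sub>e Reg r_k) s' \<noteq> 0 \<and>
      wp w level_prog s' (\<lambda>t s''. t \<le> level_cost d \<and> level_inv (Suc d) s'')"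
      using level_prog[of d s'] by (auto simp: level_inv_def constants_def)
  next
    fix s' assume "level_inv k s'"
    then show "eval w (Reg r_depth <\<^sub>e Reg r_k) s' = 0" by (simp add: level_inv_def constants_def)
  qed
  then show ?thesis by (rule wp_mono) simp
qed

lemma wavelet_prog:
  "wp w wavelet_prog (input_state k s) (\<lambda>t s'. t \<le> 100 * w + (\<Sum>d<k. level_cost d) + 4 * k + 10 \<and>
     stores_bitmasks w (wavelet_tree k s) s')"
proof -
  have "(2::nat) ^ 1 \<le> 2 ^ k" using k by (intro power_increasing) simp_all
  then have "\<not> 2 ^ k < (2::nat)" by simp
  then have c: "eval w (Reg 1 <\<^sub>e Const 2) (input_state k s) = 0"
    using two_less by (simp add: input_state_def)
  have fin: "stores_bitmasks w (wavelet_tree k s) s'" if "level_inv k s'" for s'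
    by (rule stores_bitmasksI) (use that in \<open>auto simp: level_inv_def outputs_def\<close>)
  have "wp w (init_prog ;; While (Reg r_depth <\<^sub>e Reg r_k) level_prog) (input_state k s)
    (\<lambda>t s'. t \<le> 100 * w + (\<Sum>d<k. level_cost d) + 4 * k + 4 \<and> stores_bitmasks w (wavelet_tree k s) s')"
    by (subst wp_Seq, rule wp_mono[OF init_prog], rule wp_mono[OF levels_prog]) (auto simp: fin)
  then show ?thesis
    unfolding wavelet_prog_def wp_If c by simp (erule wp_mono, auto)
qed

end

section \<open>Running time\<close>

text \<open>Counts the rebuilds: one for every group of \<open>c\<close> levels, including an
  incomplete last group.\<close>

lemma count_multiples:
  assumes "0 < c"
  shows "(\<Sum>d<m. if d mod c = 0 then B else (0::nat)) = B * ((m + c - 1) div c)"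
proof (induction m)
  case (Suc m)
  have "(m + c) div c = (if (m + c) mod c = 0 then Suc ((m + c - 1) div c) else (m + c - 1) div c)"
    using div_Suc[of "m + c - 1" c] assms by simp
  then show ?case using Suc by simp
qed (use assms in simp)

text \<open>\<open>2 ^ l / l\<close> does not decrease, because \<open>l + 1 <= 2 * l\<close>. This
  lets the constant costs of all nodes, about \<open>2 ^ k\<close> in total, be charged to
  \<open>n * k / chunk\<close>, which is less than \<open>n\<close> if
  \<open>k < chunk\<close>.\<close>

lemma pow2_mult_mono:
  fixes k l :: nat
  assumes "k \<le> l" "0 < k"
  shows "2 ^ k * l \<le> 2 ^ l * k"
  using assms
proof (induction l rule: dec_induct)
  case (step l)
  have "2 ^ k * Suc l \<le> 2 * (2 ^ k * l)" using step by simp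
  also have "\<dots> \<le> 2 * (2 ^ l * k)" using step by simp
  finally show ?case by simp
qed simp

context wavelet
begin

text \<open>The terms of lower order, namely tables, initialisation and node constants, multiplied
  by \<open>chunk\<close> for comparison with \<open>n * k / chunk\<close>. The factor 4 is the
  slack of the word size: \<open>2 ^ (w - 2) <= n\<close>. The last bound uses
  \<open>k <= w - 2\<close> and the monotonicity of \<open>2 ^ l / l\<close>.\<close>

lemma chunk_bounds:
  "2 ^ (chunk * width) * chunk \<le> 4 * n" "w * chunk \<le> 4 * n" "chunk \<le> w - 2" "2 ^ k * chunk \<le> n * k"
proof -
  have "w = Suc (Suc (w - 2))" using w_ge by simp
  then have "(2::nat) ^ w = 2 * (2 * 2 ^ (w - 2))" by (metis power_Suc)
  then have w4: "2 ^ w \<le> 4 * n" using n_less(2) by simp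
  define h where "h = w div 2"
  have h: "chunk \<le> h" "h + h \<le> w" using chunk_pos by (auto simp: h_def intro: order_trans[OF le_square])
  have "2 ^ (chunk * width) * chunk \<le> 2 ^ h * 2 ^ h"
    using width_pos(4)[folded h_def] order_trans[OF h(1) less_imp_le[OF less_exp]]
    by (intro mult_le_mono power_increasing) simp_all
  also have "\<dots> \<le> 2 ^ w" using h(2) by (simp flip: power_add)
  finally show "2 ^ (chunk * width) * chunk \<le> 4 * n" using w4 by simp
  show "w * chunk \<le> 4 * n" using w_chunk_less w4 by simp
  show cw: "chunk \<le> w - 2" using h w_ge by (simp add: h_def)
  have "2 ^ k * chunk \<le> 2 ^ k * (w - 2)" using cw by simp
  also have "\<dots> \<le> 2 ^ (w - 2) * k" using k_less k by (intro pow2_mult_mono) simp_all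
  also have "\<dots> \<le> n * k" using n_less(2) by simp
  finally show "2 ^ k * chunk \<le> n * k" .
qed

lemma sqrt_log_le: "sqrt (log 2 (real n)) \<le> 3 * real chunk"
proof -
  have "real n < 2 ^ w" using n_less(1) two_n_less by (metis of_nat_less_iff of_nat_numeral of_nat_power stream_fits(2))
  then have 1: "log 2 (real n) \<le> real w" using n_pos by (intro less_imp_le log2_of_power_less) auto
  have "w div 2 < (Suc chunk)\<^sup>2" unfolding chunk_def by (rule Suc_floor_sqrt_power2_gt)
  also have "(Suc chunk)\<^sup>2 \<le> (2 * chunk)\<^sup>2" using chunk_pos by (intro power_mono) simp_all
  also have "\<dots> = 4 * chunk\<^sup>2" by (simp add: power_mult_distrib)
  finally have "w \<le> 8 * chunk\<^sup>2" by simp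
  \<comment> \<open>Raising 8 to the square number 9 makes the root the integer factor 3.\<close>
  then have "real w \<le> real (9 * chunk\<^sup>2)" by (intro of_nat_mono) simp
  also have "\<dots> = (3 * real chunk)\<^sup>2" by (simp add: power_mult_distrib)
  finally show ?thesis using 1 by (intro real_le_lsqrt) auto
qed

lemma total_cost:
  "real (100 * w + (\<Sum>d<k. level_cost d) + 4 * k + 10) \<le> 20000 * (real n * real k / real chunk)"
proof -
  define R where "R = real n * real k / real chunk"
  have c: "0 < real chunk" "1 \<le> real k" "0 \<le> real n" using chunk_pos k by simp_all
  have R: "real x \<le> y * R" if "real x * real chunk \<le> y * (real n * real k)" for x :: nat and y :: real
    using that c by (simp add: R_def field_simps)
  have nk: "real n \<le> real n * real k" using c mult_left_mono[of 1 "real k" "real n"] by simp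
  have a1: "real w \<le> 4 * R"
  proof (rule R)
    have "real w * real chunk \<le> 4 * real n" using chunk_bounds(2) by (metis of_nat_le_iff of_nat_mult of_nat_numeral)
    then show "real w * real chunk \<le> 4 * (real n * real k)" using nk by linarith
  qed
  have cn: "real chunk \<le> 2 * real n"
  proof -
    have "2 * chunk \<le> 2 ^ (chunk * width) * chunk"
      using power_increasing[of 1 "chunk * width" "2::nat"] chunk_pos width_pos by (intro mult_le_mono1) simp
    then show ?thesis using chunk_bounds(1) by linarith
  qed
  have a2: "real k \<le> 2 * R"
    by (rule R) (use mult_left_mono[OF cn, of "real k"] in \<open>simp add: algebra_simps\<close>)
  have a3: "real (2 ^ k) \<le> 1 * R"
    by (rule R) (use chunk_bounds(4) in \<open>simp flip: of_nat_mult of_nat_power\<close>)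
  have nc: "real (n div chunk) \<le> real n / real chunk" by (rule of_nat_div_le_of_nat)
  have a4: "real k * real (n div chunk) \<le> R"
    using mult_left_mono[OF nc, of "real k"] by (simp add: R_def mult.commute)
  have a5: "real k * real (2 ^ (chunk * width)) \<le> 4 * R"
  proof -
    have "real (2 ^ (chunk * width)) * real chunk \<le> 4 * real n"
      using chunk_bounds(1) by (metis of_nat_le_iff of_nat_mult of_nat_numeral)
    then have "real (2 ^ (chunk * width)) \<le> 4 * real n / real chunk" using c by (simp add: field_simps)
    from mult_left_mono[OF this, of "real k"] show ?thesis by (simp add: R_def mult_ac)
  qed
  \<comment> \<open>For \<open>k <= chunk\<close> there is one rebuild, and
    \<open>k <= 2 * R\<close> turns its additive 900 into at most \<open>1800 * R\<close>, besides
    \<open>400 * R\<close>. Otherwise there are at most \<open>2 * k / chunk\<close> rebuilds of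
    cost \<open>1000 * n\<close>, hence \<open>2000 * R\<close>.\<close>
  have a6: "real (\<Sum>d<k. if d mod width = 0 then build_cost else 0) \<le> 2300 * R"
  proof (cases "k \<le> chunk")
    case True
    then have "width = k" by (simp add: width_def)
    then have "(\<Sum>d<k. if d mod width = 0 then build_cost else 0) = build_cost * ((k + k - 1) div k)"
      by (simp only: count_multiples[OF k])
    also have "(k + k - 1) div k = 1" using k by (intro div_nat_eqI) simp_all
    finally have "real (\<Sum>d<k. if d mod width = 0 then build_cost else 0) = 400 * real (n div chunk) + 900"
      using True by (simp add: build_cost_def)
    moreover have "real (n div chunk) \<le> real k * real (n div chunk)"
      using mult_right_mono[OF c(2), of "real (n div chunk)"] by simp
    ultimately show ?thesis using a2 a4 c by linarith
  next
    case False
    then have wd: "width = chunk" "build_cost = 1000 * n" by (simp_all add: width_def build_cost_def)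
    have "real ((k + chunk - 1) div chunk) \<le> real (k + chunk - 1) / real chunk" by (rule of_nat_div_le_of_nat)
    also have "\<dots> \<le> 2 * real k / real chunk" using False c by (intro divide_right_mono) simp_all
    finally have "real (1000 * n) * real ((k + chunk - 1) div chunk) \<le> real (1000 * n) * (2 * real k / real chunk)"
      by (intro mult_left_mono) simp_all
    moreover have "(\<Sum>d<k. if d mod width = 0 then build_cost else 0) = (1000 * n) * ((k + chunk - 1) div chunk)"
      unfolding wd using chunk_pos by (intro count_multiples) simp
    ultimately have "real (\<Sum>d<k. if d mod width = 0 then build_cost else 0) \<le> real (1000 * n) * (2 * real k / real chunk)"
      by (simp only: of_nat_mult)
    then have "real (\<Sum>d<k. if d mod width = 0 then build_cost else 0) \<le> 2000 * R"
      by (simp only: R_def of_nat_mult of_nat_numeral) (simp add: field_simps)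
    moreover have "0 \<le> R" by (simp add: R_def)
    ultimately show ?thesis by linarith
  qed
  have "(\<Sum>d<k. 2 ^ d) \<le> (2::nat) ^ k" by (induction k) simp_all
  then have pw: "real (\<Sum>d<k. 2 ^ d) \<le> R" using a3 by (metis mult_1 of_nat_mono order_trans)
  have "(\<Sum>d<k. level_cost d) = (\<Sum>d<k. if d mod width = 0 then build_cost else 0) + 1600 * (k * (n div chunk)) +
    2730 * (\<Sum>d<k. 2 ^ d) + 100 * (k * 2 ^ (chunk * width)) + 1000 * k"
    unfolding level_cost_def by (simp add: sum.distrib flip: sum_distrib_left)
  then have "real (\<Sum>d<k. level_cost d) = real (\<Sum>d<k. if d mod width = 0 then build_cost else 0) +
    1600 * (real k * real (n div chunk)) + 2730 * real (\<Sum>d<k. 2 ^ d) +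
    100 * (real k * real (2 ^ (chunk * width))) + 1000 * real k"
    by (simp only: of_nat_add of_nat_mult of_nat_numeral)
  then have "real (\<Sum>d<k. level_cost d) \<le> 2300 * R + 1600 * R + 2730 * R + 400 * R + 2000 * R"
    using a6 a4 pw a5 a2 by linarith
  moreover have "real (100 * w + (\<Sum>d<k. level_cost d) + 4 * k + 10) =
      100 * real w + real (\<Sum>d<k. level_cost d) + 4 * real k + 10"
    by (simp only: of_nat_add of_nat_mult of_nat_numeral)
  ultimately show ?thesis using a1 a2 c unfolding R_def[symmetric] by linarith
qed

text \<open>60000 is 20000 times the factor 3 between \<open>chunk\<close> and the root of the
  logarithm.\<close>

lemma cost_le_time_bound:
  "real (100 * w + (\<Sum>d<k. level_cost d) + 4 * k + 10) \<le> 60000 * time_bound n (2 ^ k)"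
proof -
  have pos: "0 < sqrt (log 2 (real n))" using n_pos by simp
  have lg: "log 2 (real (2 ^ k)) = real k" by simp
  have "real n * real k / real chunk \<le> 3 * (real n * real k / sqrt (log 2 (real n)))"
    using sqrt_log_le mult_left_mono[OF sqrt_log_le, of "real n * real k"] pos chunk_pos
    by (simp add: field_simps)
  also have "real n * real k / sqrt (log 2 (real n)) \<le> time_bound n (2 ^ k)"
    unfolding time_bound_def lg by simp
  finally show ?thesis using total_cost by linarith
qed

end

theorem theorem1:
  "\<exists>(P :: com) (C :: real). \<forall>(n :: nat) (\<sigma> :: nat) (k :: nat) (s :: nat list).
     length s = n \<and> \<sigma> = 2 ^ k \<and> \<sigma> \<le> n \<and> set s \<subseteq> {..<\<sigma>} \<longrightarrow>
     (\<exists>t st. run (word_size n) P (input_state k s) t st \<and>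
        stores_bitmasks (word_size n) (wavelet_tree k s) st \<and>
        real t \<le> C * time_bound n \<sigma>)"
proof (rule exI[of _ wavelet_prog], rule exI[of _ 60000], intro allI impI)
  fix n \<sigma> k :: nat and s :: "nat list"
  assume *: "length s = n \<and> \<sigma> = 2 ^ k \<and> \<sigma> \<le> n \<and> set s \<subseteq> {..<\<sigma>}"
  have "wp (word_size n) wavelet_prog (input_state k s) (\<lambda>t st.
      stores_bitmasks (word_size n) (wavelet_tree k s) st \<and> real t \<le> 60000 * time_bound n \<sigma>)"
  proof (cases "k = 0")
    \<comment> \<open>For a unary alphabet the tree is a leaf without bitmasks; the maximum with 1
      in \<open>time_bound\<close> pays for the single test.\<close>
    case True
    have "(2::nat) ^ 1 < 2 ^ word_size n" by (intro power_strict_increasing) (simp_all add: word_size_def)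
    then have "2 mod 2 ^ word_size n = (2::nat)" by simp
    moreover have "1 \<le> time_bound n \<sigma>" by (simp add: time_bound_def)
    ultimately show ?thesis using True
      by (simp add: wavelet_prog_def wp_simps input_state_def stores_bitmasks_def)
  next
    case False
    then interpret W: wavelet k s using * by unfold_locales auto
    have n: "W.n = n" "W.w = word_size n" using * by (simp_all add: W.n_def W.w_def)
    show ?thesis
      by (rule wp_mono[OF W.wavelet_prog[unfolded n]])
        (use W.cost_le_time_bound[unfolded n] * in \<open>auto intro: order_trans[OF of_nat_mono]\<close>)
  qed
  then show "\<exists>t st. run (word_size n) wavelet_prog (input_state k s) t st \<and>
      stores_bitmasks (word_size n) (wavelet_tree k s) st \<and> real t \<le> 60000 * time_bound n \<sigma>"
    by (auto simp: wp_def)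
qed

end
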